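(* Let $(X,f)$ be a topological dynamical system and $K$ be a non-empty compact subset of $X$. Suppose that $\varphi\in C(X,\mathbb{R})$ with $\varphi>0$. Then for all $d\in\mathscr{D}(X)$, $$\overline{\mathrm{BSmdim}}_{M,K,f}(\varphi,d)=\limsup_{\epsilon\to0}\frac{\sup\{\underline h_{\varphi,\mu}(f,\epsilon):\mu\in M(X),\ \mu(K)=1\}}{\log\frac1\epsilon},$$ $$\overline{\mathrm{BSPmdim}}_{M,K,f}(\varphi,d)=\limsup_{\epsilon\to0}\frac{\sup\{\overline h_{\varphi,\mu}(f,\epsilon):\mu\in M(X),\ \mu(K)=1\}}{\log\frac1\epsilon}.$$
   Context: A topological dynamical system $(X,f)$ is a compact metrizable space $X$ with a continuous map $f:X\to X$; $\mathscr{D}(X)$ is the set of compatible metrics; $M(X)$ is the set of Borel probability measures on $X$. $d_n(x,y)=\max_{0\le j\le n-1}d(f^jx,f^jy)$, $B_n(x,\epsilon)=\{y:d_n(x,y)<\epsilon\}$, $\overline B_n(x,\epsilon)=\{y:d_n(x,y)\le\epsilon\}$, $S_n\varphi=\sum_{i=0}^{n-1}\varphi\circ f^i$. Throughout $0<\epsilon<1$, $\lambda\in\mathbb{R}$, $N\in\mathbb{N}$, $Z\subset X$, $\varphi>0$. For $\mu\in M(X)$, $$\underline h_{\varphi,\mu}(f,\epsilon)=\int\liminf_{n\to\infty}-\frac{\log\mu(B_n(x,\epsilon))}{S_n\varphi(x)}\,d\mu(x),\qquad \overline h_{\varphi,\mu}(f,\epsilon)=\int\limsup_{n\to\infty}-\frac{\log\mu(B_n(x,\epsilon))}{S_n\varphi(x)}\,d\mu(x).$$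 BS metric mean dimension on $Z$ with respect to $\varphi$: let $R(f,d,\varphi,\lambda,Z,N,\epsilon)=\inf\sum_{i\in I}e^{-\lambda\sup_{y\in B_{n_i}(x_i,\epsilon)}S_{n_i}\varphi(y)}$ over all finite or countable covers $\{B_{n_i}(x_i,\epsilon)\}_{i\in I}$ of $Z$ with $n_i\ge N$; $R(f,d,\varphi,\lambda,Z,\epsilon)=\lim_{N\to\infty}R(f,d,\varphi,\lambda,Z,N,\epsilon)$; $R(f,d,\varphi,Z,\epsilon)=\inf\{\lambda:R(f,d,\varphi,\lambda,Z,\epsilon)=0\}=\sup\{\lambda:R(f,d,\varphi,\lambda,Z,\epsilon)=\infty\}$; $\overline{\mathrm{BSmdim}}_{M,Z,f}(\varphi,d)=\limsup_{\epsilon\to0}R(f,d,\varphi,Z,\epsilon)/\log\frac1\epsilon$. Packing BS metric mean dimension on $Z$ with respect to $\varphi$: let $P_p(f,d,\varphi,Z,\lambda,N,\epsilon)=\sup\sum_{i\in I}e^{-\lambda\sup_{y\in B_{n_i}(x_i,\epsilon)}S_{n_i}\varphi(y)}$ over all finite or countable pairwise disjoint families of closed balls $\{\overline B_{n_i}(x_i,\epsilon)\}_{i\in I}$ with $n_i\ge N$, $x_i\in Z$; $P_p(f,d,\varphi,Z,\lambda,\epsilon)=\lim_{N\to\infty}P_p(f,d,\varphi,Z,\lambda,N,\epsilon)$; $\mathcal P_p(f,d,\varphi,Z,\lambda,\epsilon)=\inf\{\sum_{i\ge1}P_p(f,d,\varphi,Z_i,\lambda,\epsilon):\bigcup_{i\ge1}Z_i\supseteq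 Z\}$; $\overline{\mathrm{BSPmdim}}_{M,Z,f}(\varphi,d,\epsilon)=\inf\{\lambda:\mathcal P_p(f,d,\varphi,Z,\lambda,\epsilon)=0\}=\sup\{\lambda:\mathcal P_p(f,d,\varphi,Z,\lambda,\epsilon)=\infty\}$; $\overline{\mathrm{BSPmdim}}_{M,Z,f}(\varphi,d)=\limsup_{\epsilon\to0}\overline{\mathrm{BSPmdim}}_{M,Z,f}(\varphi,d,\epsilon)/\log\frac1\epsilon$. *)

theory Defs
  imports "HOL-Probability.Probability"
begin

definition is_tds :: "('a::topological_space \<Rightarrow> 'a) \<Rightarrow> bool" where
  "is_tds f \<longleftrightarrow>
     compact (UNIV :: 'a set) \<and> metrizable_space (euclidean :: 'a topology) \<and> continuous_on UNIV f"

definition compatible_metrics :: "('a::topological_space \<Rightarrow> 'a \<Rightarrow> real) set" where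
  "compatible_metrics =
     {d. Metric_space UNIV d \<and> Metric_space.mtopology UNIV d = euclidean}"

definition borel_probs :: "'a::topological_space measure set" where
  "borel_probs = {\<mu>. prob_space \<mu> \<and> sets \<mu> = sets borel}"

text \<open>
  For \<open>n = 0\<close> the maximum is over the empty set and unspecified. Every notion below
  only depends on large \<open>n\<close>, so this value plays no role.
\<close>
definition bowen_dist ::
    "('a \<Rightarrow> 'a \<Rightarrow> real) \<Rightarrow> ('a \<Rightarrow> 'a) \<Rightarrow> nat \<Rightarrow> 'a \<Rightarrow> 'a \<Rightarrow> real" where
  "bowen_dist d f n x y = Max ((\<lambda>j. d ((f ^^ j) x) ((f ^^ j) y)) ` {..<n})"

definition bowen_ball ::
    "('a \<Rightarrow> 'a \<Rightarrow> real) \<Rightarrow> ('a \<Rightarrow> 'a) \<Rightarrow> nat \<Rightarrow> 'a \<Rightarrow> real \<Rightarrow> 'a set" where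
  "bowen_ball d f n x \<epsilon> = {y. bowen_dist d f n x y < \<epsilon>}"

definition bowen_cball ::
    "('a \<Rightarrow> 'a \<Rightarrow> real) \<Rightarrow> ('a \<Rightarrow> 'a) \<Rightarrow> nat \<Rightarrow> 'a \<Rightarrow> real \<Rightarrow> 'a set" where
  "bowen_cball d f n x \<epsilon> = {y. bowen_dist d f n x y \<le> \<epsilon>}"

definition birkhoff_sum :: "('a \<Rightarrow> 'a) \<Rightarrow> ('a \<Rightarrow> real) \<Rightarrow> nat \<Rightarrow> 'a \<Rightarrow> real" where
  "birkhoff_sum f \<phi> n x = (\<Sum>i<n. \<phi> ((f ^^ i) x))"

text \<open>Logarithm on \<open>[0, \<infinity>)\<close> with \<open>log 0 = - \<infinity>\<close>, whereas \<open>ln 0 = 0\<close> in HOL.\<close>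
definition elog :: "real \<Rightarrow> ereal" where
  "elog p = (if p = 0 then - \<infinity> else ereal (ln p))"

text \<open>
  The integrands are nonnegative (when \<open>\<phi> > 0\<close>) and may take the value \<open>\<infinity>\<close>, hence the
  nonnegative integral.
\<close>
definition lower_entropy ::
    "('a::topological_space \<Rightarrow> 'a \<Rightarrow> real) \<Rightarrow> ('a \<Rightarrow> 'a) \<Rightarrow> ('a \<Rightarrow> real) \<Rightarrow> 'a measure \<Rightarrow> real \<Rightarrow> ennreal"
  where
  "lower_entropy d f \<phi> \<mu> \<epsilon> =
     (\<integral>\<^sup>+ x. e2ennreal (liminf (\<lambda>n.
        - elog (measure \<mu> (bowen_ball d f n x \<epsilon>)) / ereal (birkhoff_sum f \<phi> n x))) \<partial>\<mu>)"

definition upper_entropy ::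
    "('a::topological_space \<Rightarrow> 'a \<Rightarrow> real) \<Rightarrow> ('a \<Rightarrow> 'a) \<Rightarrow> ('a \<Rightarrow> real) \<Rightarrow> 'a measure \<Rightarrow> real \<Rightarrow> ennreal"
  where
  "upper_entropy d f \<phi> \<mu> \<epsilon> =
     (\<integral>\<^sup>+ x. e2ennreal (limsup (\<lambda>n.
        - elog (measure \<mu> (bowen_ball d f n x \<epsilon>)) / ereal (birkhoff_sum f \<phi> n x))) \<partial>\<mu>)"

text \<open>
  The supremum is a real one: it is taken over a bounded set since \<open>\<phi>\<close> is continuous on a
  compact space.
\<close>
definition ball_weight ::
    "('a \<Rightarrow> 'a \<Rightarrow> real) \<Rightarrow> ('a \<Rightarrow> 'a) \<Rightarrow> ('a \<Rightarrow> real) \<Rightarrow> real \<Rightarrow> real \<Rightarrow> nat \<Rightarrow> 'a \<Rightarrow> ennreal" where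
  "ball_weight d f \<phi> lam \<epsilon> n x =
     ennreal (exp (- lam * (SUP y\<in>bowen_ball d f n x \<epsilon>. birkhoff_sum f \<phi> n y)))"

text \<open>
  A finite or countable family of Bowen balls is a set \<open>I\<close> of natural numbers as index set
  (finite or infinite, possibly empty) with sequences \<open>n\<close> of times and \<open>x\<close> of centres, of
  which only the values on \<open>I\<close> matter.
\<close>
definition BS_pre ::
    "('a \<Rightarrow> 'a \<Rightarrow> real) \<Rightarrow> ('a \<Rightarrow> 'a) \<Rightarrow> ('a \<Rightarrow> real) \<Rightarrow> real \<Rightarrow> 'a set \<Rightarrow> nat \<Rightarrow> real \<Rightarrow> ennreal" where
  "BS_pre d f \<phi> lam Z N \<epsilon> =
     Inf {\<Sum>\<^sub>\<infinity>i\<in>I. ball_weight d f \<phi> lam \<epsilon> (n i) (x i) | (I :: nat set) (n :: nat \<Rightarrow> nat) x.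
            (\<forall>i\<in>I. N \<le> n i) \<and> Z \<subseteq> (\<Union>i\<in>I. bowen_ball d f (n i) (x i) \<epsilon>)}"

definition BS_outer ::
    "('a \<Rightarrow> 'a \<Rightarrow> real) \<Rightarrow> ('a \<Rightarrow> 'a) \<Rightarrow> ('a \<Rightarrow> real) \<Rightarrow> real \<Rightarrow> 'a set \<Rightarrow> real \<Rightarrow> ennreal" where
  "BS_outer d f \<phi> lam Z \<epsilon> = lim (\<lambda>N. BS_pre d f \<phi> lam Z N \<epsilon>)"

definition BS_crit ::
    "('a \<Rightarrow> 'a \<Rightarrow> real) \<Rightarrow> ('a \<Rightarrow> 'a) \<Rightarrow> ('a \<Rightarrow> real) \<Rightarrow> 'a set \<Rightarrow> real \<Rightarrow> ereal" where
  "BS_crit d f \<phi> Z \<epsilon> = Inf {ereal lam | lam. BS_outer d f \<phi> lam Z \<epsilon> = 0}"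

definition upper_BSmdim ::
    "('a \<Rightarrow> 'a \<Rightarrow> real) \<Rightarrow> ('a \<Rightarrow> 'a) \<Rightarrow> ('a \<Rightarrow> real) \<Rightarrow> 'a set \<Rightarrow> ereal" where
  "upper_BSmdim d f \<phi> Z =
     Limsup (at_right 0) (\<lambda>\<epsilon>. BS_crit d f \<phi> Z \<epsilon> / ereal (ln (1 / \<epsilon>)))"

definition BSP_pre ::
    "('a \<Rightarrow> 'a \<Rightarrow> real) \<Rightarrow> ('a \<Rightarrow> 'a) \<Rightarrow> ('a \<Rightarrow> real) \<Rightarrow> 'a set \<Rightarrow> real \<Rightarrow> nat \<Rightarrow> real \<Rightarrow> ennreal" where
  "BSP_pre d f \<phi> Z lam N \<epsilon> =
     Sup {\<Sum>\<^sub>\<infinity>i\<in>I. ball_weight d f \<phi> lam \<epsilon> (n i) (x i) | (I :: nat set) (n :: nat \<Rightarrow> nat) x.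
            (\<forall>i\<in>I. N \<le> n i \<and> x i \<in> Z) \<and>
            disjoint_family_on (\<lambda>i. bowen_cball d f (n i) (x i) \<epsilon>) I}"

definition BSP_lim ::
    "('a \<Rightarrow> 'a \<Rightarrow> real) \<Rightarrow> ('a \<Rightarrow> 'a) \<Rightarrow> ('a \<Rightarrow> real) \<Rightarrow> 'a set \<Rightarrow> real \<Rightarrow> real \<Rightarrow> ennreal" where
  "BSP_lim d f \<phi> Z lam \<epsilon> = lim (\<lambda>N. BSP_pre d f \<phi> Z lam N \<epsilon>)"

definition BSP_outer ::
    "('a \<Rightarrow> 'a \<Rightarrow> real) \<Rightarrow> ('a \<Rightarrow> 'a) \<Rightarrow> ('a \<Rightarrow> real) \<Rightarrow> 'a set \<Rightarrow> real \<Rightarrow> real \<Rightarrow> ennreal" where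
  "BSP_outer d f \<phi> Z lam \<epsilon> =
     Inf {\<Sum>i. BSP_lim d f \<phi> (Zs i) lam \<epsilon> | Zs :: nat \<Rightarrow> 'a set. Z \<subseteq> (\<Union>i. Zs i)}"

definition BSP_crit ::
    "('a \<Rightarrow> 'a \<Rightarrow> real) \<Rightarrow> ('a \<Rightarrow> 'a) \<Rightarrow> ('a \<Rightarrow> real) \<Rightarrow> 'a set \<Rightarrow> real \<Rightarrow> ereal" where
  "BSP_crit d f \<phi> Z \<epsilon> = Inf {ereal lam | lam. BSP_outer d f \<phi> Z lam \<epsilon> = 0}"

definition upper_BSPmdim ::
    "('a \<Rightarrow> 'a \<Rightarrow> real) \<Rightarrow> ('a \<Rightarrow> 'a) \<Rightarrow> ('a \<Rightarrow> real) \<Rightarrow> 'a set \<Rightarrow> ereal" where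
  "upper_BSPmdim d f \<phi> Z =
     Limsup (at_right 0) (\<lambda>\<epsilon>. BSP_crit d f \<phi> Z \<epsilon> / ereal (ln (1 / \<epsilon>)))"

end

theory Submission
  imports Defs
begin

text \<open>
  Replacing \<open>\<epsilon>\<close> by a constant multiple, or either side by a factor \<open>\<theta> > 1\<close>, does not affect an upper
  limit of quotients by \<open>ln (1 / \<epsilon>)\<close>. By uniform continuity of the positive function \<open>\<phi>\<close>, the Birkhoff
  sums \<open>S\<^sub>n \<phi>\<close> at two points of a Bowen ball of small radius agree up to such a factor. So it suffices
  to compare critical exponents and entropies at a fixed small scale, up to constants.

  The entropies are bounded from above by covering the points where the measure of a Bowen ball is
  too small: with a finite subcover of \<open>K\<close> for the lower entropy, and with maximal families of
  disjoint balls and the Borel--Cantelli lemma for the upper entropy.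

  For the reverse inequalities one constructs measures as weak limits of finitely supported ones.
  For the lower entropy, a Vitali-type argument on each time level, with geometric weights over the
  levels, shows that fractional covers are not essentially cheaper than covers; linear programming
  duality on finite families then gives measures with \<open>\<mu> (B\<^sub>n x \<epsilon>) \<le> C exp (- s S\<^sub>n \<phi> x)\<close>. For the upper
  entropy, one removes from \<open>K\<close> the relatively open negligible parts and distributes mass along a tree of
  nested disjoint Bowen balls, each node receiving at most its weight (Joyce and Preiss).
\<close>

section \<open>Weak limits of finitely supported measures\<close>

text \<open>Only one half of weak convergence is used: an upper bound for the mass of an open set
  survives in the limit. This suits both constructions, since the mass bounds concern open Bowen
  balls, and full mass on a closed set means mass 0 on its open complement.

  Entropy integrands are compared only with constants, almost everywhere, and exceptional sets are
  enclosed in measurable sets of small measure. Monotonicity of the nonnegative integral then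
  suffices, and the measurability of integrands and exceptional sets never has to be settled.

  The lower bound of \<open>\<phi>\<close> turns a gap between two exponents into a factor decaying
  exponentially in \<open>n\<close>. Such gaps pay for the sum over the levels of a weighted cover,
  for the Borel--Cantelli series and for multiplicative constants, which is why most comparisons
  below give up a little of the exponent.\<close>

lemma weak_conv_open_le:
  fixes V :: "real set"
  assumes \<nu>: "\<And>j. real_distribution (\<nu> j)" and N: "real_distribution N"
    and conv: "weak_conv_m \<nu> N" and V: "open V"
    and le: "\<forall>\<^sub>F j in sequentially. measure (\<nu> j) V \<le> w"
  shows "measure N V \<le> w"
\<comment> \<open>The whole line is separate because \<open>infdist\<close> to the empty set is 0 by
  convention, so the functions \<open>g m\<close> below would vanish.\<close>
proof (cases "V = UNIV")
  case True
  interpret N: real_distribution N by fact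
  obtain j where "measure (\<nu> j) V \<le> w" using eventually_happens'[OF sequentially_bot le] by blast
  moreover interpret nj: real_distribution "\<nu> j" by fact
  have "measure (\<nu> j) V = 1" using True nj.prob_space by simp
  ultimately show ?thesis using N.prob_space True by simp
next
  case False
  interpret N: real_distribution N by fact
  \<comment> \<open>Continuous functions increasing to the indicator of \<open>V\<close>: the
    distance to the complement, steepened by \<open>m\<close> and capped at 1.\<close>
  define g where "g m t = min 1 (real m * infdist t (- V))" for m t
  have cont: "isCont (g m) t" for m t unfolding g_def by (intro continuous_intros)
  have g01: "0 \<le> g m t" "g m t \<le> 1" for m t
    by (auto simp: g_def infdist_nonneg)
  have gV: "g m t \<le> indicator V t" for m t
    using g01(2)[of m t] by (auto simp: g_def indicator_def)
  have meas[measurable]: "g m \<in> borel_measurable borel" for m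
    using cont by (intro borel_measurable_continuous_onI continuous_at_imp_continuous_on) auto
  have int_le: "integral\<^sup>L N (g m) \<le> w" for m
  proof -
    have lim: "(\<lambda>j. integral\<^sup>L (\<nu> j) (g m)) \<longlonglongrightarrow> integral\<^sup>L N (g m)"
      using g01 by (intro weak_conv_imp_integral_bdd_continuous_conv[OF \<nu> N conv cont, of _ 1]) auto
    have "\<forall>\<^sub>F j in sequentially. integral\<^sup>L (\<nu> j) (g m) \<le> w"
      using le
    proof eventually_elim
      case (elim j)
      interpret nj: real_distribution "\<nu> j" by fact
      have "integral\<^sup>L (\<nu> j) (g m) \<le> integral\<^sup>L (\<nu> j) (indicator V)"
        using V g01 gV by (intro integral_mono nj.integrable_const_bound[where B=1]) auto
      then show ?case using elim V by simp
    qed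
    with lim show ?thesis by (rule tendsto_upperbound) simp
  qed
  have "(\<lambda>m. integral\<^sup>L N (g m)) \<longlonglongrightarrow> integral\<^sup>L N (indicator V)"
  proof (rule integral_dominated_convergence[where w = "\<lambda>_. 1"])
    show "AE x in N. (\<lambda>m. g m x) \<longlonglongrightarrow> indicator V x"
    proof (rule AE_I2)
      fix t
      show "(\<lambda>m. g m t) \<longlonglongrightarrow> indicator V t"
      proof (cases "t \<in> V")
        case True
        have pos: "infdist t (- V) > 0"
          using V True False by (metis Compl_iff closed_Compl compl_eq_compl_iff
              compl_top_eq in_closed_iff_infdist_zero infdist_nonneg less_eq_real_def)
        have "\<forall>\<^sub>F m in sequentially. 1 \<le> real m * infdist t (- V)"
          using eventually_gt_at_top[of "nat \<lceil>1 / infdist t (- V)\<rceil>"]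
        proof eventually_elim
          case (elim m)
          then have "1 / infdist t (- V) \<le> real m" by linarith
          then show ?case using pos by (simp add: field_simps)
        qed
        then have "\<forall>\<^sub>F m in sequentially. g m t = 1"
          by eventually_elim (simp add: g_def)
        then show ?thesis using True by (simp add: tendsto_eventually)
      next
        case F: False
        then have "g m t = 0" for m by (simp add: g_def)
        then show ?thesis using F by simp
      qed
    qed
  qed (use V g01 in auto)
  then show ?thesis
    using V by (intro tendsto_upperbound[of _ "measure N V"]) (auto intro: int_le always_eventually)
qed

section \<open>Compact spaces with a chosen compatible metric\<close>

text \<open>The theorem quantifies over all compatible metrics of one topology, so the metric is a
  parameter and not the \<open>dist\<close> of a type class.\<close>

locale compact_metric = Metric_space "UNIV :: 'a::topological_space set" d for d +
  assumes top: "mtopology = (euclidean :: 'a topology)"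
    and cpt: "compact (UNIV :: 'a set)"
begin

lemma open_iff: "open U \<longleftrightarrow> (\<forall>x\<in>U. \<exists>r>0. mball x r \<subseteq> U)"
  using openin_mtopology[of U] top by auto

lemma open_ball [simp]: "open (mball x r)"
  using openin_mball[of x r] top by simp

lemma closed_compact: "compact (K :: 'a set) \<Longrightarrow> closed K"
  using compactin_imp_closedin[OF Hausdorff_space_mtopology, of K] unfolding top by simp

lemma open_gt: "open {y. r < d x y}"
  unfolding open_iff
proof safe
  fix y assume "r < d x y"
  then show "\<exists>s>0. mball y s \<subseteq> {y. r < d x y}"
    using triangle[of x _ y] commute
    by (intro exI[of _ "d x y - r"]) (auto simp: in_mball, smt (verit) UNIV_I commute triangle)
qed

lemma compact_ball_cover:
  assumes "\<And>x. open (U x)" "\<And>x. x \<in> K \<Longrightarrow> x \<in> U x" "compact K"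
  obtains F where "finite F" "F \<subseteq> K" "K \<subseteq> (\<Union>x\<in>F. U x)"
proof (rule compactE_image[OF \<open>compact K\<close>, of K U])
  show "K \<subseteq> (\<Union>x\<in>K. U x)" using assms(2) by blast
qed (use assms(1) that in auto)

text \<open>Finite nets of radius \<open>1 / real (Suc k)\<close> for all \<open>k\<close>, put into
  one sequence. The second property is uniform in \<open>x\<close>: finitely many of the sets locate
  every point up to \<open>e\<close>. The real code below relies on this.\<close>

lemma countable_base:
  obtains V :: "nat \<Rightarrow> 'a set" where "\<And>i. open (V i)"
    "\<And>e. e > 0 \<Longrightarrow> \<exists>n. \<forall>x. \<exists>i<n. x \<in> V i \<and> (\<forall>y\<in>V i. d x y < e)"
proof -
  have "\<exists>F. finite F \<and> (UNIV :: 'a set) \<subseteq> (\<Union>x\<in>F. mball x (1 / real (Suc k)))" for k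
    by (rule compact_ball_cover[OF _ _ cpt, of "\<lambda>x. mball x (1 / real (Suc k))"]) auto
  then obtain F where F: "\<And>k. finite (F k)" "\<And>k. UNIV \<subseteq> (\<Union>x\<in>F k. mball x (1 / real (Suc k)))"
    by metis
  define S where "S = (\<Union>k. F k \<times> {k})"
  have S: "countable S" unfolding S_def using F(1) by (auto intro: countable_finite)
  have "F 0 \<noteq> {}" using F(2)[of 0] by auto
  then have Sne: "S \<noteq> {}" by (auto simp: S_def)
  define V where "V i = (case from_nat_into S i of (x, k) \<Rightarrow> mball x (1 / real (Suc k)))" for i
  show ?thesis
  proof
    show "open (V i)" for i by (simp add: V_def split: prod.split)
    fix e :: real assume "e > 0"
    then obtain k :: nat where k: "2 / real (Suc k) < e"
      using reals_Archimedean[of "e/2"] by (auto simp: field_simps)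
    \<comment> \<open>One more than the largest index at which a ball of the \<open>k\<close>-th net
      is listed.\<close>
    define n where "n = Suc (Max (to_nat_on S ` (F k \<times> {k})))"
    have "\<exists>i<n. x \<in> V i \<and> (\<forall>y\<in>V i. d x y < e)" for x
    proof -
      obtain c where c: "c \<in> F k" "x \<in> mball c (1 / real (Suc k))" using F(2)[of k] by blast
      then have inS: "(c, k) \<in> S" by (auto simp: S_def)
      have Vi: "V (to_nat_on S (c, k)) = mball c (1 / real (Suc k))"
        using S inS by (simp add: V_def)
      have "to_nat_on S (c, k) < n"
        unfolding n_def less_Suc_eq_le using F(1) c by (intro Max_ge) auto
      moreover have "d x y < e" if "y \<in> mball c (1 / real (Suc k))" for y
      proof -
        have "d c x < 1 / real (Suc k)" "d c y < 1 / real (Suc k)" using that c(2) by auto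
        moreover have "d x y \<le> d c x + d c y" using triangle[of x c y] commute[of x c] by auto
        ultimately show ?thesis using k by simp
      qed
      ultimately show ?thesis using c Vi by auto
    qed
    then show "\<exists>n. \<forall>x. \<exists>i<n. x \<in> V i \<and> (\<forall>y\<in>V i. d x y < e)" by blast
  qed
qed

end

section \<open>Coding points by real numbers\<close>

text \<open>Digits 0 and 1 in base 4 exclude carries: a first difference at digit \<open>j\<close>
  contributes \<open>1 / 4 ^ j\<close>, and all later digits change the number by at most a third of
  that. The remaining two thirds give the constant.\<close>

lemma abs_binary_code_diff:
  fixes a b :: "nat \<Rightarrow> real"
  assumes a: "\<And>i. a i \<in> {0, 1}" and b: "\<And>i. b i \<in> {0, 1}"
    and less: "\<bar>(\<Sum>i. a i / 4 ^ i) - (\<Sum>i. b i / 4 ^ i)\<bar> < (2/3) / 4 ^ n" and "j \<le> n"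
  shows "a j = b j"
  using \<open>j \<le> n\<close>
proof (induction j rule: less_induct)
  case (less j)
  define c where "c i = (a i - b i) / 4 ^ i" for i
  have c1: "\<bar>c i\<bar> \<le> (1/4) ^ i" for i
    using a[of i] b[of i] by (auto simp: c_def power_one_over divide_simps)
  have geo: "summable (\<lambda>i. (1/4::real) ^ i)" by (rule summable_geometric) simp
  have sumc: "summable c"
    using c1 by (intro summable_comparison_test'[OF geo]) auto
  have s01: "summable (\<lambda>i. u i / 4 ^ i)" if "\<And>i. u i \<in> {0, 1}" for u :: "nat \<Rightarrow> real"
  proof (intro summable_comparison_test'[OF geo, of 0])
    show "norm (u i / 4 ^ i) \<le> (1/4) ^ i" for i
      using that[of i] by (auto simp: power_one_over)
  qed
  note s = s01[OF a] s01[OF b]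
  have "(\<Sum>i. a i / 4 ^ i) - (\<Sum>i. b i / 4 ^ i) = suminf c"
    using suminf_diff[OF s] by (simp add: c_def[abs_def] diff_divide_distrib)
  also have "\<dots> = (\<Sum>i. c (i + Suc j)) + (\<Sum>i<Suc j. c i)"
    by (rule suminf_split_initial_segment[OF sumc])
  also have "(\<Sum>i<Suc j. c i) = c j"
    using less by (simp add: c_def)
  finally have eq: "(\<Sum>i. a i / 4 ^ i) - (\<Sum>i. b i / 4 ^ i) = (\<Sum>i. c (i + Suc j)) + c j" .
  have "\<bar>\<Sum>i. c (i + Suc j)\<bar> \<le> (\<Sum>i. (1/4) ^ Suc j * (1/4::real) ^ i)"
  proof (rule order_trans[OF summable_rabs suminf_le])
    show sm: "summable (\<lambda>i. \<bar>c (i + Suc j)\<bar>)"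
    proof (rule summable_comparison_test'[OF summable_ignore_initial_segment[OF geo, of "Suc j"], of 0])
      show "norm \<bar>c (i + Suc j)\<bar> \<le> (1/4) ^ (i + Suc j)" for i using c1[of "i + Suc j"] by simp
    qed
    show "\<bar>c (i + Suc j)\<bar> \<le> (1/4) ^ Suc j * (1/4) ^ i" for i
      using c1[of "i + Suc j"] by (simp only: power_add mult.commute)
    show "summable (\<lambda>i. (1/4) ^ Suc j * (1/4::real) ^ i)"
      by (intro summable_mult geo)
    show "summable (\<lambda>i. \<bar>c (i + Suc j)\<bar>)" by fact
  qed
  also have "\<dots> = (1/4) ^ Suc j * (\<Sum>i. (1/4::real) ^ i)" by (rule suminf_mult[OF geo])
  also have "\<dots> = (1/3) / 4 ^ j" by (subst suminf_geometric) (simp_all add: power_one_over)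
  finally have tail: "\<bar>\<Sum>i. c (i + Suc j)\<bar> \<le> (1/3) / 4 ^ j" .
  have "(2/3) / 4 ^ n \<le> (2/3::real) / 4 ^ j"
    using less.prems by (intro divide_left_mono power_increasing) auto
  then have small: "\<bar>(\<Sum>i. c (i + Suc j)) + c j\<bar> < (2/3) / 4 ^ j" using eq assms(3) by linarith
  show "a j = b j"
  proof (rule ccontr)
    assume "a j \<noteq> b j"
    then have "\<bar>c j\<bar> = 1 / 4 ^ j" using a[of j] b[of j] by (auto simp: c_def)
    moreover have "1 / 4 ^ j = (1/3) / 4 ^ j + (2/3::real) / 4 ^ j" by (simp add: field_simps)
    ultimately show False using tail small by linarith
  qed
qed

context compact_metric
begin

text \<open>The digits of the code record membership in the sets of the countable base. Close codes
  share their first \<open>n\<close> digits, hence both points lie in a common small set.\<close>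

lemma real_code:
  obtains \<theta> :: "'a \<Rightarrow> real" where "range \<theta> \<subseteq> {0..2}"
    "\<And>e. e > 0 \<Longrightarrow> \<exists>\<delta>>0. \<forall>x y. \<bar>\<theta> x - \<theta> y\<bar> < \<delta> \<longrightarrow> d x y < e"
proof -
  obtain V :: "nat \<Rightarrow> 'a set" where V: "\<And>i. open (V i)"
    "\<And>e. e > 0 \<Longrightarrow> \<exists>n. \<forall>x. \<exists>i<n. x \<in> V i \<and> (\<forall>y\<in>V i. d x y < e)"
    using countable_base by metis
  define \<theta> :: "'a \<Rightarrow> real" where "\<theta> x = (\<Sum>i. indicator (V i) x / 4 ^ i)" for x
  show ?thesis
  proof
    have geo: "summable (\<lambda>i. (1/4::real) ^ i)" by (rule summable_geometric) simp
    have le: "indicator (V i) x / 4 ^ i \<le> (1/4::real) ^ i" for i x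
      by (simp add: indicator_def power_one_over)
    have s: "summable (\<lambda>i. indicator (V i) x / 4 ^ i :: real)" for x
      using le by (intro summable_comparison_test'[OF geo, of 0]) auto
    have "\<theta> x \<le> 2" for x
    proof -
      have "\<theta> x \<le> (\<Sum>i. (1/4::real) ^ i)" unfolding \<theta>_def by (intro suminf_le le s geo)
      then show ?thesis by (simp add: suminf_geometric)
    qed
    moreover have "\<theta> x \<ge> 0" for x unfolding \<theta>_def by (intro suminf_nonneg s) simp
    ultimately show "range \<theta> \<subseteq> {0..2}" by auto
    fix e :: real assume "e > 0"
    then obtain n where n: "\<And>x. \<exists>i<n. x \<in> V i \<and> (\<forall>y\<in>V i. d x y < e)" using V(2) by blast
    show "\<exists>\<delta>>0. \<forall>x y. \<bar>\<theta> x - \<theta> y\<bar> < \<delta> \<longrightarrow> d x y < e"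
    proof (intro exI[of _ "(2/3) / 4 ^ n"] conjI allI impI)
      fix x y assume *: "\<bar>\<theta> x - \<theta> y\<bar> < (2/3) / 4 ^ n"
      obtain i where i: "i < n" "x \<in> V i" "\<forall>y\<in>V i. d x y < e" using n by blast
      have "indicator (V i) x = (indicator (V i) y :: real)"
        using abs_binary_code_diff[of "\<lambda>i. indicator (V i) x" "\<lambda>i. indicator (V i) y" n i] * i(1)
        by (simp add: \<theta>_def indicator_def)
      then show "d x y < e" using i by (auto simp: indicator_def split: if_splits)
    qed simp
  qed
qed

text \<open>The hypothesis says that the inverse of \<open>\<theta>\<close> is uniformly continuous
  on the range. At a point \<open>t\<close> of the closure, compactness gives a limit point of
  preimages along one sequence tending to \<open>t\<close>, and the hypothesis extends its closeness
  to the preimages of all values near \<open>t\<close>.\<close>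

lemma code_inverse:
  fixes \<theta> :: "'a \<Rightarrow> real"
  assumes \<theta>: "\<And>e. e > 0 \<Longrightarrow> \<exists>\<delta>>0. \<forall>x y. \<bar>\<theta> x - \<theta> y\<bar> < \<delta> \<longrightarrow> d x y < e"
  obtains h where "continuous_on (closure (range \<theta>)) h" "\<And>x. h (\<theta> x) = x"
proof -
  have ex: "\<exists>x. \<forall>e>0. \<exists>\<delta>>0. \<forall>y. \<bar>\<theta> y - t\<bar> < \<delta> \<longrightarrow> d x y < e" if t: "t \<in> closure (range \<theta>)" for t
  proof -
    obtain s where s: "\<And>n. s n \<in> range \<theta>" "s \<longlonglongrightarrow> t" using t unfolding closure_sequential by blast
    then have "\<forall>n. \<exists>x. s n = \<theta> x" by blast
    then obtain y where y: "\<And>n. s n = \<theta> (y n)" using choice[of "\<lambda>n x. s n = \<theta> x"] by blast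
    have "compact_space mtopology" using cpt top by (simp add: compact_space_def)
    then have "\<exists>x r. strict_mono (r :: nat \<Rightarrow> nat) \<and> limitin mtopology (y \<circ> r) x sequentially"
      using compactin_sequentially[of UNIV] unfolding compact_space_def by simp
    then obtain x r where r: "strict_mono (r :: nat \<Rightarrow> nat)" and x: "limitin mtopology (y \<circ> r) x sequentially"
      by blast
    show ?thesis
    proof (intro exI[of _ x] allI impI)
      fix e :: real assume "e > 0"
      then obtain \<delta> where \<delta>: "\<delta> > 0" "\<And>x y. \<bar>\<theta> x - \<theta> y\<bar> < \<delta> \<Longrightarrow> d x y < e / 2"
        using \<theta>[of "e/2"] by (metis half_gt_zero)
      have "\<forall>\<^sub>F n in sequentially. d (y (r n)) x < e / 2"
        using x \<open>e > 0\<close> unfolding limitin_metric by (auto dest!: spec[of _ "e/2"])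
      moreover have "(\<lambda>n. \<theta> (y (r n))) \<longlonglongrightarrow> t"
        using LIMSEQ_subseq_LIMSEQ[OF s(2) r] by (simp add: o_def y)
      then have "\<forall>\<^sub>F n in sequentially. \<bar>\<theta> (y (r n)) - t\<bar> < \<delta> / 2"
        using \<delta>(1) tendstoD[of _ t sequentially "\<delta>/2"] by (auto simp: dist_real_def)
      ultimately have "\<forall>\<^sub>F n in sequentially. d (y (r n)) x < e / 2 \<and> \<bar>\<theta> (y (r n)) - t\<bar> < \<delta> / 2"
        by (rule eventually_conj)
      from eventually_happens'[OF sequentially_bot this] obtain n where n: "d (y (r n)) x < e / 2" "\<bar>\<theta> (y (r n)) - t\<bar> < \<delta> / 2"
        by blast
      have "d x z < e" if z: "\<bar>\<theta> z - t\<bar> < \<delta> / 2" for z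
      proof -
        have "d (y (r n)) z < e / 2" using z n by (intro \<delta>(2)) linarith
        then show ?thesis using n triangle[of x "y (r n)" z] commute[of x "y (r n)"] by auto
      qed
      then show "\<exists>\<delta>>0. \<forall>y. \<bar>\<theta> y - t\<bar> < \<delta> \<longrightarrow> d x y < e" using \<delta>(1) half_gt_zero by blast
    qed
  qed
  define h where "h t = (SOME x. \<forall>e>0. \<exists>\<delta>>0. \<forall>y. \<bar>\<theta> y - t\<bar> < \<delta> \<longrightarrow> d x y < e)" for t
  have h: "\<exists>\<delta>>0. \<forall>y. \<bar>\<theta> y - t\<bar> < \<delta> \<longrightarrow> d (h t) y < e"
    if "t \<in> closure (range \<theta>)" "e > 0" for t e
    using someI_ex[OF ex[OF that(1)]] that(2) unfolding h_def by blast
  show ?thesis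
  proof
    show "h (\<theta> x) = x" for x
    proof -
      have "d (h (\<theta> x)) x < e" if "e > 0" for e
      proof -
        have "\<theta> x \<in> closure (range \<theta>)" by (rule subsetD[OF closure_subset rangeI])
        from h[OF this that] obtain \<delta> where \<delta>: "\<delta> > 0" "\<forall>y. \<bar>\<theta> y - \<theta> x\<bar> < \<delta> \<longrightarrow> d (h (\<theta> x)) y < e"
          by (elim exE conjE)
        show ?thesis by (rule \<delta>(2)[rule_format]) (simp add: \<delta>(1))
      qed
      from less_imp_le[OF this] have "d (h (\<theta> x)) x \<le> 0 + e" if "e > 0" for e
        using that by simp
      then have "d (h (\<theta> x)) x \<le> 0" by (rule field_le_epsilon)
      then have "d (h (\<theta> x)) x = 0" using nonneg[of "h (\<theta> x)" x] by (rule order_antisym)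
      then show ?thesis by simp
    qed
    show "continuous_on (closure (range \<theta>)) h"
      unfolding continuous_on_topological
    proof (intro ballI allI impI)
      fix t B assume t: "t \<in> closure (range \<theta>)" and B: "open B" "h t \<in> B"
      then obtain e where e: "e > 0" "mball (h t) e \<subseteq> B" using open_iff by blast
      obtain \<delta> where \<delta>: "\<delta> > 0" "\<And>y. \<bar>\<theta> y - t\<bar> < \<delta> \<Longrightarrow> d (h t) y < e / 2"
        using h[OF t half_gt_zero[OF e(1)]] by blast
      have "h u \<in> B" if u: "u \<in> closure (range \<theta>)" "u \<in> ball t (\<delta>/2)" for u
      proof -
        obtain \<eta> where \<eta>: "\<eta> > 0" "\<And>y. \<bar>\<theta> y - u\<bar> < \<eta> \<Longrightarrow> d (h u) y < e / 2"
          using h[OF u(1) half_gt_zero[OF e(1)]] by blast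
        have "min \<eta> (\<delta>/2) > 0" using \<eta> \<delta> by simp
        then obtain y where y: "\<bar>\<theta> y - u\<bar> < min \<eta> (\<delta>/2)"
          using u(1) unfolding closure_approachable dist_real_def by blast
        then have "d (h u) y < e / 2" using \<eta>(2) by simp
        moreover have "d (h t) y < e / 2" using y u(2) unfolding mem_ball dist_real_def by (intro \<delta>(2)) linarith
        ultimately have "d (h t) (h u) < e" using triangle[of "h t" y "h u"] commute[of y "h u"] by simp
        then show ?thesis using e(2) by (simp add: subset_iff)
      qed
      then show "\<exists>A. open A \<and> t \<in> A \<and> (\<forall>y\<in>closure (range \<theta>). y \<in> A \<longrightarrow> h y \<in> B)"
        using \<delta>(1) by (intro exI[of _ "ball t (\<delta>/2)"]) auto
    qed
  qed
qed

text \<open>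
  Helly's selection theorem is transported from the real line: a code \<open>\<theta>\<close> of the compact space into
  the reals need not be continuous, but its inverse extends continuously to the closure of its range.
\<close>
lemma pmf_weak_limit:
  fixes p :: "nat \<Rightarrow> 'a pmf"
  obtains \<mu> where "\<mu> \<in> borel_probs"
    "\<And>U w. open U \<Longrightarrow> \<forall>\<^sub>F j in sequentially. measure_pmf.prob (p j) U \<le> w \<Longrightarrow> measure \<mu> U \<le> w"
proof -
  obtain \<theta> :: "'a \<Rightarrow> real" where \<theta>: "range \<theta> \<subseteq> {0..2}"
    "\<And>e. e > 0 \<Longrightarrow> \<exists>\<delta>>0. \<forall>x y. \<bar>\<theta> x - \<theta> y\<bar> < \<delta> \<longrightarrow> d x y < e"
    using real_code by metis
  obtain h where h: "continuous_on (closure (range \<theta>)) h" "\<And>x. h (\<theta> x) = x"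
    using code_inverse \<theta>(2) by metis
  define C where "C = closure (range \<theta>)"
  \<comment> \<open>Every map is measurable for a \<open>pmf\<close>, so the possibly discontinuous
    code can be pushed forward.\<close>
  define \<nu> where "\<nu> j = distr (measure_pmf (p j)) borel \<theta>" for j
  have \<nu>: "real_distribution (\<nu> j)" for j
    by (auto simp: real_distribution_def real_distribution_axioms_def \<nu>_def
        intro!: measure_pmf.prob_space_distr)
  have \<nu>_eq: "measure (\<nu> j) V = measure_pmf.prob (p j) (\<theta> -` V)" if "V \<in> sets borel" for V j
    unfolding \<nu>_def using that by (subst measure_distr) auto
  have "tight \<nu>"
    unfolding tight_def
  proof (intro conjI allI impI)
    fix e :: real assume "e > 0"
    have "\<theta> -` {-1<..3} = UNIV" using \<theta>(1) by force
    then show "\<exists>a b. a < b \<and> (\<forall>n. 1 - e < measure (\<nu> n) {a<..b})"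
      using \<open>e > 0\<close> by (intro exI[of _ "-1"] exI[of _ 3]) (simp add: \<nu>_eq)
  qed (rule \<nu>)
  then obtain r N where r: "strict_mono (r :: nat \<Rightarrow> nat)" and N: "real_distribution N"
    and conv: "weak_conv_m (\<nu> \<circ> id \<circ> r) N"
    using tight_imp_convergent_subsubsequence[of \<nu> id] by (auto simp: strict_mono_id)
  interpret N: real_distribution N by fact
  have N_le: "measure N V \<le> w" if "open V" "\<forall>\<^sub>F j in sequentially. measure_pmf.prob (p j) (\<theta> -` V) \<le> w" for V w
  proof (rule weak_conv_open_le[OF _ N conv \<open>open V\<close>])
    show "real_distribution ((\<nu> \<circ> id \<circ> r) j)" for j using \<nu> by simp
    show "\<forall>\<^sub>F j in sequentially. measure ((\<nu> \<circ> id \<circ> r) j) V \<le> w"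
      using filterlim_subseq[OF r] that by (auto simp: filterlim_iff \<nu>_eq)
  qed
  have closedC: "closed C" by (simp add: C_def)
  have "\<theta> -` (- C) = {}" using closure_subset[of "range \<theta>"] by (auto simp: C_def)
  then have "measure N (- C) \<le> 0" using closedC by (intro N_le) auto
  then have N0: "measure N (- C) = 0" by (simp add: order_antisym)
  \<comment> \<open>Outside the closed set \<open>C\<close>, which carries \<open>N\<close>, a
    constant value keeps the map Borel.\<close>
  define h' where "h' t = (if t \<in> C then h t else undefined)" for t
  have h'[measurable]: "h' \<in> borel_measurable borel"
    unfolding h'_def using h(1) closedC
    by (intro borel_measurable_continuous_on_if) (auto simp: C_def)
  define \<mu> where "\<mu> = distr N borel h'"
  show ?thesis
  proof
    show "\<mu> \<in> borel_probs" by (auto simp: borel_probs_def \<mu>_def intro!: N.prob_space_distr)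
    fix U w assume U: "open U" and ev: "\<forall>\<^sub>F j in sequentially. measure_pmf.prob (p j) U \<le> w"
    obtain V where V: "open V" "V \<inter> C = h -` U \<inter> C"
      using h(1) U unfolding continuous_on_open_invariant C_def by blast
    have \<theta>C: "\<theta> x \<in> C" for x using closure_subset[of "range \<theta>"] by (auto simp: C_def)
    then have "\<theta> x \<in> V \<longleftrightarrow> \<theta> x \<in> h -` U \<inter> C" for x using V(2) by blast
    then have "\<theta> x \<in> V \<longleftrightarrow> x \<in> U" for x using \<theta>C h(2)[of x] by simp
    then have "\<theta> -` V = U" by auto
    then have le: "measure N V \<le> w" using N_le[OF V(1)] ev by simp
    have "measure \<mu> U = measure N (h' -` U)" unfolding \<mu>_def using U by (subst measure_distr) auto
    also have "\<dots> \<le> measure N (V \<union> - C)"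
    proof (rule N.finite_measure_mono)
      show "h' -` U \<subseteq> V \<union> - C" using V(2) by (auto simp: h'_def)
    qed (use V closedC in auto)
    also have "\<dots> \<le> measure N V + measure N (- C)"
      using V closedC by (intro measure_Un_le) auto
    finally show "measure \<mu> U \<le> w" using N0 le by simp
  qed
qed

end

section \<open>Linear programming duality for fractional covers\<close>

lemma finite_pmf_exists:
  fixes q :: "'a \<Rightarrow> real"
  assumes "finite P" "\<And>x. x \<in> P \<Longrightarrow> q x \<ge> 0" "(\<Sum>x\<in>P. q x) = 1"
  obtains p where "set_pmf p \<subseteq> P" "\<And>x. x \<in> P \<Longrightarrow> pmf p x = q x"
proof
  define q' where "q' x = (if x \<in> P then q x else 0)" for x
  have "(\<integral>\<^sup>+ x. ennreal (q' x) \<partial>count_space UNIV) = (\<Sum>x\<in>P. ennreal (q' x))"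
    using assms(1) by (intro nn_integral_count_space') (auto simp: q'_def)
  also have "\<dots> = ennreal (\<Sum>x\<in>P. q' x)" using assms(2) by (intro sum_ennreal) (auto simp: q'_def)
  also have "(\<Sum>x\<in>P. q' x) = 1" using assms(3) by (simp add: q'_def)
  finally have "pmf (embed_pmf q') x = q' x" for x
    using assms(2) by (intro pmf_embed_pmf) (auto simp: q'_def)
  then show "set_pmf (embed_pmf q') \<subseteq> P" "\<And>x. x \<in> P \<Longrightarrow> pmf (embed_pmf q') x = q x"
    by (auto simp: set_pmf_iff q'_def split: if_splits)
qed

text \<open>A first-order expansion of the squared positive part with an explicit quadratic error.
  It replaces differentiation of the penalty.\<close>

lemma max0_add_sq_le:
  fixes u h :: real
  shows "(max 0 (u + h))\<^sup>2 \<le> (max 0 u)\<^sup>2 + 2 * h * max 0 u + h\<^sup>2"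
proof -
  have "\<bar>max 0 (u + h)\<bar> \<le> \<bar>max 0 u + h\<bar>" by auto
  then have "(max 0 (u + h))\<^sup>2 \<le> (max 0 u + h)\<^sup>2" by (simp only: abs_le_square_iff)
  then show ?thesis by (simp add: power2_sum algebra_simps)
qed

text \<open>
  Duality is obtained without a separation theorem: the excesses at a minimizer of this penalty
  would, by the first-order condition, be the coefficients of a fractional cover that is too cheap.
\<close>
lemma simplex_penalty_minimizer:
  fixes B :: "'i \<Rightarrow> 'a set" and b :: "'i \<Rightarrow> real"
  assumes "finite P" "P \<noteq> {}"
  obtains q :: "'a \<Rightarrow> real" where "\<And>x. q x \<ge> 0" "(\<Sum>x\<in>P. q x) = 1"
    "\<And>q'. (\<And>x. x \<in> P \<Longrightarrow> q' x \<ge> 0) \<Longrightarrow> (\<Sum>x\<in>P. q' x) = 1 \<Longrightarrow>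
       (\<Sum>i\<in>I. (max 0 ((\<Sum>x\<in>P. q x * indicator (B i) x) / b i - 1))\<^sup>2)
       \<le> (\<Sum>i\<in>I. (max 0 ((\<Sum>x\<in>P. q' x * indicator (B i) x) / b i - 1))\<^sup>2)"
proof -
  define \<Phi> where "\<Phi> q = (\<Sum>i\<in>I. (max 0 ((\<Sum>x\<in>P. q x * indicator (B i) x) / b i - 1))\<^sup>2)"
    for q :: "'a \<Rightarrow> real"
  \<comment> \<open>Coordinates outside \<open>P\<close> are pinned to 0, so that the simplex is a
    closed subset of a product of compact sets.\<close>
  define S :: "('a \<Rightarrow> real) set" where
    "S = PiE UNIV (\<lambda>x. if x \<in> P then {0..1} else {0}) \<inter> {q. (\<Sum>x\<in>P. q x) = 1}"
  have coord: "continuous_on UNIV (\<lambda>q::'a \<Rightarrow> real. q x)" for x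
    by (rule continuous_on_product_coordinates)
  have "closed {q::'a \<Rightarrow> real. (\<Sum>x\<in>P. q x) = 1}"
    by (intro closed_Collect_eq continuous_on_sum coord continuous_on_const)
  moreover have "compactin (product_topology (\<lambda>_. euclidean) UNIV)
      (PiE UNIV (\<lambda>x. if x \<in> P then {0..1::real} else {0}))"
    unfolding compactin_PiE by simp
  then have "compact (PiE UNIV (\<lambda>x. if x \<in> P then {0..1::real} else {0}))"
    unfolding euclidean_product_topology by simp
  ultimately have "compact S" unfolding S_def by (intro compact_Int_closed)
  moreover obtain x0 where "x0 \<in> P" using assms by auto
  then have "(\<lambda>x. if x = x0 then 1 else 0) \<in> S"
    using assms by (auto simp: S_def split: if_splits)
  then have "S \<noteq> {}" by auto
  moreover have "continuous_on UNIV \<Phi>"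
    unfolding \<Phi>_def divide_inverse by (intro continuous_intros coord)
  then have "continuous_on S \<Phi>" by (rule continuous_on_subset) simp
  ultimately obtain q where q: "q \<in> S" "\<And>q'. q' \<in> S \<Longrightarrow> \<Phi> q \<le> \<Phi> q'"
    using continuous_attains_inf by metis
  show ?thesis
  proof
    show "0 \<le> q x" for x
      using q(1) by (auto simp: S_def PiE_iff split: if_splits dest!: spec[of _ x])
    show "(\<Sum>x\<in>P. q x) = 1" using q(1) by (simp add: S_def)
    fix q' :: "'a \<Rightarrow> real" assume q': "\<And>x. x \<in> P \<Longrightarrow> 0 \<le> q' x" "(\<Sum>x\<in>P. q' x) = 1"
    define q'' where "q'' x = (if x \<in> P then q' x else 0)" for x
    have "q' x \<le> 1" if "x \<in> P" for x
      using member_le_sum[OF that, of q'] q' assms(1) by simp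
    then have "q'' \<in> S" using q' by (auto simp: S_def q''_def)
    then have "\<Phi> q \<le> \<Phi> q''" by (rule q(2))
    also have "\<Phi> q'' = \<Phi> q'" by (simp add: \<Phi>_def q''_def)
    finally show "(\<Sum>i\<in>I. (max 0 ((\<Sum>x\<in>P. q x * indicator (B i) x) / b i - 1))\<^sup>2)
       \<le> (\<Sum>i\<in>I. (max 0 ((\<Sum>x\<in>P. q' x * indicator (B i) x) / b i - 1))\<^sup>2)"
      by (simp add: \<Phi>_def)
  qed
qed

text \<open>Strong duality of a linear program: \<open>b i\<close> is the price of
  \<open>B i\<close> for the covering side and its capacity for the measure side. Below,
  \<open>c i\<close> is the relative excess of the minimizer over the capacity, and the aim is to
  show that it vanishes.\<close>

lemma fractional_cover_duality_finite:
  fixes B :: "'i \<Rightarrow> 'a set" and b :: "'i \<Rightarrow> real"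
  assumes I: "finite I" and P: "finite P" "P \<noteq> {}" and b: "\<And>i. i \<in> I \<Longrightarrow> b i > 0"
    and cover: "\<And>c. \<lbrakk>\<And>i. i \<in> I \<Longrightarrow> c i \<ge> 0;
       \<And>x. x \<in> P \<Longrightarrow> 1 \<le> (\<Sum>i\<in>I. c i * indicator (B i) x)\<rbrakk> \<Longrightarrow> 1 \<le> (\<Sum>i\<in>I. c i * b i)"
  obtains p where "set_pmf p \<subseteq> P" "\<And>i. i \<in> I \<Longrightarrow> measure_pmf.prob p (B i) \<le> b i"
proof -
  obtain q where q: "\<And>x. q x \<ge> 0" "(\<Sum>x\<in>P. q x) = 1"
    "\<And>q'. (\<And>x. x \<in> P \<Longrightarrow> q' x \<ge> 0) \<Longrightarrow> (\<Sum>x\<in>P. q' x) = 1 \<Longrightarrow>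
       (\<Sum>i\<in>I. (max 0 ((\<Sum>x\<in>P. q x * indicator (B i) x) / b i - 1))\<^sup>2)
       \<le> (\<Sum>i\<in>I. (max 0 ((\<Sum>x\<in>P. q' x * indicator (B i) x) / b i - 1))\<^sup>2)"
    using simplex_penalty_minimizer[OF P, of B b I] by blast
  define Q where "Q i = (\<Sum>x\<in>P. q x * indicator (B i) x)" for i
  define u where "u i = Q i / b i - 1" for i
  define c where "c i = max 0 (u i)" for i
  have cu: "c i * u i = (c i)\<^sup>2" for i by (auto simp: c_def max_def power2_eq_square)
  have first_order: "(\<Sum>i\<in>I. c i + (c i)\<^sup>2) \<le> (\<Sum>i\<in>I. c i / b i * indicator (B i) y)" if y: "y \<in> P" for y
  proof -
    define a where "a i = (indicator (B i) y - Q i) / b i" for i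
    define A where "A = (\<Sum>i\<in>I. (a i)\<^sup>2)"
    \<comment> \<open>Move the fraction \<open>t\<close> of the mass to \<open>y\<close>. By the
      quadratic bound the penalty grows by at most \<open>t\<close> times this expression, so
      minimality makes it nonnegative; then \<open>t\<close> tends to 0.\<close>
    have var: "0 \<le> 2 * (\<Sum>i\<in>I. a i * c i) + t * A" if t: "0 < t" "t \<le> 1" for t
    proof -
      define q' where "q' x = (1 - t) * q x + t * (if x = y then 1 else 0)" for x
      have q'Q: "(\<Sum>x\<in>P. q' x * indicator (B i) x) = (1 - t) * Q i + t * indicator (B i) y" for i
      proof -
        have "(\<Sum>x\<in>P. q' x * indicator (B i) x)
          = (\<Sum>x\<in>P. (1 - t) * (q x * indicator (B i) x) + t * (if x = y then indicator (B i) x else 0))"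
          by (intro sum.cong) (auto simp: q'_def algebra_simps)
        also have "\<dots> = (1 - t) * Q i + t * indicator (B i) y"
          using y P(1) by (simp add: sum.distrib sum_distrib_left[symmetric] Q_def)
        finally show ?thesis .
      qed
      have "(\<Sum>x\<in>P. q' x) = (1 - t) * (\<Sum>x\<in>P. q x) + t * (\<Sum>x\<in>P. if x = y then 1 else 0)"
        unfolding q'_def by (simp only: sum.distrib sum_distrib_left)
      also have "\<dots> = 1" using y P(1) q(2) by simp
      finally have "(\<Sum>i\<in>I. (c i)\<^sup>2) \<le> (\<Sum>i\<in>I. (max 0 (((1 - t) * Q i + t * indicator (B i) y) / b i - 1))\<^sup>2)"
        using q(3)[of q'] t q(1) unfolding q'Q by (simp add: c_def u_def Q_def q'_def)
      also have "\<dots> \<le> (\<Sum>i\<in>I. (c i)\<^sup>2 + 2 * (t * a i) * c i + (t * a i)\<^sup>2)"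
      proof (rule sum_mono)
        fix i assume "i \<in> I"
        have "((1 - t) * Q i + t * indicator (B i) y) / b i - 1 = u i + t * a i"
          using b[OF \<open>i \<in> I\<close>] by (simp add: u_def a_def field_simps)
        then show "(max 0 (((1 - t) * Q i + t * indicator (B i) y) / b i - 1))\<^sup>2
          \<le> (c i)\<^sup>2 + 2 * (t * a i) * c i + (t * a i)\<^sup>2"
          using max0_add_sq_le[of "u i" "t * a i"] by (simp add: c_def)
      qed
      also have "\<dots> = (\<Sum>i\<in>I. (c i)\<^sup>2) + t * (2 * (\<Sum>i\<in>I. a i * c i) + t * A)"
        by (simp add: sum.distrib A_def sum_distrib_left power2_eq_square algebra_simps)
      finally have "0 \<le> t * (2 * (\<Sum>i\<in>I. a i * c i) + t * A)" by simp
      then show ?thesis using t by (simp add: zero_le_mult_iff)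
    qed
    have "0 \<le> 2 * (\<Sum>i\<in>I. a i * c i)"
    proof (rule tendsto_lowerbound)
      show "((\<lambda>t. 2 * (\<Sum>i\<in>I. a i * c i) + t * A) \<longlongrightarrow> 2 * (\<Sum>i\<in>I. a i * c i)) (at_right 0)"
        by (auto intro!: tendsto_eq_intros)
      show "\<forall>\<^sub>F t in at_right 0. 0 \<le> 2 * (\<Sum>i\<in>I. a i * c i) + t * A"
        using var unfolding eventually_at_right_field by (auto intro!: exI[of _ 1])
    qed simp
    also have "(\<Sum>i\<in>I. a i * c i) = (\<Sum>i\<in>I. c i / b i * indicator (B i) y) - (\<Sum>i\<in>I. c i + (c i)\<^sup>2)"
      unfolding sum_subtractf[symmetric]
    proof (rule sum.cong)
      fix i assume "i \<in> I"
      have "Q i / b i = 1 + u i" by (simp add: u_def)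
      then have "a i * c i = c i / b i * indicator (B i) y - (1 + u i) * c i"
        by (simp add: a_def diff_divide_distrib algebra_simps)
      then show "a i * c i = c i / b i * indicator (B i) y - (c i + (c i)\<^sup>2)"
        using cu[of i] by (simp add: algebra_simps)
    qed simp
    finally show ?thesis by simp
  qed
  have c0: "c i \<ge> 0" for i by (simp add: c_def)
  have c_zero: "c i = 0" if "i \<in> I" for i
  proof (rule ccontr)
    assume "c i \<noteq> 0"
    \<comment> \<open>By the first-order inequality the coefficients \<open>c i / b i / T\<close>
      cover every point of \<open>P\<close>, but their cost is the sum of the \<open>c i\<close>
      divided by \<open>T\<close>, which the squares in \<open>T\<close> push below 1.\<close>
    define T where "T = (\<Sum>i\<in>I. c i + (c i)\<^sup>2)"
    have "(\<Sum>i\<in>I. c i) < T"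
      unfolding T_def using \<open>c i \<noteq> 0\<close> that I by (intro sum_strict_mono_ex1) auto
    moreover have "0 \<le> (\<Sum>i\<in>I. c i)" using c0 by (simp add: sum_nonneg)
    ultimately have T: "T > 0" "(\<Sum>i\<in>I. c i) < T" by auto
    have "1 \<le> (\<Sum>i\<in>I. c i / b i / T * b i)"
    proof (rule cover)
      show "0 \<le> c i / b i / T" if "i \<in> I" for i using c0[of i] b[OF that] T by simp
      show "1 \<le> (\<Sum>i\<in>I. c i / b i / T * indicator (B i) x)" if "x \<in> P" for x
      proof -
        have "T / T \<le> (\<Sum>i\<in>I. c i / b i * indicator (B i) x) / T"
          using first_order[OF that] T by (intro divide_right_mono) (auto simp: T_def)
        then show ?thesis using T by (simp add: sum_divide_distrib)
      qed
    qed
    also have "\<dots> = (\<Sum>i\<in>I. c i) / T"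
      unfolding sum_divide_distrib using b by (intro sum.cong) (auto simp: less_imp_neq[symmetric])
    finally show False using T by simp
  qed
  obtain p where p: "set_pmf p \<subseteq> P" "\<And>x. x \<in> P \<Longrightarrow> pmf p x = q x"
    using finite_pmf_exists[OF P(1) q(1) q(2)] by blast
  show ?thesis
  proof
    show "set_pmf p \<subseteq> P" by fact
    fix i assume i: "i \<in> I"
    have "measure_pmf.prob p (B i) = measure_pmf.prob p (B i \<inter> P)"
      using p(1) by (intro measure_pmf.finite_measure_eq_AE AE_pmfI) auto
    also have "\<dots> = (\<Sum>x\<in>B i \<inter> P. q x)"
      using P(1) p(2) by (subst measure_measure_pmf_finite) auto
    also have "\<dots> = Q i"
      unfolding Q_def using P(1) by (simp add: indicator_def if_distrib sum.If_cases Int_commute cong: if_cong)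
    also have "\<dots> \<le> b i"
      using c_zero[OF i] b[OF i] by (simp add: c_def u_def max_def field_simps split: if_splits)
    finally show "measure_pmf.prob p (B i) \<le> b i" .
  qed
qed

text \<open>Finitely many sets realise only finitely many membership patterns, so one representative
  of each pattern replaces the infinite set \<open>K\<close>.\<close>

lemma fractional_cover_duality:
  fixes B :: "'i \<Rightarrow> 'a set" and b :: "'i \<Rightarrow> real"
  assumes I: "finite I" and K: "K \<noteq> {}" and b: "\<And>i. i \<in> I \<Longrightarrow> b i > 0"
    and cover: "\<And>c. \<lbrakk>\<And>i. i \<in> I \<Longrightarrow> c i \<ge> 0;
       \<And>x. x \<in> K \<Longrightarrow> 1 \<le> (\<Sum>i\<in>I. c i * indicator (B i) x)\<rbrakk> \<Longrightarrow> 1 \<le> (\<Sum>i\<in>I. c i * b i)"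
  obtains p where "set_pmf p \<subseteq> K" "\<And>i. i \<in> I \<Longrightarrow> measure_pmf.prob p (B i) \<le> b i"
proof -
  define pat where "pat x = {i\<in>I. x \<in> B i}" for x
  have "finite (pat ` K)"
    by (rule finite_subset[of _ "Pow I"]) (use I in \<open>auto simp: pat_def\<close>)
  then obtain P where P: "P \<subseteq> K" "finite P" "pat ` K = pat ` P"
    using finite_subset_image[of "pat ` K" pat K] by auto
  have "P \<noteq> {}" using K P(3) by auto
  show ?thesis
  proof (rule fractional_cover_duality_finite[OF I P(2) \<open>P \<noteq> {}\<close> b])
    fix p
    assume "set_pmf p \<subseteq> P" "\<And>i. i \<in> I \<Longrightarrow> measure_pmf.prob p (B i) \<le> b i"
    then show thesis using that P(1) by blast
  next
    fix c :: "'i \<Rightarrow> real"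
    assume c: "\<And>i. i \<in> I \<Longrightarrow> 0 \<le> c i" "\<And>x. x \<in> P \<Longrightarrow> 1 \<le> (\<Sum>i\<in>I. c i * indicator (B i) x)"
    show "1 \<le> (\<Sum>i\<in>I. c i * b i)"
    proof (rule cover[OF c(1)])
      fix x assume "x \<in> K"
      then obtain y where y: "y \<in> P" "pat x = pat y" using P(3) by blast
      have "indicator (B i) x = (indicator (B i) y :: real)" if "i \<in> I" for i
        using y(2) that by (auto simp: pat_def indicator_def)
      then show "1 \<le> (\<Sum>i\<in>I. c i * indicator (B i) x)" using c(2)[OF y(1)] by simp
    qed
  qed
qed

section \<open>Bowen balls, Birkhoff sums and comparison\<close>

locale bs_system = compact_metric d for d :: "'a::topological_space \<Rightarrow> 'a \<Rightarrow> real" +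
  fixes f :: "'a \<Rightarrow> 'a" and \<phi> :: "'a \<Rightarrow> real"
  assumes cont_f: "continuous_on UNIV f" and cont_\<phi>: "continuous_on UNIV \<phi>"
    and \<phi>_pos: "\<phi> x > 0"
begin

abbreviation S :: "nat \<Rightarrow> 'a \<Rightarrow> real" where "S \<equiv> birkhoff_sum f \<phi>"
abbreviation oball :: "nat \<Rightarrow> 'a \<Rightarrow> real \<Rightarrow> 'a set" where "oball \<equiv> bowen_ball d f"
abbreviation clball :: "nat \<Rightarrow> 'a \<Rightarrow> real \<Rightarrow> 'a set" where "clball \<equiv> bowen_cball d f"
abbreviation weight :: "real \<Rightarrow> real \<Rightarrow> nat \<Rightarrow> 'a \<Rightarrow> ennreal" where "weight \<equiv> ball_weight d f \<phi>"

lemma in_oball: "0 < n \<Longrightarrow> y \<in> oball n x e \<longleftrightarrow> (\<forall>j<n. d ((f ^^ j) x) ((f ^^ j) y) < e)"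
  by (subst bowen_ball_def, simp add: bowen_dist_def, subst Max_less_iff) auto

lemma in_clball: "0 < n \<Longrightarrow> y \<in> clball n x e \<longleftrightarrow> (\<forall>j<n. d ((f ^^ j) x) ((f ^^ j) y) \<le> e)"
  by (subst bowen_cball_def, simp add: bowen_dist_def, subst Max_le_iff) auto

lemma d_triangle: "d x z \<le> d x y + d y z"
  by (rule triangle) auto

lemma center_in_oball: "0 < n \<Longrightarrow> 0 < e \<Longrightarrow> x \<in> oball n x e"
  by (simp add: in_oball)

lemma oball_sym: "0 < n \<Longrightarrow> y \<in> oball n x e \<Longrightarrow> x \<in> oball n y e"
  by (simp add: in_oball commute)

lemma oball_subset: "0 < n \<Longrightarrow> y \<in> oball n x r \<Longrightarrow> r + s \<le> e \<Longrightarrow> oball n y s \<subseteq> oball n x e"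
proof (rule subsetI)
  fix z assume n: "0 < n" and y: "y \<in> oball n x r" and le: "r + s \<le> e" and z: "z \<in> oball n y s"
  have "d ((f ^^ j) x) ((f ^^ j) z) < e" if "j < n" for j
  proof -
    have "d ((f ^^ j) x) ((f ^^ j) y) < r" "d ((f ^^ j) y) ((f ^^ j) z) < s"
      using y z that n by (simp_all add: in_oball)
    then show ?thesis using d_triangle[of "(f ^^ j) x" "(f ^^ j) z" "(f ^^ j) y"] le by linarith
  qed
  then show "z \<in> oball n x e" using n by (simp add: in_oball)
qed

lemma continuous_iterate: "continuous_on UNIV (f ^^ j)"
proof (induction j)
  case (Suc j)
  then show ?case
    using continuous_on_compose[OF Suc continuous_on_subset[OF cont_f]] by (simp add: o_def)
qed simp

lemma open_dist_preimage: "open {y. d x ((f ^^ j) y) < e}"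
proof -
  have "{y. d x ((f ^^ j) y) < e} = (f ^^ j) -` mball x e" by auto
  then show ?thesis using open_vimage[OF open_ball continuous_iterate] by simp
qed

lemma open_oball: "0 < n \<Longrightarrow> open (oball n x e)"
proof -
  assume "0 < n"
  then have eq: "oball n x e = (\<Inter>j\<in>{..<n}. {y. d ((f ^^ j) x) ((f ^^ j) y) < e})"
    by (auto simp: in_oball)
  show ?thesis unfolding eq by (intro open_INT ballI finite_lessThan open_dist_preimage)
qed

lemma closed_clball: "0 < n \<Longrightarrow> closed (clball n x e)"
proof -
  assume n: "0 < n"
  have op: "open {y. e < d ((f ^^ j) x) ((f ^^ j) y)}" for j
    using open_vimage[OF open_gt continuous_iterate[of j], of e "(f ^^ j) x"] by (simp add: vimage_def)
  have eq: "- clball n x e = (\<Union>j<n. {y. e < d ((f ^^ j) x) ((f ^^ j) y)})"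
    using n by (auto simp: in_clball not_le) (meson leD)
  have "open (- clball n x e)" unfolding eq by (intro open_UN ballI op)
  then show ?thesis by (simp add: closed_def)
qed

lemma \<phi>_bounds: obtains m M where "0 < m" "\<And>x. m \<le> \<phi> x" "\<And>x. \<phi> x \<le> M"
proof -
  obtain x0 where "\<And>x. \<phi> x0 \<le> \<phi> x"
    using continuous_attains_inf[OF cpt _ cont_\<phi>] by auto
  moreover obtain x1 where "\<And>x. \<phi> x \<le> \<phi> x1"
    using continuous_attains_sup[OF cpt _ cont_\<phi>] by auto
  ultimately show ?thesis using that[of "\<phi> x0" "\<phi> x1"] \<phi>_pos by blast
qed

lemma S_lower: "(\<And>x. m \<le> \<phi> x) \<Longrightarrow> real n * m \<le> S n x"
  using sum_mono[of "{..<n}" "\<lambda>_. m" "\<lambda>i. \<phi> ((f ^^ i) x)"] by (simp add: birkhoff_sum_def)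

lemma S_upper: "(\<And>x. \<phi> x \<le> M) \<Longrightarrow> S n x \<le> real n * M"
  using sum_mono[of "{..<n}" "\<lambda>i. \<phi> ((f ^^ i) x)" "\<lambda>_. M"] by (simp add: birkhoff_sum_def)

lemma S_nonneg: "0 \<le> S n x"
  unfolding birkhoff_sum_def using \<phi>_pos by (intro sum_nonneg) (simp add: less_imp_le)

lemma S_pos: "0 < n \<Longrightarrow> 0 < S n x"
  unfolding birkhoff_sum_def using \<phi>_pos by (intro sum_pos) auto

lemma S_le_SUP: "y \<in> A \<Longrightarrow> S n y \<le> (SUP y\<in>A. S n y)"
proof (rule cSUP_upper)
  obtain m M where "\<And>x. \<phi> x \<le> M" using \<phi>_bounds by metis
  then show "bdd_above (S n ` A)" using S_upper[of M n] by (auto intro!: bdd_aboveI2)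
qed

lemma SUP_S_nonneg: "0 < n \<Longrightarrow> 0 < e \<Longrightarrow> 0 \<le> (SUP y\<in>oball n x e. S n y)"
  using S_le_SUP[OF center_in_oball[of n e x], of n] S_nonneg[of n x] by linarith

section \<open>Comparison of Birkhoff sums inside a Bowen ball\<close>

text \<open>A multiplicative modulus of continuity. A ratio bound passes through sums of any length,
  so it controls \<open>S n\<close> with a factor independent of \<open>n\<close>.\<close>

definition comparable :: "real \<Rightarrow> real \<Rightarrow> bool" where
  "comparable \<theta> e \<longleftrightarrow> (\<forall>x y. d x y < e \<longrightarrow> \<phi> y \<le> \<theta> * \<phi> x)"

lemma comparable_mono: "comparable \<theta> e \<Longrightarrow> e' \<le> e \<Longrightarrow> comparable \<theta> e'"
  by (auto simp: comparable_def)

lemma comparable_S: "comparable \<theta> e \<Longrightarrow> 0 < n \<Longrightarrow> y \<in> oball n x e \<Longrightarrow> S n y \<le> \<theta> * S n x"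
  unfolding birkhoff_sum_def sum_distrib_left
  by (intro sum_mono) (auto simp: comparable_def in_oball)

lemma comparable_SUP:
  "comparable \<theta> e \<Longrightarrow> 0 < n \<Longrightarrow> 0 < e \<Longrightarrow> (SUP y\<in>oball n x e. S n y) \<le> \<theta> * S n x"
  using center_in_oball[of n e x] by (intro cSUP_least) (auto intro: comparable_S)

lemma comparable_exists:
  assumes "1 < \<theta>"
  obtains e where "0 < e" "comparable \<theta> e"
proof -
  \<comment> \<open>Two nearby points are compared through the centre of a covering ball, so the
    factor is spent twice. For the same reason the local estimate holds up to distance
    \<open>2 * r\<close>: one radius to reach \<open>y\<close>, another to reach
    \<open>z\<close>.\<close>
  define t where "t = sqrt \<theta>"
  have t: "t > 1" "t * t = \<theta>" using assms by (auto simp: t_def)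
  have "\<exists>r>0. \<forall>y. d x y < 2 * r \<longrightarrow> \<phi> y < t * \<phi> x \<and> \<phi> x < t * \<phi> y" for x
  proof -
    have "open {y. \<phi> y < t * \<phi> x \<and> \<phi> x < t * \<phi> y}"
      by (intro open_Collect_conj open_Collect_less continuous_intros cont_\<phi>)
    moreover have "x \<in> {y. \<phi> y < t * \<phi> x \<and> \<phi> x < t * \<phi> y}" using t \<phi>_pos[of x] by simp
    ultimately obtain r where "r > 0" "mball x r \<subseteq> {y. \<phi> y < t * \<phi> x \<and> \<phi> x < t * \<phi> y}"
      unfolding open_iff by blast
    then show ?thesis by (intro exI[of _ "r/2"]) (auto simp: subset_iff)
  qed
  then obtain r where r: "\<And>x. r x > 0"
    "\<And>x y. d x y < 2 * r x \<Longrightarrow> \<phi> y < t * \<phi> x \<and> \<phi> x < t * \<phi> y" by metis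
  obtain F where F: "finite F" "UNIV \<subseteq> (\<Union>x\<in>F. mball x (r x))"
    by (rule compact_ball_cover[OF _ _ cpt, of "\<lambda>x. mball x (r x)"]) (use r in auto)
  have Fne: "F \<noteq> {}" using F(2) by auto
  show ?thesis
  proof
    show "0 < Min (r ` F)" using F(1) Fne r by auto
    show "comparable \<theta> (Min (r ` F))"
      unfolding comparable_def
    proof (intro allI impI)
      fix y z assume yz: "d y z < Min (r ` F)"
      obtain x where x: "x \<in> F" "d x y < r x" using F(2) UNIV_I[of y] by (auto simp: subset_iff)
      have "d y z < r x" using yz F(1) x(1) by (meson Min_le finite_imageI image_eqI less_le_trans)
      then have "\<phi> z < t * \<phi> x" "\<phi> x < t * \<phi> y"
        using r(2)[of x z] r(2)[of x y] x d_triangle[of x z y] r(1)[of x] by auto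
      then have "\<phi> z \<le> t * (t * \<phi> y)" using t by (smt (verit) mult_left_mono)
      then show "\<phi> z \<le> \<theta> * \<phi> y" using t(2) by (simp add: mult.assoc[symmetric])
    qed
  qed
qed

section \<open>Reduction of covers and packings to finite families\<close>

lemma infsum_ennreal_SUP:
  fixes g :: "'i \<Rightarrow> ennreal"
  shows "infsum g I = (SUP F\<in>{F. finite F \<and> F \<subseteq> I}. sum g F)"
  by (rule nonneg_infsum_complete) simp

lemma sum_le_infsum_ennreal:
  fixes g :: "'i \<Rightarrow> ennreal"
  shows "finite F \<Longrightarrow> F \<subseteq> I \<Longrightarrow> sum g F \<le> infsum g I"
  unfolding infsum_ennreal_SUP by (rule SUP_upper) simp

text \<open>Translates between finite sets of pairs of a time and a centre, in which the arguments
  are carried out, and the families indexed by natural numbers of the definitions.\<close>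

lemma finite_enumeration:
  assumes "finite (T :: (nat \<times> 'a) set)"
  obtains I :: "nat set" and n x where "finite I" "bij_betw (\<lambda>i. (n i, x i)) I T"
proof -
  obtain h where h: "bij_betw h {0..<card T} T" using assms ex_bij_betw_nat_finite by blast
  show ?thesis
    using h that[of "{0..<card T}" "fst \<circ> h" "snd \<circ> h"] by simp
qed

lemma BS_pre_le:
  assumes T: "finite T" "\<And>n x. (n, x) \<in> T \<Longrightarrow> N \<le> n" and Z: "Z \<subseteq> (\<Union>(n, x)\<in>T. oball n x e)"
  shows "BS_pre d f \<phi> lam Z N e \<le> (\<Sum>(n, x)\<in>T. weight lam e n x)"
proof -
  obtain I :: "nat set" and n x where I: "finite I" "bij_betw (\<lambda>i. (n i, x i)) I T"
    using finite_enumeration[OF T(1)] by blast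
  have img: "(\<lambda>i. (n i, x i)) ` I = T" using I(2) by (rule bij_betw_imp_surj_on)
  have "(\<Sum>(n, x)\<in>T. weight lam e n x) = (\<Sum>i\<in>I. weight lam e (n i) (x i))"
    using sum.reindex_bij_betw[OF I(2), of "\<lambda>(n, x). weight lam e n x"] by simp
  also have "\<dots> = (\<Sum>\<^sub>\<infinity>i\<in>I. weight lam e (n i) (x i))" using I(1) by simp
  finally show ?thesis
    unfolding BS_pre_def using T(2) Z img by (intro Inf_lower) (auto intro!: exI[of _ I] exI[of _ n] exI[of _ x])
qed

text \<open>Bowen balls of positive time are open, so a countable cover of the compact set has a
  finite subcover, whose sum is no larger.\<close>

lemma BS_pre_less:
  assumes "compact K" "0 < N" "BS_pre d f \<phi> lam K N e < c"
  obtains I :: "nat set" and n x where "finite I" "\<And>i. i \<in> I \<Longrightarrow> N \<le> n i"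
    "K \<subseteq> (\<Union>i\<in>I. oball (n i) (x i) e)" "(\<Sum>i\<in>I. weight lam e (n i) (x i)) < c"
proof -
  obtain I :: "nat set" and n x where I: "\<And>i. i \<in> I \<Longrightarrow> N \<le> n i"
    "K \<subseteq> (\<Union>i\<in>I. oball (n i) (x i) e)" "(\<Sum>\<^sub>\<infinity>i\<in>I. weight lam e (n i) (x i)) < c"
    using assms(3) unfolding BS_pre_def Inf_less_iff by blast
  have "open (oball (n i) (x i) e)" if "i \<in> I" for i
    using I(1)[OF that] assms(2) by (intro open_oball) simp
  then obtain J where J: "J \<subseteq> I" "finite J" "K \<subseteq> (\<Union>i\<in>J. oball (n i) (x i) e)"
    using compactE_image[OF assms(1), of I "\<lambda>i. oball (n i) (x i) e"] I(2) by metis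
  have "(\<Sum>i\<in>J. weight lam e (n i) (x i)) < c"
    using sum_le_infsum_ennreal[OF J(2,1)] I(3) by (rule le_less_trans)
  then show ?thesis using that[of J n x] J I(1) by blast
qed

lemma le_BSP_pre:
  assumes T: "finite T" "\<And>n x. (n, x) \<in> T \<Longrightarrow> N \<le> n \<and> x \<in> Z"
    and disj: "disjoint_family_on (\<lambda>(n, x). clball n x e) T"
  shows "(\<Sum>(n, x)\<in>T. weight lam e n x) \<le> BSP_pre d f \<phi> Z lam N e"
proof -
  obtain I :: "nat set" and n x where I: "finite I" "bij_betw (\<lambda>i. (n i, x i)) I T"
    using finite_enumeration[OF T(1)] by blast
  have img: "\<And>i. i \<in> I \<Longrightarrow> (n i, x i) \<in> T" using bij_betwE[OF I(2)] by blast
  have inj: "inj_on (\<lambda>i. (n i, x i)) I" using I(2) by (rule bij_betw_imp_inj_on)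
  have "(\<Sum>(n, x)\<in>T. weight lam e n x) = (\<Sum>i\<in>I. weight lam e (n i) (x i))"
    using sum.reindex_bij_betw[OF I(2), of "\<lambda>(n, x). weight lam e n x"] by simp
  also have "\<dots> = (\<Sum>\<^sub>\<infinity>i\<in>I. weight lam e (n i) (x i))" using I(1) by simp
  finally have eq: "(\<Sum>(n, x)\<in>T. weight lam e n x) = (\<Sum>\<^sub>\<infinity>i\<in>I. weight lam e (n i) (x i))" .
  have "disjoint_family_on (\<lambda>i. clball (n i) (x i) e) I"
    unfolding disjoint_family_on_def
  proof (intro ballI impI)
    fix i j assume ij: "i \<in> I" "j \<in> I" "i \<noteq> j"
    then have "(n i, x i) \<noteq> (n j, x j)" using inj by (meson inj_onD)
    then show "clball (n i) (x i) e \<inter> clball (n j) (x j) e = {}"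
      using disjoint_family_onD[OF disj img[OF ij(1)] img[OF ij(2)]] by simp
  qed
  then show ?thesis
    unfolding BSP_pre_def eq using T(2) img by (intro Sup_upper) blast
qed

lemma less_BSP_pre:
  assumes "c < BSP_pre d f \<phi> Z lam N e"
  obtains I :: "nat set" and n x where "finite I" "\<And>i. i \<in> I \<Longrightarrow> N \<le> n i" "\<And>i. i \<in> I \<Longrightarrow> x i \<in> Z"
    "disjoint_family_on (\<lambda>i. clball (n i) (x i) e) I" "c < (\<Sum>i\<in>I. weight lam e (n i) (x i))"
proof -
  obtain I :: "nat set" and n x where I: "\<forall>i\<in>I. N \<le> n i \<and> x i \<in> Z"
    "disjoint_family_on (\<lambda>i. clball (n i) (x i) e) I" "c < (\<Sum>\<^sub>\<infinity>i\<in>I. weight lam e (n i) (x i))"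
    using assms unfolding BSP_pre_def less_Sup_iff by blast
  obtain F where F: "finite F" "F \<subseteq> I" "c < (\<Sum>i\<in>F. weight lam e (n i) (x i))"
    using I(3) unfolding infsum_ennreal_SUP less_SUP_iff by blast
  show ?thesis
    using that[of F n x] F I disjoint_family_on_mono[OF F(2) I(2)] by blast
qed

lemma BS_pre_mono: "N \<le> N' \<Longrightarrow> BS_pre d f \<phi> lam Z N e \<le> BS_pre d f \<phi> lam Z N' e"
  unfolding BS_pre_def by (intro Inf_superset_mono) (blast intro: order_trans)

lemma BS_outer_eq_SUP: "BS_outer d f \<phi> lam Z e = (SUP N. BS_pre d f \<phi> lam Z N e)"
proof -
  have "incseq (\<lambda>N. BS_pre d f \<phi> lam Z N e)"
    by (intro monoI BS_pre_mono)
  then show ?thesis unfolding BS_outer_def by (intro limI LIMSEQ_SUP)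
qed

lemma BSP_pre_antimono: "N \<le> N' \<Longrightarrow> BSP_pre d f \<phi> Z lam N' e \<le> BSP_pre d f \<phi> Z lam N e"
  unfolding BSP_pre_def
proof (intro Sup_subset_mono Collect_mono impI, elim exE conjE)
  fix s and I :: "nat set" and n x
  assume "N \<le> N'" and I: "\<forall>i\<in>I. N' \<le> n i \<and> x i \<in> Z"
    and rest: "s = (\<Sum>\<^sub>\<infinity>i\<in>I. weight lam e (n i) (x i))"
      "disjoint_family_on (\<lambda>i. clball (n i) (x i) e) I"
  have "\<forall>i\<in>I. N \<le> n i \<and> x i \<in> Z"
    using I \<open>N \<le> N'\<close> by (meson order_trans)
  then show "\<exists>(I :: nat set) n x. s = (\<Sum>\<^sub>\<infinity>i\<in>I. weight lam e (n i) (x i)) \<and>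
      (\<forall>i\<in>I. N \<le> n i \<and> x i \<in> Z) \<and> disjoint_family_on (\<lambda>i. clball (n i) (x i) e) I"
    using rest by (intro exI conjI)
qed

lemma BSP_lim_eq_INF: "BSP_lim d f \<phi> Z lam e = (INF N. BSP_pre d f \<phi> Z lam N e)"
proof -
  have "decseq (\<lambda>N. BSP_pre d f \<phi> Z lam N e)"
    by (intro antimonoI BSP_pre_antimono)
  then show ?thesis unfolding BSP_lim_def by (intro limI LIMSEQ_INF)
qed

text \<open>This is what makes the critical exponents nonnegative: below exponent 0 a single ball
  already prevents small sums.\<close>

lemma weight_ge_1:
  assumes "lam \<le> 0" "0 < n" "0 < e"
  shows "1 \<le> weight lam e n x"
proof -
  have "0 \<le> - lam * (SUP y\<in>oball n x e. S n y)"
    using assms SUP_S_nonneg[of n e x] by (intro mult_nonneg_nonneg) auto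
  then have "1 \<le> exp (- lam * (SUP y\<in>oball n x e. S n y))" by (simp only: one_le_exp_iff)
  then have "ennreal 1 \<le> weight lam e n x" unfolding ball_weight_def by (rule ennreal_leI)
  then show ?thesis by simp
qed

end

section \<open>Upper bounds for the entropies\<close>

text \<open>\<open>A\<close> is an arbitrary set. The intersection of measurable supersets of
  measure at most \<open>1 / real (Suc k)\<close> is a measurable null set containing it.\<close>

lemma AE_notin_if_small_cover:
  assumes "prob_space \<mu>"
    and small: "\<And>\<eta>::real. \<eta> > 0 \<Longrightarrow> \<exists>U\<in>sets \<mu>. A \<subseteq> U \<and> measure \<mu> U \<le> \<eta>"
  shows "AE x in \<mu>. x \<notin> A"
proof -
  interpret prob_space \<mu> by fact
  have "\<forall>k. \<exists>U\<in>sets \<mu>. A \<subseteq> U \<and> measure \<mu> U \<le> 1 / real (Suc k)"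
    by (intro allI small) simp
  then obtain U where U: "\<And>k. U k \<in> sets \<mu>" "\<And>k. A \<subseteq> U k" "\<And>k. measure \<mu> (U k) \<le> 1 / real (Suc k)"
    by metis
  have sets: "(\<Inter>k. U k) \<in> sets \<mu>" using U(1) by auto
  have "measure \<mu> (\<Inter>k. U k) \<le> 0 + \<eta>" if \<eta>: "\<eta> > 0" for \<eta>
  proof -
    obtain k where "1 / real (Suc k) < \<eta>" using reals_Archimedean[OF \<eta>] by (auto simp: inverse_eq_divide)
    moreover have "measure \<mu> (\<Inter>k. U k) \<le> measure \<mu> (U k)" using U(1) by (intro finite_measure_mono) auto
    ultimately show ?thesis using U(3)[of k] by simp
  qed
  then have "measure \<mu> (\<Inter>k. U k) \<le> 0" by (rule field_le_epsilon)
  then have "emeasure \<mu> (\<Inter>k. U k) = 0" by (simp add: emeasure_eq_measure measure_le_0_iff)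
  then show ?thesis
    using sets U(2) by (intro AE_I[where N = "\<Inter>k. U k"]) auto
qed

lemma liminf_le_if_infinitely_often:
  fixes g :: "nat \<Rightarrow> ereal"
  assumes "\<And>N. \<exists>n\<ge>N. g n \<le> c"
  shows "liminf g \<le> c"
  unfolding liminf_SUP_INF
proof (rule SUP_least)
  fix N
  obtain n where "n \<ge> N" "g n \<le> c" using assms by blast
  then show "(INF n\<in>{N..}. g n) \<le> c" by (intro INF_lower2[of n]) auto
qed

lemma le_limsup_if_infinitely_often:
  fixes g :: "nat \<Rightarrow> ereal"
  assumes "\<And>N. \<exists>n\<ge>N. c \<le> g n"
  shows "c \<le> limsup g"
  unfolding limsup_INF_SUP
proof (rule INF_greatest)
  fix N
  obtain n where "n \<ge> N" "c \<le> g n" using assms by blast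
  then show "c \<le> (SUP n\<in>{N..}. g n)" by (intro SUP_upper2[of n]) auto
qed

lemma neg_elog_divide_le:
  assumes "0 < t" "exp (- s * t) \<le> p"
  shows "- elog p / ereal t \<le> ereal s"
proof -
  have p: "p > 0" using assms(2) exp_gt_zero less_le_trans by blast
  then have "- s * t \<le> ln p" using assms(2) ln_ge_iff by blast
  then have "- ln p / t \<le> s" using assms(1) by (simp add: field_simps)
  then show ?thesis using p assms(1) by (simp add: elog_def)
qed

lemma neg_elog_divide_ge:
  assumes "0 < t" "0 \<le> p" "p \<le> exp (- s * t)"
  shows "ereal s \<le> - elog p / ereal t"
proof (cases "p = 0")
  case True
  then show ?thesis using assms by (simp add: elog_def)
next
  case False
  then have p: "p > 0" using assms(2) by simp
  then have "ln p \<le> - s * t" using assms(3) ln_le_cancel_iff[of p "exp (- s * t)"] by simp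
  then have "s \<le> - ln p / t" using assms(1) by (simp add: field_simps)
  then show ?thesis using p assms(1) by (simp add: elog_def)
qed

lemma nn_integral_e2ennreal_le:
  assumes "prob_space \<mu>" "AE x in \<mu>. g x \<le> ereal s"
  shows "(\<integral>\<^sup>+ x. e2ennreal (g x) \<partial>\<mu>) \<le> ennreal s"
proof -
  interpret prob_space \<mu> by fact
  have "(\<integral>\<^sup>+ x. e2ennreal (g x) \<partial>\<mu>) \<le> (\<integral>\<^sup>+ x. ennreal s \<partial>\<mu>)"
  proof (rule nn_integral_mono_AE)
    show "AE x in \<mu>. e2ennreal (g x) \<le> ennreal s"
      using assms(2)
    proof eventually_elim
      case (elim x)
      from e2ennreal_mono[OF this] show ?case by simp
    qed
  qed
  then show ?thesis by (simp add: emeasure_space_1)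
qed

lemma le_nn_integral_e2ennreal:
  assumes "prob_space \<mu>" "AE x in \<mu>. ereal s \<le> g x"
  shows "ennreal s \<le> (\<integral>\<^sup>+ x. e2ennreal (g x) \<partial>\<mu>)"
proof -
  interpret prob_space \<mu> by fact
  have "(\<integral>\<^sup>+ x. ennreal s \<partial>\<mu>) \<le> (\<integral>\<^sup>+ x. e2ennreal (g x) \<partial>\<mu>)"
  proof (rule nn_integral_mono_AE)
    show "AE x in \<mu>. ennreal s \<le> e2ennreal (g x)"
      using assms(2)
    proof eventually_elim
      case (elim x)
      from e2ennreal_mono[OF this] show ?case by simp
    qed
  qed
  then show ?thesis by (simp add: emeasure_space_1)
qed

lemma borel_probsD:
  assumes "\<mu> \<in> borel_probs"
  shows "prob_space \<mu>" "sets \<mu> = sets borel" "space \<mu> = UNIV"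
  using assms sets_eq_imp_space_eq[of \<mu> borel] by (auto simp: borel_probs_def)

lemma AE_in_if_measure_1:
  assumes "\<mu> \<in> borel_probs" "K \<in> sets borel" "measure \<mu> K = 1"
  shows "AE x in \<mu>. x \<in> K"
proof -
  interpret prob_space \<mu> using assms borel_probsD by blast
  show ?thesis using assms borel_probsD(2)[OF assms(1)] by (intro AE_prob_1) simp
qed

context bs_system
begin

lemma open_in_sets: "\<mu> \<in> borel_probs \<Longrightarrow> open U \<Longrightarrow> U \<in> sets \<mu>"
  by (simp add: borel_probsD(2))

text \<open>On \<open>A N\<close> all balls from time \<open>Suc N\<close> on are too light. In a
  cheap cover by balls of radius \<open>e / 2\<close>, each ball that meets \<open>A N\<close> in a
  point \<open>y i\<close> lies in the ball of radius \<open>e\<close> about \<open>y i\<close>,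
  whose measure is at most the weight of the covering ball. So \<open>A N\<close> has arbitrarily
  small covers. Outside all \<open>A N\<close> the balls are heavy enough at arbitrarily late times,
  which bounds the lower limit.\<close>

lemma lower_entropy_le_of_BS_outer_zero:
  assumes \<mu>: "\<mu> \<in> borel_probs" "measure \<mu> K = 1" and K: "compact K"
    and comp: "comparable \<theta> e" and e: "0 < e" and lam: "0 \<le> lam"
    and zero: "BS_outer d f \<phi> lam K (e / 2) = 0"
  shows "lower_entropy d f \<phi> \<mu> e \<le> ennreal (\<theta> * lam)"
proof -
  interpret prob_space \<mu> using \<mu>(1) borel_probsD by blast
  define A where "A N = {x \<in> K. \<forall>n\<ge>Suc N. measure \<mu> (oball n x e) < exp (- (\<theta> * lam) * S n x)}" for N
  have null: "AE x in \<mu>. x \<notin> A N" for N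
  proof (rule AE_notin_if_small_cover)
    fix \<eta> :: real assume "\<eta> > 0"
    have "BS_pre d f \<phi> lam K (Suc N) (e / 2) \<le> BS_outer d f \<phi> lam K (e / 2)"
      unfolding BS_outer_eq_SUP by (rule SUP_upper) simp
    then have less: "BS_pre d f \<phi> lam K (Suc N) (e / 2) < ennreal \<eta>" using zero \<open>\<eta> > 0\<close> by simp
    obtain I :: "nat set" and n x where I: "finite I" "\<And>i. i \<in> I \<Longrightarrow> Suc N \<le> n i"
      "K \<subseteq> (\<Union>i\<in>I. oball (n i) (x i) (e / 2))" "(\<Sum>i\<in>I. weight lam (e / 2) (n i) (x i)) < ennreal \<eta>"
      by (rule BS_pre_less[OF K zero_less_Suc less]) blast
    define J where "J = {i \<in> I. oball (n i) (x i) (e / 2) \<inter> A N \<noteq> {}}"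
    have "\<forall>i\<in>J. \<exists>y. y \<in> oball (n i) (x i) (e / 2) \<and> y \<in> A N" unfolding J_def by blast
    from bchoice[OF this] obtain y where
      y: "\<And>i. i \<in> J \<Longrightarrow> y i \<in> oball (n i) (x i) (e / 2)" "\<And>i. i \<in> J \<Longrightarrow> y i \<in> A N"
      by blast
    have J: "finite J" "\<And>i. i \<in> J \<Longrightarrow> 0 < n i" "\<And>i. i \<in> J \<Longrightarrow> Suc N \<le> n i"
      using I(1) less_le_trans[OF zero_less_Suc I(2)] I(2) by (auto simp: J_def)
    have ball: "oball (n i) (x i) (e / 2) \<subseteq> oball (n i) (y i) e" if "i \<in> J" for i
      using oball_subset[OF J(2)[OF that] oball_sym[OF J(2)[OF that] y(1)[OF that]], of "e/2" e] by simp
    have SUP_le: "(SUP z\<in>oball (n i) (x i) (e / 2). S (n i) z) \<le> \<theta> * S (n i) (y i)" if "i \<in> J" for i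
    proof (rule cSUP_least)
      show "oball (n i) (x i) (e / 2) \<noteq> {}" using y(1)[OF that] by auto
      show "S (n i) z \<le> \<theta> * S (n i) (y i)" if "z \<in> oball (n i) (x i) (e / 2)" for z
        using comparable_S[OF comp J(2)] ball \<open>i \<in> J\<close> that by blast
    qed
    have bound: "measure \<mu> (oball (n i) (y i) e)
        \<le> exp (- lam * (SUP z\<in>oball (n i) (x i) (e / 2). S (n i) z))" if "i \<in> J" for i
    proof -
      have "measure \<mu> (oball (n i) (y i) e) < exp (- (\<theta> * lam) * S (n i) (y i))"
        using y(2)[OF that] J(3)[OF that] by (simp add: A_def)
      also have "\<dots> \<le> exp (- lam * (SUP z\<in>oball (n i) (x i) (e / 2). S (n i) z))"
        using mult_left_mono[OF SUP_le[OF that] lam] by (simp add: algebra_simps)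
      finally show ?thesis by simp
    qed
    show "\<exists>U\<in>sets \<mu>. A N \<subseteq> U \<and> measure \<mu> U \<le> \<eta>"
    proof (intro bexI conjI)
      show "A N \<subseteq> (\<Union>i\<in>J. oball (n i) (y i) e)"
      proof
        fix z assume z: "z \<in> A N"
        then obtain i where "i \<in> I" "z \<in> oball (n i) (x i) (e / 2)" using I(3) by (auto simp: A_def)
        then show "z \<in> (\<Union>i\<in>J. oball (n i) (y i) e)" using z ball[of i] by (auto simp: J_def)
      qed
      have sets: "oball (n i) (y i) e \<in> sets \<mu>" if "i \<in> J" for i
        using open_in_sets[OF \<mu>(1) open_oball[OF J(2)[OF that]]] .
      then show "(\<Union>i\<in>J. oball (n i) (y i) e) \<in> sets \<mu>" using J(1) by auto
      have "measure \<mu> (\<Union>i\<in>J. oball (n i) (y i) e) \<le> (\<Sum>i\<in>J. measure \<mu> (oball (n i) (y i) e))"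
        using J(1) sets by (intro measure_subadditive_finite) auto
      also have "\<dots> \<le> (\<Sum>i\<in>J. exp (- lam * (SUP z\<in>oball (n i) (x i) (e / 2). S (n i) z)))"
        by (rule sum_mono[OF bound])
      finally have "ennreal (measure \<mu> (\<Union>i\<in>J. oball (n i) (y i) e))
          \<le> (\<Sum>i\<in>J. weight lam (e / 2) (n i) (x i))"
        unfolding ball_weight_def by (subst sum_ennreal) (auto intro: ennreal_leI)
      also have "\<dots> \<le> (\<Sum>i\<in>I. weight lam (e / 2) (n i) (x i))"
        using I(1) by (intro sum_mono2) (auto simp: J_def)
      also have "\<dots> \<le> ennreal \<eta>" using I(4) by simp
      finally show "measure \<mu> (\<Union>i\<in>J. oball (n i) (y i) e) \<le> \<eta>"
        using \<open>\<eta> > 0\<close> by (simp add: ennreal_le_iff)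
    qed
  qed (rule prob_space_axioms)
  have "AE x in \<mu>. x \<in> K"
    using AE_in_if_measure_1[OF \<mu>(1) _ \<mu>(2)] closed_compact[OF K] by simp
  moreover have "AE x in \<mu>. \<forall>N. x \<notin> A N" using null by (simp add: AE_all_countable)
  ultimately have "AE x in \<mu>. liminf (\<lambda>n. - elog (measure \<mu> (oball n x e)) / ereal (S n x)) \<le> ereal (\<theta> * lam)"
  proof eventually_elim
    case (elim x)
    show ?case
    proof (rule liminf_le_if_infinitely_often)
      fix N
      obtain n where n: "n \<ge> Suc N" "exp (- (\<theta> * lam) * S n x) \<le> measure \<mu> (oball n x e)"
        using elim by (auto simp: A_def not_less)
      then have "- elog (measure \<mu> (oball n x e)) / ereal (S n x) \<le> ereal (\<theta> * lam)"
        by (intro neg_elog_divide_le S_pos) auto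
      then show "\<exists>n\<ge>N. - elog (measure \<mu> (oball n x e)) / ereal (S n x) \<le> ereal (\<theta> * lam)"
        using n(1) by (intro exI[of _ n]) auto
    qed
  qed
  then show ?thesis
    unfolding lower_entropy_def by (intro nn_integral_e2ennreal_le prob_space_axioms)
qed

text \<open>At the fixed time \<open>n\<close> all weights are at least
  \<open>exp (- lam * (real n * M))\<close>, while a disjoint family has total weight at most 1.
  This bounds the number of balls, and a family of largest cardinality is maximal.\<close>

lemma maximal_disjoint_centers:
  assumes n: "0 < n" and e: "0 < e" and lam: "0 \<le> lam"
    and E: "E \<subseteq> Z" and pre: "BSP_pre d f \<phi> Z lam n e < 1"
  obtains F where "finite F" "F \<subseteq> E" "(\<Sum>x\<in>F. weight lam e n x) \<le> 1"
    "\<And>y. y \<in> E \<Longrightarrow> \<exists>x\<in>F. clball n x e \<inter> clball n y e \<noteq> {}"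
proof -
  define P where "P F \<longleftrightarrow> finite F \<and> F \<subseteq> E \<and> disjoint_family_on (\<lambda>x. clball n x e) F" for F
  have sum_le: "(\<Sum>x\<in>F. weight lam e n x) \<le> 1" if "P F" for F
  proof -
    have "(\<Sum>x\<in>F. weight lam e n x) = (\<Sum>(k, x)\<in>{n} \<times> F. weight lam e k x)"
      by (simp add: sum.cartesian_product[symmetric])
    also have "\<dots> \<le> BSP_pre d f \<phi> Z lam n e"
      using that E by (intro le_BSP_pre) (auto simp: P_def disjoint_family_on_def)
    finally show ?thesis using pre by (meson order_trans less_imp_le)
  qed
  obtain M where M: "\<And>x. \<phi> x \<le> M" using \<phi>_bounds by metis
  have weight_ge: "ennreal (exp (- lam * (real n * M))) \<le> weight lam e n x" for x
  proof -
    have "(SUP y\<in>oball n x e. S n y) \<le> real n * M"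
      using center_in_oball[OF n e, of x] S_upper[of M n, OF M] by (intro cSUP_least) auto
    then show ?thesis
      unfolding ball_weight_def using lam by (intro ennreal_leI) (simp add: mult_left_mono)
  qed
  have card_le: "card F \<le> nat \<lceil>exp (lam * (real n * M))\<rceil>" if "P F" for F
  proof -
    have "ennreal (real (card F) * exp (- lam * (real n * M))) = (\<Sum>x\<in>F. ennreal (exp (- lam * (real n * M))))"
      by (simp add: ennreal_mult' ennreal_of_nat_eq_real_of_nat)
    also have "\<dots> \<le> (\<Sum>x\<in>F. weight lam e n x)" by (intro sum_mono weight_ge)
    also have "\<dots> \<le> ennreal 1" using sum_le[OF that] by simp
    finally have "real (card F) * exp (- lam * (real n * M)) \<le> 1" by (simp only: ennreal_le_iff zero_le_one)
    then have "real (card F) \<le> exp (lam * (real n * M))"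
      by (simp add: exp_minus field_simps)
    then show ?thesis by linarith
  qed
  have "P {}" by (simp add: P_def disjoint_family_on_def)
  then obtain F where F: "P F" "\<And>F'. P F' \<Longrightarrow> card F' \<le> card F"
    using ex_has_greatest_nat[of P "{}" card "Suc (nat \<lceil>exp (lam * (real n * M))\<rceil>)"] card_le
    unfolding less_Suc_eq_le by blast
  show ?thesis
  proof
    show "finite F" "F \<subseteq> E" using F(1) by (auto simp: P_def)
    show "(\<Sum>x\<in>F. weight lam e n x) \<le> 1" by (rule sum_le[OF F(1)])
    fix y assume y: "y \<in> E"
    show "\<exists>x\<in>F. clball n x e \<inter> clball n y e \<noteq> {}"
    proof (rule ccontr)
      assume *: "\<not> (\<exists>x\<in>F. clball n x e \<inter> clball n y e \<noteq> {})"
      have "y \<in> clball n y e" using n e by (simp add: in_clball)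
      then have "y \<notin> F" using * by blast
      moreover have "P (insert y F)"
        using F(1) y * by (auto simp: P_def disjoint_family_on_def Int_commute)
      ultimately show False using F(2)[of "insert y F"] F(1) by (simp add: P_def)
    qed
  qed
qed

lemma clball_meet:
  assumes "0 < n" "clball n x r \<inter> clball n y r \<noteq> {}" "2 * r < e"
  shows "y \<in> oball n x e"
proof -
  obtain z where z: "z \<in> clball n x r" "z \<in> clball n y r" using assms(2) by blast
  have "d ((f ^^ j) x) ((f ^^ j) y) < e" if "j < n" for j
  proof -
    have "d ((f ^^ j) x) ((f ^^ j) z) \<le> r" "d ((f ^^ j) y) ((f ^^ j) z) \<le> r"
      using z that assms(1) by (simp_all add: in_clball)
    then show ?thesis
      using d_triangle[of "(f ^^ j) x" "(f ^^ j) y" "(f ^^ j) z"] assms(3)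
      unfolding commute[of "(f ^^ j) y" "(f ^^ j) z"] by linarith
  qed
  then show ?thesis using assms(1) by (simp add: in_oball)
qed

text \<open>A maximal disjoint family of closed balls of radius \<open>e / 3\<close> centred in the
  bad set \<open>E n\<close> covers \<open>E n\<close> once the radii are raised to
  \<open>e\<close>; a third is used instead of a half because the enlarged balls are open. At bad
  centres the measure of the large ball is below the weight by a factor
  \<open>exp (- c) ^ n\<close>, and total weight at most 1 gives a summable series.\<close>

lemma AE_eventually_of_BSP_lim_less_1:
  assumes \<mu>: "\<mu> \<in> borel_probs" and comp: "comparable \<theta> e" and e: "0 < e" and lam: "0 \<le> lam"
    and s: "\<theta> * lam < s" and lim: "BSP_lim d f \<phi> Z lam (e / 3) < 1"
  shows "AE x in \<mu>. x \<in> Z \<longrightarrow> (\<forall>\<^sub>F n in sequentially. exp (- s * S n x) \<le> measure \<mu> (oball n x e))"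
proof -
  interpret prob_space \<mu> using \<mu>(1) borel_probsD by blast
  obtain m M where m: "0 < m" "\<And>x. m \<le> \<phi> x" using \<phi>_bounds by metis
  \<comment> \<open>The gap between \<open>s\<close> and \<open>\<theta> * lam\<close>, multiplied
    by a lower bound of \<open>\<phi>\<close>, is an exponential gain per unit of time.\<close>
  define c where "c = (s - \<theta> * lam) * m"
  have c: "c > 0" using s m by (simp add: c_def)
  obtain N0 where N0: "BSP_pre d f \<phi> Z lam N0 (e / 3) < 1"
    using lim unfolding BSP_lim_eq_INF INF_less_iff by blast
  define E where "E n = {x \<in> Z. measure \<mu> (oball n x e) < exp (- s * S n x)}" for n
  have "\<exists>U\<in>sets \<mu>. E n \<subseteq> U \<and> measure \<mu> U \<le> exp (- c) ^ n" if n: "Suc N0 \<le> n" for n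
  proof -
    have n0: "0 < n" using n by simp
    have "BSP_pre d f \<phi> Z lam n (e / 3) < 1"
      using BSP_pre_antimono[of N0 n] N0 n by (meson Suc_leD le_less_trans)
    then obtain F where F: "finite F" "F \<subseteq> E n" "(\<Sum>x\<in>F. weight lam (e / 3) n x) \<le> 1"
      "\<And>y. y \<in> E n \<Longrightarrow> \<exists>x\<in>F. clball n x (e / 3) \<inter> clball n y (e / 3) \<noteq> {}"
      using maximal_disjoint_centers[OF n0 _ lam, of "e/3" "E n" Z] e by (auto simp: E_def)
    have sets: "oball n x e \<in> sets \<mu>" for x using open_in_sets[OF \<mu>(1) open_oball[OF n0]] .
    have "measure \<mu> (\<Union>x\<in>F. oball n x e) \<le> (\<Sum>x\<in>F. measure \<mu> (oball n x e))"
      using F(1) sets by (intro measure_subadditive_finite) auto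
    also have "\<dots> \<le> (\<Sum>x\<in>F. exp (- c) ^ n * exp (- lam * (SUP z\<in>oball n x (e / 3). S n z)))"
    proof (rule sum_mono)
      fix x assume "x \<in> F"
      have "(SUP z\<in>oball n x (e / 3). S n z) \<le> \<theta> * S n x"
        using e by (intro comparable_SUP comparable_mono[OF comp] n0) auto
      then have "lam * (SUP z\<in>oball n x (e / 3). S n z) \<le> lam * (\<theta> * S n x)"
        using lam by (rule mult_left_mono)
      moreover have "c * real n \<le> (s - \<theta> * lam) * S n x"
        using s S_lower[of m n x, OF m(2)] mult_left_mono[of "real n * m" "S n x" "s - \<theta> * lam"]
        by (simp add: c_def mult_ac)
      ultimately have "- s * S n x \<le> - c * real n - lam * (SUP z\<in>oball n x (e / 3). S n z)"
        by (simp add: algebra_simps)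
      then have "exp (- s * S n x) \<le> exp (- c * real n - lam * (SUP z\<in>oball n x (e / 3). S n z))"
        by simp
      also have "\<dots> = exp (- c) ^ n * exp (- lam * (SUP z\<in>oball n x (e / 3). S n z))"
        by (simp add: exp_of_nat_mult[symmetric] exp_add[symmetric] mult.commute)
      finally show "measure \<mu> (oball n x e)
          \<le> exp (- c) ^ n * exp (- lam * (SUP z\<in>oball n x (e / 3). S n z))"
        using \<open>x \<in> F\<close> F(2) by (auto simp: E_def)
    qed
    also have "\<dots> = exp (- c) ^ n * (\<Sum>x\<in>F. exp (- lam * (SUP z\<in>oball n x (e / 3). S n z)))"
      by (simp add: sum_distrib_left)
    also have "\<dots> \<le> exp (- c) ^ n * 1"
    proof (rule mult_left_mono)
      have "ennreal (\<Sum>x\<in>F. exp (- lam * (SUP z\<in>oball n x (e / 3). S n z))) \<le> ennreal 1"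
        using F(3) unfolding ball_weight_def by (subst (asm) sum_ennreal) auto
      then show "(\<Sum>x\<in>F. exp (- lam * (SUP z\<in>oball n x (e / 3). S n z))) \<le> 1"
        by (simp only: ennreal_le_iff zero_le_one)
    qed simp
    finally have "measure \<mu> (\<Union>x\<in>F. oball n x e) \<le> exp (- c) ^ n" by simp
    moreover have "E n \<subseteq> (\<Union>x\<in>F. oball n x e)"
    proof
      fix y assume "y \<in> E n"
      then obtain x where "x \<in> F" "clball n x (e / 3) \<inter> clball n y (e / 3) \<noteq> {}" using F(4) by blast
      then show "y \<in> (\<Union>x\<in>F. oball n x e)" using clball_meet[OF n0, of x "e/3" y e] e by auto
    qed
    moreover have "(\<Union>x\<in>F. oball n x e) \<in> sets \<mu>" using F(1) sets by auto
    ultimately show ?thesis by blast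
  qed
  then obtain U where U: "\<And>n. Suc N0 \<le> n \<Longrightarrow> U n \<in> sets \<mu>" "\<And>n. Suc N0 \<le> n \<Longrightarrow> E n \<subseteq> U n"
    "\<And>n. Suc N0 \<le> n \<Longrightarrow> measure \<mu> (U n) \<le> exp (- c) ^ n" by metis
  \<comment> \<open>Borel--Cantelli asks for a set at every time; the finitely many early times
    receive the empty set.\<close>
  define V where "V n = (if Suc N0 \<le> n then U n else {})" for n
  have V: "V n \<in> sets \<mu>" "measure \<mu> (V n) \<le> exp (- c) ^ n" for n
    using U by (auto simp: V_def)
  have summ: "summable (\<lambda>n. exp (- c) ^ n)" using c by (intro summable_geometric) simp
  have "summable (\<lambda>n. measure \<mu> (V n))"
    using V(2) by (intro summable_comparison_test'[OF summ, of 0]) simp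
  then have "AE x in \<mu>. \<forall>\<^sub>F n in sequentially. x \<in> space \<mu> - V n"
    using V(1) by (intro borel_cantelli_AE1) (auto simp: emeasure_eq_measure)
  then show ?thesis
  proof eventually_elim
    case (elim x)
    show ?case
    proof
      assume x: "x \<in> Z"
      show "\<forall>\<^sub>F n in sequentially. exp (- s * S n x) \<le> measure \<mu> (oball n x e)"
        using elim eventually_ge_at_top[of "Suc N0"]
      proof eventually_elim
        case (elim n)
        then have "x \<notin> E n" using U(2)[of n] by (auto simp: V_def)
        then show ?case using x by (simp add: E_def)
      qed
    qed
  qed
qed

text \<open>A decomposition with total below 1 has every piece below 1, and the almost everywhere
  statements for the countably many pieces combine to one on \<open>K\<close>.\<close>

lemma upper_entropy_le_of_BSP_outer_zero:
  assumes \<mu>: "\<mu> \<in> borel_probs" "measure \<mu> K = 1" and K: "compact K"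
    and comp: "comparable \<theta> e" and e: "0 < e" and lam: "0 \<le> lam" and s: "\<theta> * lam < s"
    and zero: "BSP_outer d f \<phi> K lam (e / 3) = 0"
  shows "upper_entropy d f \<phi> \<mu> e \<le> ennreal s"
proof -
  interpret prob_space \<mu> using \<mu>(1) borel_probsD by blast
  have "BSP_outer d f \<phi> K lam (e / 3) < 1" using zero by simp
  then obtain Zs :: "nat \<Rightarrow> 'a set" where Zs: "K \<subseteq> (\<Union>i. Zs i)" "(\<Sum>i. BSP_lim d f \<phi> (Zs i) lam (e / 3)) < 1"
    unfolding BSP_outer_def Inf_less_iff by auto
  have "BSP_lim d f \<phi> (Zs i) lam (e / 3) < 1" for i
  proof -
    have "(\<Sum>i\<in>{i}. BSP_lim d f \<phi> (Zs i) lam (e / 3)) \<le> (\<Sum>i. BSP_lim d f \<phi> (Zs i) lam (e / 3))"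
      by (rule sum_le_suminf) auto
    then show ?thesis using Zs(2) by simp
  qed
  then have "AE x in \<mu>. \<forall>i. x \<in> Zs i \<longrightarrow>
      (\<forall>\<^sub>F n in sequentially. exp (- s * S n x) \<le> measure \<mu> (oball n x e))"
    unfolding AE_all_countable using AE_eventually_of_BSP_lim_less_1[OF \<mu>(1) comp e lam s] by blast
  moreover have "AE x in \<mu>. x \<in> K"
    using AE_in_if_measure_1[OF \<mu>(1) _ \<mu>(2)] closed_compact[OF K] by simp
  ultimately have "AE x in \<mu>. limsup (\<lambda>n. - elog (measure \<mu> (oball n x e)) / ereal (S n x)) \<le> ereal s"
  proof eventually_elim
    case (elim x)
    then have "\<forall>\<^sub>F n in sequentially. exp (- s * S n x) \<le> measure \<mu> (oball n x e)" using Zs(1) by blast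
    then have "\<forall>\<^sub>F n in sequentially. - elog (measure \<mu> (oball n x e)) / ereal (S n x) \<le> ereal s"
      using eventually_gt_at_top[of 0]
      by eventually_elim (intro neg_elog_divide_le S_pos)
    then show ?case by (rule Limsup_bounded)
  qed
  then show ?thesis
    unfolding upper_entropy_def by (intro nn_integral_e2ennreal_le prob_space_axioms)
qed

section \<open>Nonnegativity of the critical exponents\<close>

lemma BS_outer_zero_imp_nonneg:
  assumes "compact K" "K \<noteq> {}" "0 < e" "BS_outer d f \<phi> lam K e = 0"
  shows "0 \<le> lam"
proof (rule ccontr)
  assume lam: "\<not> 0 \<le> lam"
  have "BS_pre d f \<phi> lam K 1 e \<le> BS_outer d f \<phi> lam K e"
    unfolding BS_outer_eq_SUP by (rule SUP_upper) simp
  then have less: "BS_pre d f \<phi> lam K 1 e < 1" using assms(4) by simp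
  obtain I :: "nat set" and n x where I: "finite I" "\<And>i. i \<in> I \<Longrightarrow> 1 \<le> n i"
    "K \<subseteq> (\<Union>i\<in>I. oball (n i) (x i) e)" "(\<Sum>i\<in>I. weight lam e (n i) (x i)) < 1"
    by (rule BS_pre_less[OF assms(1) zero_less_one less]) blast
  obtain i where i: "i \<in> I" using I(3) assms(2) by auto
  have "1 \<le> weight lam e (n i) (x i)" using lam I(2)[OF i] assms(3) by (intro weight_ge_1) auto
  also have "\<dots> \<le> (\<Sum>i\<in>I. weight lam e (n i) (x i))" using I(1) i by (intro member_le_sum) auto
  finally show False using I(4) by simp
qed

lemma BSP_outer_zero_imp_nonneg:
  assumes "K \<noteq> {}" "0 < e" "BSP_outer d f \<phi> K lam e = 0"
  shows "0 \<le> lam"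
proof (rule ccontr)
  assume lam: "\<not> 0 \<le> lam"
  have "BSP_outer d f \<phi> K lam e < 1" using assms(3) by simp
  then obtain Zs :: "nat \<Rightarrow> 'a set" where Zs: "K \<subseteq> (\<Union>i. Zs i)" "(\<Sum>i. BSP_lim d f \<phi> (Zs i) lam e) < 1"
    unfolding BSP_outer_def Inf_less_iff by auto
  obtain x i where x: "x \<in> Zs i" using assms(1) Zs(1) by blast
  have "1 \<le> BSP_pre d f \<phi> (Zs i) lam N e" for N
  proof -
    have "1 \<le> weight lam e (Suc N) x" using lam assms(2) by (intro weight_ge_1) auto
    also have "\<dots> \<le> BSP_pre d f \<phi> (Zs i) lam N e"
      using le_BSP_pre[of "{(Suc N, x)}" N "Zs i" e lam] x by (simp add: disjoint_family_on_def)
    finally show ?thesis .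
  qed
  then have "1 \<le> BSP_lim d f \<phi> (Zs i) lam e" unfolding BSP_lim_eq_INF by (intro INF_greatest)
  also have "\<dots> = (\<Sum>i\<in>{i}. BSP_lim d f \<phi> (Zs i) lam e)" by simp
  also have "\<dots> \<le> (\<Sum>i. BSP_lim d f \<phi> (Zs i) lam e)" by (rule sum_le_suminf) auto
  finally show False using Zs(2) by simp
qed

end

section \<open>A Frostman measure from weighted covers\<close>

context bs_system
begin

text \<open>\<open>G y\<close> is the set of balls containing \<open>y\<close>. A maximal set
  \<open>F\<close> of heavily covered points with disjoint sets \<open>G a\<close> serves both
  conclusions: every other heavily covered point shares a ball with some \<open>a\<close> in
  \<open>F\<close>, hence lies within \<open>2 * r\<close> of it, and each \<open>a\<close> owns
  coefficients of total at least \<open>t\<close>, so the costs add up without overlap.\<close>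

lemma level_cover:
  fixes J :: "'i set" and c :: "'i \<Rightarrow> real" and x :: "'i \<Rightarrow> 'a"
  assumes J: "finite J" "\<And>i. i \<in> J \<Longrightarrow> 0 \<le> c i" and k: "0 < k" and t: "0 < t"
    and H: "\<And>i y. i \<in> J \<Longrightarrow> y \<in> oball k (x i) r \<Longrightarrow> s * S k (x i) + \<eta> \<le> lam * S k y"
  obtains F where "finite F"
    "\<And>y. y \<in> K \<Longrightarrow> t \<le> (\<Sum>i\<in>J. c i * indicator (oball k (x i) r) y) \<Longrightarrow> \<exists>a\<in>F. y \<in> oball k a (2 * r)"
    "t * (\<Sum>a\<in>F. exp (- lam * S k a)) \<le> exp (- \<eta>) * (\<Sum>i\<in>J. c i * exp (- s * S k (x i)))"
proof -
  define G where "G y = {i\<in>J. y \<in> oball k (x i) r}" for y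
  define A where "A = {y\<in>K. t \<le> (\<Sum>i\<in>J. c i * indicator (oball k (x i) r) y)}"
  have G_sum: "(\<Sum>i\<in>J. c i * indicator (oball k (x i) r) y) = (\<Sum>i\<in>G y. c i)" for y
    unfolding G_def using J(1) by (intro sum.mono_neutral_cong_right) (auto simp: indicator_def)
  have finG: "finite (G y)" "G y \<subseteq> J" for y using J(1) by (auto simp: G_def)
  have Gne: "G y \<noteq> {}" if "y \<in> A" for y
  proof
    assume "G y = {}"
    then show False using that t by (simp add: A_def G_sum)
  qed
  \<comment> \<open>Disjointness is required of the index sets, not of the balls; it bounds the
    cardinality of \<open>F\<close> by that of \<open>J\<close>.\<close>
  define P where "P F \<longleftrightarrow> finite F \<and> F \<subseteq> A \<and> disjoint_family_on G F" for F
  have card_le: "card F < Suc (card J)" if "P F" for F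
  proof -
    have F: "finite F" "F \<subseteq> A" "disjoint_family_on G F" using that by (auto simp: P_def)
    have "(\<Sum>a\<in>F. 1) \<le> (\<Sum>a\<in>F. card (G a))"
      using F(2) Gne finG by (intro sum_mono) (auto simp: Suc_le_eq card_gt_0_iff)
    also have "\<dots> = card (\<Union>a\<in>F. G a)"
      using F finG by (subst card_UN_disjoint) (auto simp: disjoint_family_on_def)
    also have "\<dots> \<le> card J" using J(1) finG by (intro card_mono) auto
    finally show ?thesis by simp
  qed
  have "P {}" by (simp add: P_def disjoint_family_on_def)
  then obtain F where F: "P F" "\<And>F'. P F' \<Longrightarrow> card F' \<le> card F"
    using ex_has_greatest_nat[of P "{}" card "Suc (card J)"] card_le by blast
  have F': "finite F" "F \<subseteq> A" "disjoint_family_on G F" using F(1) by (auto simp: P_def)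
  show ?thesis
  proof
    show "finite F" by fact
    fix y assume y: "y \<in> K" "t \<le> (\<Sum>i\<in>J. c i * indicator (oball k (x i) r) y)"
    then have yA: "y \<in> A" by (simp add: A_def)
    have "\<exists>a\<in>F. G a \<inter> G y \<noteq> {}"
    proof (rule ccontr)
      assume *: "\<not> (\<exists>a\<in>F. G a \<inter> G y \<noteq> {})"
      then have "y \<notin> F" using Gne[OF yA] by blast
      moreover have "P (insert y F)"
        using F' yA * by (auto simp: P_def disjoint_family_on_def Int_commute)
      ultimately show False using F(2)[of "insert y F"] F'(1) by simp
    qed
    then obtain a i where "a \<in> F" "i \<in> G a" "i \<in> G y" by blast
    then have a: "a \<in> F" "a \<in> oball k (x i) r" "y \<in> oball k (x i) r" by (auto simp: G_def)
    have "oball k (x i) r \<subseteq> oball k a (2 * r)"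
      by (rule oball_subset[OF k oball_sym[OF k a(2)]]) simp
    then show "\<exists>a\<in>F. y \<in> oball k a (2 * r)" using a by blast
  next
    have one: "t * exp (- lam * S k a) \<le> exp (- \<eta>) * (\<Sum>i\<in>G a. c i * exp (- s * S k (x i)))"
      if a: "a \<in> F" for a
    proof -
      have "t \<le> (\<Sum>i\<in>G a. c i)" using a F'(2) by (auto simp: A_def G_sum)
      then have "t * exp (- lam * S k a) \<le> (\<Sum>i\<in>G a. c i * exp (- lam * S k a))"
        by (simp add: sum_distrib_right[symmetric])
      also have "\<dots> \<le> (\<Sum>i\<in>G a. exp (- \<eta>) * (c i * exp (- s * S k (x i))))"
      proof (rule sum_mono)
        fix i assume "i \<in> G a"
        then have i: "i \<in> J" "a \<in> oball k (x i) r" by (auto simp: G_def)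
        have "exp (- lam * S k a) \<le> exp (- \<eta> - s * S k (x i))" using H[OF i] by simp
        also have "\<dots> = exp (- \<eta>) * exp (- s * S k (x i))" by (simp add: exp_add[symmetric])
        finally show "c i * exp (- lam * S k a) \<le> exp (- \<eta>) * (c i * exp (- s * S k (x i)))"
          using mult_left_mono[OF _ J(2)[OF i(1)]] by (simp add: mult.left_commute)
      qed
      finally show ?thesis by (simp add: sum_distrib_left)
    qed
    have "t * (\<Sum>a\<in>F. exp (- lam * S k a)) = (\<Sum>a\<in>F. t * exp (- lam * S k a))"
      by (rule sum_distrib_left)
    also have "\<dots> \<le> (\<Sum>a\<in>F. exp (- \<eta>) * (\<Sum>i\<in>G a. c i * exp (- s * S k (x i))))"
      by (rule sum_mono[OF one])
    also have "\<dots> = exp (- \<eta>) * (\<Sum>a\<in>F. \<Sum>i\<in>G a. c i * exp (- s * S k (x i)))"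
      by (rule sum_distrib_left[symmetric])
    also have "(\<Sum>a\<in>F. \<Sum>i\<in>G a. c i * exp (- s * S k (x i))) = (\<Sum>i\<in>(\<Union>a\<in>F. G a). c i * exp (- s * S k (x i)))"
      using F' finG by (intro sum.UNION_disjoint[symmetric]) (auto simp: disjoint_family_on_def)
    also have "\<dots> \<le> (\<Sum>i\<in>J. c i * exp (- s * S k (x i)))"
      using finG J by (intro sum_mono2) auto
    finally show "t * (\<Sum>a\<in>F. exp (- lam * S k a)) \<le> exp (- \<eta>) * (\<Sum>i\<in>J. c i * exp (- s * S k (x i)))"
      by simp
  qed
qed

text \<open>A point of total multiplicity at least 1 reaches the threshold \<open>t k\<close> on
  some level, because the thresholds sum to 1. Rounding on level \<open>k\<close> costs the factor
  \<open>1 / t k\<close>, and its growing part is cancelled exactly by the gain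
  \<open>exp (- (\<eta> * real k))\<close> of \<open>H\<close>; the constant
  \<open>1 / (1 - exp (- \<eta>))\<close> remains.\<close>

lemma BS_pre_le_weighted_cover:
  fixes I :: "'i set" and c :: "'i \<Rightarrow> real" and x :: "'i \<Rightarrow> 'a" and n :: "'i \<Rightarrow> nat"
  assumes r: "0 < r" and I: "finite I" "\<And>i. i \<in> I \<Longrightarrow> 0 \<le> c i" "\<And>i. i \<in> I \<Longrightarrow> N \<le> n i"
    and N: "0 < N" and lam: "0 < lam" and \<eta>: "0 < \<eta>"
    and H: "\<And>n x y. 0 < n \<Longrightarrow> y \<in> oball n x r \<Longrightarrow> s * S n x + \<eta> * real n \<le> lam * S n y"
    and cover: "\<And>y. y \<in> K \<Longrightarrow> 1 \<le> (\<Sum>i\<in>I. c i * indicator (oball (n i) (x i) r) y)"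
  shows "BS_pre d f \<phi> lam K N (2 * r)
    \<le> ennreal (1 / (1 - exp (- \<eta>)) * (\<Sum>i\<in>I. c i * exp (- s * S (n i) (x i))))"
proof -
  define q where "q = exp (- \<eta>)"
  have q: "0 < q" "q < 1" using \<eta> by (auto simp: q_def)
  define L where "L = n ` I"
  have L: "finite L" "\<And>k. k \<in> L \<Longrightarrow> N \<le> k" using I by (auto simp: L_def)
  define J where "J k = {i\<in>I. n i = k}" for k
  have sumJ: "(\<Sum>k\<in>L. \<Sum>i\<in>J k. g i) = (\<Sum>i\<in>I. g i)" for g :: "'i \<Rightarrow> real"
    unfolding L_def J_def by (rule sum.image_gen[OF I(1), symmetric])
  define t where "t k = (1 - q) * q ^ k" for k
  have t: "t k > 0" for k using q by (simp add: t_def)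
  have "\<exists>F. finite F \<and>
      (\<forall>y\<in>K. t k \<le> (\<Sum>i\<in>J k. c i * indicator (oball k (x i) r) y) \<longrightarrow> (\<exists>a\<in>F. y \<in> oball k a (2 * r))) \<and>
      t k * (\<Sum>a\<in>F. exp (- lam * S k a)) \<le> exp (- (\<eta> * real k)) * (\<Sum>i\<in>J k. c i * exp (- s * S k (x i)))"
    if "k \<in> L" for k
  proof -
    have "0 < k" using L(2)[OF that] N by simp
    show ?thesis
      by (rule level_cover[of "J k" c k "t k" x r s "\<eta> * real k" lam K])
        (use I(1,2) t \<open>0 < k\<close> H[OF \<open>0 < k\<close>] in \<open>auto simp: J_def\<close>)
  qed
  then have "\<forall>k\<in>L. \<exists>F. finite F \<and>
      (\<forall>y\<in>K. t k \<le> (\<Sum>i\<in>J k. c i * indicator (oball k (x i) r) y) \<longrightarrow> (\<exists>a\<in>F. y \<in> oball k a (2 * r))) \<and>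
      t k * (\<Sum>a\<in>F. exp (- lam * S k a)) \<le> exp (- (\<eta> * real k)) * (\<Sum>i\<in>J k. c i * exp (- s * S k (x i)))"
    by (rule ballI)
  from bchoice[OF this] obtain F where F: "\<And>k. k \<in> L \<Longrightarrow> finite (F k)"
    "\<And>k y. k \<in> L \<Longrightarrow> y \<in> K \<Longrightarrow> t k \<le> (\<Sum>i\<in>J k. c i * indicator (oball k (x i) r) y)
       \<Longrightarrow> \<exists>a\<in>F k. y \<in> oball k a (2 * r)"
    "\<And>k. k \<in> L \<Longrightarrow> t k * (\<Sum>a\<in>F k. exp (- lam * S k a))
       \<le> exp (- (\<eta> * real k)) * (\<Sum>i\<in>J k. c i * exp (- s * S k (x i)))"
    by blast
  \<comment> \<open>If all levels stayed strictly below their thresholds, the total multiplicity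
    would be less than 1.\<close>
  have K: "K \<subseteq> (\<Union>(k, a)\<in>Sigma L F. oball k a (2 * r))"
  proof
    fix y assume y: "y \<in> K"
    have "\<exists>k\<in>L. t k \<le> (\<Sum>i\<in>J k. c i * indicator (oball k (x i) r) y)"
    proof (rule ccontr)
      assume "\<not> ?thesis"
      then have *: "(\<Sum>i\<in>J k. c i * indicator (oball k (x i) r) y) < t k" if "k \<in> L" for k
        using that by auto
      have "1 \<le> (\<Sum>i\<in>I. c i * indicator (oball (n i) (x i) r) y)" by (rule cover[OF y])
      also have "\<dots> = (\<Sum>k\<in>L. \<Sum>i\<in>J k. c i * indicator (oball (n i) (x i) r) y)"
        by (rule sumJ[symmetric])
      also have "\<dots> = (\<Sum>k\<in>L. \<Sum>i\<in>J k. c i * indicator (oball k (x i) r) y)"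
        by (intro sum.cong) (auto simp: J_def)
      finally have ge: "1 \<le> (\<Sum>k\<in>L. \<Sum>i\<in>J k. c i * indicator (oball k (x i) r) y)" .
      then have "L \<noteq> {}" by auto
      have geo: "summable (\<lambda>k. (1 - q) * q ^ k)" using q by (intro summable_mult summable_geometric) simp
      have "(\<Sum>k\<in>L. \<Sum>i\<in>J k. c i * indicator (oball k (x i) r) y) < (\<Sum>k\<in>L. t k)"
        using * L(1) \<open>L \<noteq> {}\<close> by (intro sum_strict_mono) auto
      also have "\<dots> \<le> (\<Sum>k. t k)"
        unfolding t_def using q L(1) by (intro sum_le_suminf geo) auto
      also have "\<dots> = (1 - q) * (\<Sum>k. q ^ k)"
        unfolding t_def using q by (intro suminf_mult summable_geometric) simp
      also have "\<dots> = 1" using q by (subst suminf_geometric) auto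
      finally show False using ge by simp
    qed
    then obtain k a where "k \<in> L" "a \<in> F k" "y \<in> oball k a (2 * r)" using F(2) y by blast
    then show "y \<in> (\<Union>(k, a)\<in>Sigma L F. oball k a (2 * r))" by auto
  qed
  have level: "(\<Sum>a\<in>F k. exp (- lam * S k a)) \<le> 1 / (1 - q) * (\<Sum>i\<in>J k. c i * exp (- s * S (n i) (x i)))"
    if k: "k \<in> L" for k
  proof -
    have "exp (- (\<eta> * real k)) = q ^ k" by (simp add: q_def exp_of_nat_mult[symmetric] mult.commute)
    moreover have "(\<Sum>i\<in>J k. c i * exp (- s * S k (x i))) = (\<Sum>i\<in>J k. c i * exp (- s * S (n i) (x i)))"
      by (intro sum.cong) (auto simp: J_def)
    ultimately have "q ^ k * ((1 - q) * (\<Sum>a\<in>F k. exp (- lam * S k a)))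
        \<le> q ^ k * (\<Sum>i\<in>J k. c i * exp (- s * S (n i) (x i)))"
      using F(3)[OF k] by (simp add: t_def mult_ac)
    then have "(1 - q) * (\<Sum>a\<in>F k. exp (- lam * S k a)) \<le> (\<Sum>i\<in>J k. c i * exp (- s * S (n i) (x i)))"
      using q by (subst (asm) mult_le_cancel_left_pos) auto
    then show ?thesis using q by (simp add: field_simps)
  qed
  have "BS_pre d f \<phi> lam K N (2 * r) \<le> (\<Sum>(k, a)\<in>Sigma L F. weight lam (2 * r) k a)"
    using L F(1) K by (intro BS_pre_le) auto
  also have "\<dots> \<le> (\<Sum>(k, a)\<in>Sigma L F. ennreal (exp (- lam * S k a)))"
  proof (rule sum_mono, clarify)
    fix k a assume "k \<in> L"
    then have "0 < k" using L(2) N by fastforce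
    then have "S k a \<le> (SUP z\<in>oball k a (2 * r). S k z)"
      using r by (intro S_le_SUP center_in_oball) auto
    then show "weight lam (2 * r) k a \<le> ennreal (exp (- lam * S k a))"
      unfolding ball_weight_def using lam by (intro ennreal_leI) simp
  qed
  also have "\<dots> = ennreal (\<Sum>(k, a)\<in>Sigma L F. exp (- lam * S k a))"
    by (subst sum_ennreal[symmetric]) (auto simp: split_def)
  also have "(\<Sum>(k, a)\<in>Sigma L F. exp (- lam * S k a)) = (\<Sum>k\<in>L. \<Sum>a\<in>F k. exp (- lam * S k a))"
    using L(1) F(1) by (intro sum.Sigma[symmetric]) auto
  also have "ennreal \<dots> \<le> ennreal (\<Sum>k\<in>L. 1 / (1 - q) * (\<Sum>i\<in>J k. c i * exp (- s * S (n i) (x i))))"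
    by (intro ennreal_leI sum_mono level)
  also have "(\<Sum>k\<in>L. 1 / (1 - q) * (\<Sum>i\<in>J k. c i * exp (- s * S (n i) (x i))))
      = 1 / (1 - q) * (\<Sum>i\<in>I. c i * exp (- s * S (n i) (x i)))"
    by (simp only: sum_distrib_left[symmetric] sumJ)
  finally show ?thesis by (simp add: q_def)
qed

section \<open>Limit measures with mass bounds on Bowen balls\<close>

lemma measure_limit_full:
  assumes \<mu>: "\<mu> \<in> borel_probs"
    and lim: "\<And>U w. open U \<Longrightarrow> \<forall>\<^sub>F j in sequentially. measure_pmf.prob (p j) U \<le> w \<Longrightarrow> measure \<mu> U \<le> w"
    and C: "closed C" "\<forall>\<^sub>F j in sequentially. set_pmf (p j) \<subseteq> C"
  shows "measure \<mu> C = 1"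
proof -
  interpret prob_space \<mu> using \<mu> borel_probsD(1) by blast
  have "\<forall>\<^sub>F j in sequentially. measure_pmf.prob (p j) (- C) \<le> 0"
    using C(2)
  proof eventually_elim
    case (elim j)
    then have "measure_pmf.prob (p j) (- C) = 0" by (auto simp: measure_pmf_zero_iff)
    then show ?case by simp
  qed
  then have "measure \<mu> (- C) \<le> 0" using C(1) by (intro lim) auto
  moreover have "measure \<mu> (- C) = 1 - measure \<mu> C"
    using prob_compl[of C] C(1) borel_probsD(2,3)[OF \<mu>] by (simp add: Compl_eq_Diff_UNIV)
  ultimately show ?thesis using prob_le_1[of C] by simp
qed

text \<open>Duality treats finitely many balls only. So each time \<open>k\<close> gets a finite net
  \<open>E k\<close> of radius \<open>r / 2\<close>, the distribution \<open>p j\<close> obeys the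
  bounds for the times from \<open>N\<close> to \<open>N + j\<close>, and the weak limit obeys them
  all. Any Bowen ball of radius \<open>r / 2\<close> about a point of \<open>K\<close> lies in one
  of the controlled balls of radius \<open>r\<close>.\<close>

lemma frostman_measure:
  assumes K: "compact K" "K \<noteq> {}" and r: "0 < r" and N: "0 < N" and \<kappa>: "0 < \<kappa>"
    and LP: "\<And>(I :: (nat \<times> 'a) set) c. \<lbrakk>finite I; \<And>i. i \<in> I \<Longrightarrow> 0 \<le> c i; \<And>i. i \<in> I \<Longrightarrow> N \<le> fst i;
       \<And>y. y \<in> K \<Longrightarrow> 1 \<le> (\<Sum>i\<in>I. c i * indicator (oball (fst i) (snd i) r) y)\<rbrakk>
       \<Longrightarrow> \<kappa> \<le> (\<Sum>i\<in>I. c i * exp (- s * S (fst i) (snd i)))"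
  obtains \<mu> E where "\<mu> \<in> borel_probs" "measure \<mu> K = 1"
    "\<And>k. 0 < k \<Longrightarrow> K \<subseteq> (\<Union>x\<in>E k. oball k x (r / 2))"
    "\<And>k x. N \<le> k \<Longrightarrow> x \<in> E k \<Longrightarrow> measure \<mu> (oball k x r) \<le> exp (- s * S k x) / \<kappa>"
proof -
  have "\<exists>E. finite E \<and> K \<subseteq> (\<Union>x\<in>E. oball k x (r / 2))" if "0 < k" for k
    by (rule compact_ball_cover[OF _ _ K(1), of "\<lambda>x. oball k x (r / 2)"])
      (use that r in \<open>auto intro: open_oball center_in_oball\<close>)
  then obtain E where E: "\<And>k. 0 < k \<Longrightarrow> finite (E k)" "\<And>k. 0 < k \<Longrightarrow> K \<subseteq> (\<Union>x\<in>E k. oball k x (r / 2))"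
    by metis
  have "\<exists>p. set_pmf p \<subseteq> K \<and> (\<forall>i\<in>Sigma {N..N + j} E.
      measure_pmf.prob p (oball (fst i) (snd i) r) \<le> exp (- s * S (fst i) (snd i)) / \<kappa>)" for j
  proof -
    have fin: "finite (Sigma {N..N + j} E)" using E(1) N by (intro finite_SigmaI) auto
    have pos: "0 < exp (- s * S (fst i) (snd i)) / \<kappa>" if "i \<in> Sigma {N..N + j} E" for i
      using \<kappa> by simp
    show ?thesis
    proof (rule fractional_cover_duality[OF fin K(2) pos, where B = "\<lambda>i. oball (fst i) (snd i) r"])
      fix c :: "nat \<times> 'a \<Rightarrow> real"
      assume c: "\<And>i. i \<in> Sigma {N..N + j} E \<Longrightarrow> 0 \<le> c i"
        "\<And>y. y \<in> K \<Longrightarrow> 1 \<le> (\<Sum>i\<in>Sigma {N..N + j} E. c i * indicator (oball (fst i) (snd i) r) y)"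
      have "\<kappa> \<le> (\<Sum>i\<in>Sigma {N..N + j} E. c i * exp (- s * S (fst i) (snd i)))"
        using c fin by (intro LP) auto
      then show "1 \<le> (\<Sum>i\<in>Sigma {N..N + j} E. c i * (exp (- s * S (fst i) (snd i)) / \<kappa>))"
        using \<kappa> by (simp add: sum_divide_distrib[symmetric])
    qed blast+
  qed
  then obtain p where p: "\<And>j. set_pmf (p j) \<subseteq> K"
    "\<And>j k x. k \<in> {N..N + j} \<Longrightarrow> x \<in> E k \<Longrightarrow> measure_pmf.prob (p j) (oball k x r) \<le> exp (- s * S k x) / \<kappa>"
    by (metis SigmaI fst_conv snd_conv)
  obtain \<mu> where \<mu>: "\<mu> \<in> borel_probs"
    "\<And>U w. open U \<Longrightarrow> \<forall>\<^sub>F j in sequentially. measure_pmf.prob (p j) U \<le> w \<Longrightarrow> measure \<mu> U \<le> w"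
    by (rule pmf_weak_limit[of p]) blast
  show ?thesis
  proof
    show "\<mu> \<in> borel_probs" by fact
    show "measure \<mu> K = 1"
      by (rule measure_limit_full[OF \<mu> closed_compact[OF K(1)]]) (use p(1) in auto)
    show "K \<subseteq> (\<Union>x\<in>E k. oball k x (r / 2))" if "0 < k" for k by (rule E(2)[OF that])
    show "measure \<mu> (oball k x r) \<le> exp (- s * S k x) / \<kappa>" if "N \<le> k" "x \<in> E k" for k x
    proof (rule \<mu>(2))
      show "open (oball k x r)" using that N by (intro open_oball) simp
      show "\<forall>\<^sub>F j in sequentially. measure_pmf.prob (p j) (oball k x r) \<le> exp (- s * S k x) / \<kappa>"
        using eventually_ge_at_top[of k] by eventually_elim (use that in \<open>intro p(2), auto\<close>)
    qed
  qed
qed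

text \<open>The radius is doubled twice: from \<open>e\<close> to \<open>2 * e\<close> when a ball
  is replaced by one centred in the net, and from \<open>2 * e\<close> to \<open>4 * e\<close> when
  a weighted cover is rounded to a cover. The four factors \<open>\<theta>\<close> are spent in two
  comparisons of Birkhoff sums and on two exponential gaps.\<close>

lemma lower_entropy_ge_of_BS_outer_nonzero:
  assumes K: "compact K" "K \<noteq> {}" and e: "0 < e" and \<theta>: "1 < \<theta>" and comp: "comparable \<theta> (2 * e)"
    and lam: "0 < lam" and nonzero: "BS_outer d f \<phi> lam K (4 * e) \<noteq> 0"
  obtains \<mu> where "\<mu> \<in> borel_probs" "measure \<mu> K = 1"
    "ennreal (lam / \<theta> ^ 4) \<le> lower_entropy d f \<phi> \<mu> e"
proof -
  obtain m M where m: "0 < m" "\<And>x. m \<le> \<phi> x" using \<phi>_bounds by metis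
  \<comment> \<open>One factor \<open>\<theta>\<close> compares the sums at two points of a ball;
    the other leaves the gap behind \<open>\<eta>\<close>.\<close>
  define s where "s = lam / \<theta> ^ 2"
  define \<eta> where "\<eta> = (lam / \<theta> - s) * m"
  have s: "0 < s" "s < lam / \<theta>" using lam \<theta> by (auto simp: s_def power2_eq_square field_simps)
  have \<eta>: "0 < \<eta>" using s m by (simp add: \<eta>_def)
  have H: "s * S n x + \<eta> * real n \<le> lam * S n y" if n: "0 < n" and y: "y \<in> oball n x (2 * e)" for n x y
  proof -
    have "S n x \<le> \<theta> * S n y" by (rule comparable_S[OF comp n oball_sym[OF n y]])
    then have "lam / \<theta> * S n x \<le> lam / \<theta> * (\<theta> * S n y)" using lam \<theta> by (intro mult_left_mono) auto
    then have "lam / \<theta> * S n x \<le> lam * S n y" using \<theta> by simp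
    moreover have "\<eta> * real n \<le> (lam / \<theta> - s) * S n x"
      using s S_lower[of m n x, OF m(2)] mult_left_mono[of "real n * m" "S n x" "lam / \<theta> - s"]
      by (simp add: \<eta>_def mult_ac)
    ultimately show ?thesis by (simp add: algebra_simps)
  qed
  have "\<exists>N. BS_pre d f \<phi> lam K N (4 * e) \<noteq> 0"
    using nonzero unfolding BS_outer_eq_SUP by (metis SUP_bot_conv(2) bot_ennreal)
  then obtain N0 where N0: "BS_pre d f \<phi> lam K N0 (4 * e) \<noteq> 0" by blast
  define N where "N = Suc N0"
  have "BS_pre d f \<phi> lam K N0 (4 * e) \<le> BS_pre d f \<phi> lam K N (4 * e)"
    by (rule BS_pre_mono) (simp add: N_def)
  then have "0 < BS_pre d f \<phi> lam K N (4 * e)" using N0 by (metis gr_zeroI le_zero_eq)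
  then obtain \<kappa>0 where \<kappa>0: "0 < ennreal \<kappa>0" "ennreal \<kappa>0 < BS_pre d f \<phi> lam K N (4 * e)"
    using dense[of 0 "BS_pre d f \<phi> lam K N (4 * e)"] by (metis ennreal_cases not_top_less top.not_eq_extremum ennreal_less_top)
  have "0 < \<kappa>0" using \<kappa>0(1) by (simp add: ennreal_less_zero_iff)
  define C where "C = 1 / (1 - exp (- \<eta>))"
  have C: "0 < C" using \<eta> by (simp add: C_def)
  define \<kappa> where "\<kappa> = \<kappa>0 / C"
  have \<kappa>: "0 < \<kappa>" using \<open>0 < \<kappa>0\<close> C by (simp add: \<kappa>_def)
  obtain \<mu> E where \<mu>: "\<mu> \<in> borel_probs" "measure \<mu> K = 1"
    and E: "\<And>k. 0 < k \<Longrightarrow> K \<subseteq> (\<Union>x\<in>E k. oball k x (2 * e / 2))"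
    and bound: "\<And>k x. N \<le> k \<Longrightarrow> x \<in> E k \<Longrightarrow> measure \<mu> (oball k x (2 * e)) \<le> exp (- s * S k x) / \<kappa>"
  proof (rule frostman_measure[OF K, of "2 * e" N \<kappa> s])
    fix I :: "(nat \<times> 'a) set" and c :: "nat \<times> 'a \<Rightarrow> real"
    assume I: "finite I" "\<And>i. i \<in> I \<Longrightarrow> 0 \<le> c i" "\<And>i. i \<in> I \<Longrightarrow> N \<le> fst i"
       "\<And>y. y \<in> K \<Longrightarrow> 1 \<le> (\<Sum>i\<in>I. c i * indicator (oball (fst i) (snd i) (2 * e)) y)"
    have "BS_pre d f \<phi> lam K N (2 * (2 * e))
      \<le> ennreal (1 / (1 - exp (- \<eta>)) * (\<Sum>i\<in>I. c i * exp (- s * S (fst i) (snd i))))"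
      using e by (intro BS_pre_le_weighted_cover[OF _ I(1,2,3) _ lam \<eta> H I(4)]) (auto simp: N_def)
    then have "ennreal \<kappa>0 < ennreal (C * (\<Sum>i\<in>I. c i * exp (- s * S (fst i) (snd i))))"
      using \<kappa>0(2) by (simp add: C_def)
    then have "\<kappa>0 \<le> C * (\<Sum>i\<in>I. c i * exp (- s * S (fst i) (snd i)))"
      using \<open>0 < \<kappa>0\<close> by (simp add: ennreal_less_iff)
    then show "\<kappa> \<le> (\<Sum>i\<in>I. c i * exp (- s * S (fst i) (snd i)))"
      using C by (simp add: \<kappa>_def field_simps)
  qed (use e \<kappa> N_def in auto)
  have "ereal (lam / \<theta> ^ 4) \<le> liminf (\<lambda>n. - elog (measure \<mu> (oball n y e)) / ereal (S n y))" if y: "y \<in> K" for y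
  proof (rule Liminf_bounded)
    \<comment> \<open>Recentring from \<open>x\<close> to \<open>y\<close> lowers \<open>s\<close>
      to \<open>s / \<theta>\<close>. The last factor \<open>\<theta>\<close> creates a gap that
      absorbs the constant \<open>\<kappa>\<close> for large \<open>n\<close>.\<close>
    define \<delta> where "\<delta> = (s / \<theta> - lam / \<theta> ^ 4) * m"
    have gap: "lam / \<theta> ^ 4 < s / \<theta>"
      using lam \<theta> power_strict_increasing[of 3 4 \<theta>]
      by (simp add: s_def power2_eq_square power3_eq_cube divide_strict_left_mono)
    then have \<delta>: "0 < \<delta>" using m by (simp add: \<delta>_def)
    have "filterlim (\<lambda>n. \<delta> * real n) at_top sequentially"
      using \<delta> by (intro filterlim_tendsto_pos_mult_at_top[OF tendsto_const _ filterlim_real_sequentially])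
    then have "\<forall>\<^sub>F n in sequentially. - ln \<kappa> \<le> \<delta> * real n" by (simp add: filterlim_at_top)
    then show "\<forall>\<^sub>F n in sequentially. ereal (lam / \<theta> ^ 4) \<le> - elog (measure \<mu> (oball n y e)) / ereal (S n y)"
      using eventually_ge_at_top[of N]
    proof eventually_elim
      case (elim n)
      have n: "0 < n" using elim by (simp add: N_def)
      obtain x where x: "x \<in> E n" "y \<in> oball n x e" using E[OF n] y by auto
      interpret prob_space \<mu> using \<mu>(1) borel_probsD(1) by blast
      have "measure \<mu> (oball n y e) \<le> measure \<mu> (oball n x (2 * e))"
        using oball_subset[OF n x(2), of e "2 * e"] open_in_sets[OF \<mu>(1) open_oball[OF n]]
        by (intro finite_measure_mono) auto
      also have "\<dots> \<le> exp (- s * S n x) / \<kappa>" by (rule bound[OF elim(2) x(1)])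
      also have "\<dots> = exp (- s * S n x - ln \<kappa>)" using \<kappa> by (simp add: exp_diff)
      also have "\<dots> \<le> exp (- (lam / \<theta> ^ 4) * S n y)"
      proof -
        have "S n y \<le> \<theta> * S n x"
          using e by (intro comparable_S[OF comparable_mono[OF comp] n x(2)]) simp
        then have "s / \<theta> * S n y \<le> s * S n x"
          using s \<theta> mult_left_mono[of "S n y" "\<theta> * S n x" "s / \<theta>"] by simp
        moreover have "\<delta> * real n \<le> (s / \<theta> - lam / \<theta> ^ 4) * S n y"
          using gap S_lower[of m n y, OF m(2)] mult_left_mono[of "real n * m" "S n y" "s / \<theta> - lam / \<theta> ^ 4"]
          by (simp add: \<delta>_def mult_ac)
        ultimately show ?thesis using elim(1) by (simp add: algebra_simps)
      qed
      finally show ?case using n by (intro neg_elog_divide_ge S_pos) auto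
    qed
  qed
  then have "AE y in \<mu>. ereal (lam / \<theta> ^ 4) \<le> liminf (\<lambda>n. - elog (measure \<mu> (oball n y e)) / ereal (S n y))"
    using AE_in_if_measure_1[OF \<mu>(1) _ \<mu>(2)] closed_compact[OF K(1)] by auto
  then have "ennreal (lam / \<theta> ^ 4) \<le> lower_entropy d f \<phi> \<mu> e"
    unfolding lower_entropy_def using \<mu>(1) by (intro le_nn_integral_e2ennreal borel_probsD(1))
  then show ?thesis using that \<mu> by blast
qed

end

section \<open>A tree of packings\<close>

context bs_system
begin

section \<open>Negligible sets for packings\<close>

definition rweight :: "real \<Rightarrow> real \<Rightarrow> nat \<Rightarrow> 'a \<Rightarrow> real" where
  "rweight lam e n x = exp (- lam * (SUP y\<in>oball n x e. S n y))"

lemma weight_eq_rweight: "weight lam e n x = ennreal (rweight lam e n x)"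
  by (simp add: ball_weight_def rweight_def)

lemma BSP_lim_empty: "BSP_lim d f \<phi> {} lam e = 0"
proof -
  have "BSP_pre d f \<phi> {} lam N e \<le> 0" for N
    unfolding BSP_pre_def
  proof (rule Sup_least, elim CollectE exE conjE)
    fix u and I :: "nat set" and n x
    assume "u = (\<Sum>\<^sub>\<infinity>i\<in>I. weight lam e (n i) (x i))" "\<forall>i\<in>I. N \<le> n i \<and> x i \<in> {}"
    moreover from this have "I = {}" by blast
    ultimately show "u \<le> 0" by simp
  qed
  then show ?thesis unfolding BSP_lim_eq_INF by simp
qed

text \<open>A sigma-ideal inside the sets of vanishing \<open>BSP_outer\<close>. Asking each piece
  to have limit 0, not merely the total to be small, makes countable unions immediate.\<close>

definition BSP_negligible :: "real \<Rightarrow> real \<Rightarrow> 'a set \<Rightarrow> bool" where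
  "BSP_negligible lam e Z \<longleftrightarrow>
     (\<exists>Zs :: nat \<Rightarrow> 'a set. Z \<subseteq> (\<Union>i. Zs i) \<and> (\<forall>i. BSP_lim d f \<phi> (Zs i) lam e = 0))"

lemma BSP_negligible_subset: "BSP_negligible lam e Z \<Longrightarrow> Z' \<subseteq> Z \<Longrightarrow> BSP_negligible lam e Z'"
  unfolding BSP_negligible_def by (elim exE conjE, intro exI conjI) (erule subset_trans)

lemma BSP_negligible_of_lim: "BSP_lim d f \<phi> Z lam e = 0 \<Longrightarrow> BSP_negligible lam e Z"
  unfolding BSP_negligible_def by (intro exI[of _ "\<lambda>_. Z"]) simp

lemma BSP_negligible_UN:
  assumes "\<And>i::nat. BSP_negligible lam e (A i)"
  shows "BSP_negligible lam e (\<Union>i. A i)"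
proof -
  have "\<forall>i. \<exists>Zs :: nat \<Rightarrow> 'a set. A i \<subseteq> (\<Union>j. Zs j) \<and> (\<forall>j. BSP_lim d f \<phi> (Zs j) lam e = 0)"
    using assms unfolding BSP_negligible_def by blast
  from choice[OF this] obtain Zs :: "nat \<Rightarrow> nat \<Rightarrow> 'a set" where
    Zs: "\<And>i. A i \<subseteq> (\<Union>j. Zs i j)" "\<And>i j. BSP_lim d f \<phi> (Zs i j) lam e = 0" by blast
  show ?thesis
    unfolding BSP_negligible_def
  proof (intro exI conjI allI)
    show "(\<Union>i. A i) \<subseteq> (\<Union>k. Zs (fst (prod_decode k)) (snd (prod_decode k)))"
    proof
      fix x assume "x \<in> (\<Union>i. A i)"
      then obtain i j where "x \<in> Zs i j" using Zs(1) by blast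
      then have "x \<in> Zs (fst (prod_decode (prod_encode (i, j)))) (snd (prod_decode (prod_encode (i, j))))"
        by simp
      then show "x \<in> (\<Union>k. Zs (fst (prod_decode k)) (snd (prod_decode k)))" by (rule UN_I[OF UNIV_I])
    qed
    show "BSP_lim d f \<phi> (Zs (fst (prod_decode k)) (snd (prod_decode k))) lam e = 0" for k
      by (rule Zs(2))
  qed
qed

lemma BSP_negligible_Un:
  assumes "BSP_negligible lam e A" "BSP_negligible lam e B"
  shows "BSP_negligible lam e (A \<union> B)"
proof -
  have "BSP_negligible lam e (\<Union>i::nat. if i = 0 then A else B)"
    using assms by (intro BSP_negligible_UN) simp
  then show ?thesis by (rule BSP_negligible_subset) (auto intro: exI[of _ "1::nat"])
qed

text \<open>All base sets in which \<open>K\<close> is negligible are removed; being countably many,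
  they remove only a negligible part. If the rest were null inside some open \<open>G\<close>, a
  small base set about a remaining point of \<open>G\<close> would have a negligible trace on
  \<open>K\<close> and would have been removed.\<close>

lemma locally_non_negligible_core:
  assumes "BSP_outer d f \<phi> K lam e \<noteq> 0"
  obtains K' where "K' \<subseteq> K" "K' \<noteq> {}"
    "\<And>G. open G \<Longrightarrow> G \<inter> K' \<noteq> {} \<Longrightarrow> BSP_lim d f \<phi> (G \<inter> K') lam e \<noteq> 0"
proof -
  have K: "\<not> BSP_negligible lam e K"
  proof
    assume "BSP_negligible lam e K"
    then obtain Zs :: "nat \<Rightarrow> 'a set" where Zs: "K \<subseteq> (\<Union>i. Zs i)" "\<forall>i. BSP_lim d f \<phi> (Zs i) lam e = 0"
      unfolding BSP_negligible_def by blast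
    have "BSP_outer d f \<phi> K lam e \<le> (\<Sum>i. BSP_lim d f \<phi> (Zs i) lam e)"
      unfolding BSP_outer_def using Zs(1) by (intro Inf_lower) blast
    then show False using assms Zs(2) by simp
  qed
  obtain V :: "nat \<Rightarrow> 'a set" where V: "\<And>i. open (V i)"
    "\<And>e. e > 0 \<Longrightarrow> \<exists>n. \<forall>x. \<exists>i<n. x \<in> V i \<and> (\<forall>y\<in>V i. d x y < e)"
    using countable_base by metis
  define W where "W = {i. BSP_negligible lam e (K \<inter> V i)}"
  have "BSP_negligible lam e (\<Union>i. if i \<in> W then K \<inter> V i else {})"
    using BSP_negligible_of_lim[OF BSP_lim_empty] by (intro BSP_negligible_UN) (auto simp: W_def)
  then have W: "BSP_negligible lam e (K \<inter> (\<Union>i\<in>W. V i))"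
    by (rule BSP_negligible_subset) auto
  show ?thesis
  proof (rule that[of "K - (\<Union>i\<in>W. V i)"])
    show "K - (\<Union>i\<in>W. V i) \<subseteq> K" by blast
    show "K - (\<Union>i\<in>W. V i) \<noteq> {}"
    proof
      assume "K - (\<Union>i\<in>W. V i) = {}"
      then have "K \<subseteq> K \<inter> (\<Union>i\<in>W. V i)" by blast
      then show False using K BSP_negligible_subset[OF W] by blast
    qed
    fix G assume G: "open G" "G \<inter> (K - (\<Union>i\<in>W. V i)) \<noteq> {}"
    show "BSP_lim d f \<phi> (G \<inter> (K - (\<Union>i\<in>W. V i))) lam e \<noteq> 0"
    proof
      assume zero: "BSP_lim d f \<phi> (G \<inter> (K - (\<Union>i\<in>W. V i))) lam e = 0"
      obtain x where x: "x \<in> G" "x \<in> K" "x \<notin> (\<Union>i\<in>W. V i)" using G(2) by blast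
      obtain r where r: "r > 0" "mball x r \<subseteq> G" using G(1) x(1) open_iff by blast
      obtain i where i: "x \<in> V i" "\<forall>y\<in>V i. d x y < r" using V(2)[OF r(1)] by blast
      have "V i \<subseteq> G" using i(2) r(2) by (auto simp: subset_iff)
      then have "K \<inter> V i \<subseteq> G \<inter> (K - (\<Union>i\<in>W. V i)) \<union> K \<inter> (\<Union>i\<in>W. V i)" by blast
      then have "BSP_negligible lam e (K \<inter> V i)"
        by (rule BSP_negligible_subset[OF BSP_negligible_Un[OF BSP_negligible_of_lim[OF zero] W]])
      then show False using x(3) i(1) by (auto simp: W_def)
    qed
  qed
qed

section \<open>Packing distributions and their refinement\<close>

text \<open>A nonzero packing limit at \<open>lam\<close> only yields packings of total weight above
  some possibly small \<open>a\<close>. Passing to the smaller exponent \<open>lam'\<close> at late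
  times multiplies each weight by at least \<open>1 / a\<close>, so the total \<open>T\<close>
  reaches 1; dividing by \<open>T\<close> gives a probability and keeps each atom below its
  weight.\<close>

lemma packing_pmf:
  assumes e: "0 < e" and lam: "lam' < lam" and Z: "BSP_lim d f \<phi> Z lam e \<noteq> 0"
  obtains q m where "finite (set_pmf q)" "set_pmf q \<subseteq> Z"
    "\<And>x. x \<in> set_pmf q \<Longrightarrow> N \<le> m x \<and> 0 < m x \<and> pmf q x \<le> rweight lam' e (m x) x"
    "\<And>x y. x \<in> set_pmf q \<Longrightarrow> y \<in> set_pmf q \<Longrightarrow> x \<noteq> y \<Longrightarrow> clball (m x) x e \<inter> clball (m y) y e = {}"
proof -
  obtain b M where b: "0 < b" "\<And>x. b \<le> \<phi> x" using \<phi>_bounds by metis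
  define c where "c = (lam - lam') * b"
  have c: "0 < c" using lam b by (simp add: c_def)
  obtain a where a: "0 < a" "ennreal a < BSP_lim d f \<phi> Z lam e"
  proof -
    have "0 < BSP_lim d f \<phi> Z lam e" using Z by (simp add: zero_less_iff_neq_zero)
    then obtain t where t: "0 < t" "t < BSP_lim d f \<phi> Z lam e" using dense by blast
    then obtain a where "t = ennreal a" "0 \<le> a" by (cases t) auto
    then show ?thesis using t that[of a] by (auto simp: ennreal_less_zero_iff)
  qed
  have "filterlim (\<lambda>n. c * real n) at_top sequentially"
    using c by (intro filterlim_tendsto_pos_mult_at_top[OF tendsto_const _ filterlim_real_sequentially])
  then have "\<forall>\<^sub>F n in sequentially. - ln a \<le> c * real n" by (simp add: filterlim_at_top)
  then obtain N1 where N1: "\<And>n. N1 \<le> n \<Longrightarrow> - ln a \<le> c * real n"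
    unfolding eventually_sequentially by blast
  define N2 where "N2 = Suc (max N N1)"
  have "BSP_lim d f \<phi> Z lam e \<le> BSP_pre d f \<phi> Z lam N2 e"
    unfolding BSP_lim_eq_INF by (rule INF_lower) simp
  then have less: "ennreal a < BSP_pre d f \<phi> Z lam N2 e" using a(2) by simp
  obtain I :: "nat set" and n x where I: "finite I" "\<And>i. i \<in> I \<Longrightarrow> N2 \<le> n i" "\<And>i. i \<in> I \<Longrightarrow> x i \<in> Z"
    and disj: "disjoint_family_on (\<lambda>i. clball (n i) (x i) e) I"
    and sum: "ennreal a < (\<Sum>i\<in>I. weight lam e (n i) (x i))"
    by (rule less_BSP_pre[OF less]) blast
  have n: "0 < n i" "N \<le> n i" "N1 \<le> n i" if "i \<in> I" for i using I(2)[OF that] by (auto simp: N2_def)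
  \<comment> \<open>Two balls with the same centre meet, so in a disjoint family the time is a
    function of the centre.\<close>
  have inj: "inj_on x I"
  proof (rule inj_onI, rule ccontr)
    fix i j assume ij: "i \<in> I" "j \<in> I" "x i = x j" "i \<noteq> j"
    have "x i \<in> clball (n i) (x i) e \<inter> clball (n j) (x j) e"
      using n(1) ij e by (simp add: in_clball)
    then show False using disjoint_family_onD[OF disj ij(1,2,4)] by simp
  qed
  define m where "m y = n (the_inv_into I x y)" for y
  have m: "m (x i) = n i" if "i \<in> I" for i using the_inv_into_f_f[OF inj that] by (simp add: m_def)
  define T where "T = (\<Sum>y\<in>x ` I. rweight lam' e (m y) y)"
  have w: "rweight lam e (n i) (x i) / a \<le> rweight lam' e (n i) (x i)" if i: "i \<in> I" for i
  proof -
    define u where "u = (SUP y\<in>oball (n i) (x i) e. S (n i) y)"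
    have "real (n i) * b \<le> u"
      using S_lower[of b "n i" "x i", OF b(2)] S_le_SUP[OF center_in_oball[OF n(1)[OF i] e], of "n i" "x i"]
      by (simp add: u_def)
    then have "c * real (n i) \<le> (lam - lam') * u"
      using lam mult_left_mono[of "real (n i) * b" u "lam - lam'"] by (simp add: c_def mult_ac)
    then have "- lam * u - ln a \<le> - lam' * u"
      using N1[OF n(3)[OF i]] by (simp add: algebra_simps)
    then have "exp (- lam * u - ln a) \<le> exp (- lam' * u)" by simp
    moreover have "exp (- lam * u - ln a) = exp (- lam * u) / a" using a(1) by (simp add: exp_diff)
    ultimately have "exp (- lam * u) / a \<le> exp (- lam' * u)" by (simp only:)
    then show ?thesis unfolding rweight_def u_def .
  qed
  have "ennreal a < ennreal (\<Sum>i\<in>I. rweight lam e (n i) (x i))"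
    using sum unfolding weight_eq_rweight by (subst (asm) sum_ennreal) (auto simp: rweight_def)
  then have "a < (\<Sum>i\<in>I. rweight lam e (n i) (x i))" using a(1) by (simp add: ennreal_less_iff)
  then have "1 \<le> (\<Sum>i\<in>I. rweight lam e (n i) (x i)) / a" using a(1) by simp
  also have "\<dots> \<le> (\<Sum>i\<in>I. rweight lam' e (n i) (x i))"
    unfolding sum_divide_distrib by (rule sum_mono[OF w])
  also have "\<dots> = T" unfolding T_def by (simp add: sum.reindex[OF inj] m)
  finally have T: "1 \<le> T" .
  have wpos: "0 < rweight lam' e k y" for k y by (simp add: rweight_def)
  obtain q where q: "set_pmf q \<subseteq> x ` I" "\<And>y. y \<in> x ` I \<Longrightarrow> pmf q y = rweight lam' e (m y) y / T"
  proof (rule finite_pmf_exists[of "x ` I" "\<lambda>y. rweight lam' e (m y) y / T"])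
    show "(\<Sum>y\<in>x ` I. rweight lam' e (m y) y / T) = 1"
      using T by (simp add: sum_divide_distrib[symmetric] T_def)
  qed (use I(1) T wpos in \<open>auto intro: less_imp_le\<close>)
  show ?thesis
  proof (rule that[of q m])
    show "finite (set_pmf q)" using q(1) I(1) by (meson finite_imageI finite_subset)
    show "set_pmf q \<subseteq> Z" using q(1) I(3) by blast
  next
    fix y assume "y \<in> set_pmf q"
    then obtain i where i: "i \<in> I" "y = x i" using q(1) by blast
    have "pmf q y = rweight lam' e (m y) y / T" using q(2) i by blast
    also have "\<dots> \<le> rweight lam' e (m y) y"
      using T wpos[of "m y" y] by (simp add: divide_le_eq mult_le_cancel_left1)
    finally show "N \<le> m y \<and> 0 < m y \<and> pmf q y \<le> rweight lam' e (m y) y"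
      using n[OF i(1)] i m by simp
  next
    fix y z assume yz: "y \<in> set_pmf q" "z \<in> set_pmf q" "y \<noteq> z"
    then obtain i j where ij: "i \<in> I" "y = x i" "j \<in> I" "z = x j" using q(1) by blast
    then have "i \<noteq> j" using yz(3) by blast
    then show "clball (m y) y e \<inter> clball (m z) z e = {}"
      using disjoint_family_onD[OF disj ij(1,3)] ij m by simp
  qed
qed

text \<open>
  A state of the packing construction is a finitely supported distribution whose atoms \<open>x\<close>
  carry a time \<open>m x\<close> and an open neighbourhood \<open>G x\<close> that will contain all later descendants
  of \<open>x\<close>. The separation clause is stated for all centres in \<open>G x\<close> and all later times, so that
  descendants inherit it without losing radius.
\<close>
definition packing_state ::
    "'a set \<Rightarrow> real \<Rightarrow> real \<Rightarrow> nat \<Rightarrow> 'a pmf \<times> ('a \<Rightarrow> nat) \<times> ('a \<Rightarrow> 'a set) \<Rightarrow> bool" where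
  "packing_state K lam e i = (\<lambda>(p, m, G).
     finite (set_pmf p) \<and> set_pmf p \<subseteq> K \<and>
     (\<forall>x\<in>set_pmf p. i < m x \<and> open (G x) \<and> x \<in> G x \<and> G x \<subseteq> oball (m x) x (e / 4) \<and>
        pmf p x \<le> rweight lam e (m x) x) \<and>
     (\<forall>x\<in>set_pmf p. \<forall>x'\<in>set_pmf p. x \<noteq> x' \<longrightarrow>
        (\<forall>y\<in>G x. \<forall>n\<ge>m x. clball n y (3 / 4 * e) \<inter> G x' = {})))"

text \<open>The kernel \<open>q\<close> splits the mass of each atom among descendants whose
  neighbourhoods stay inside its own. Writing this as a bind encodes conservation of mass and
  composes along the levels.\<close>

definition packing_refines :: "'a pmf \<times> ('a \<Rightarrow> 'a set) \<Rightarrow> 'a pmf \<times> ('a \<Rightarrow> 'a set) \<Rightarrow> bool" where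
  "packing_refines = (\<lambda>(p, G) (p', G'). \<exists>q. p' = bind_pmf p q \<and>
     (\<forall>x\<in>set_pmf p. \<forall>y\<in>set_pmf (q x). G' y \<subseteq> G x))"

lemma packing_refines_refl: "packing_refines (p, G) (p, G)"
  unfolding packing_refines_def by (auto intro!: exI[of _ return_pmf] simp: bind_return_pmf')

lemma packing_refines_trans:
  assumes "packing_refines (p, G) (p', G')" "packing_refines (p', G') (p'', G'')"
  shows "packing_refines (p, G) (p'', G'')"
proof -
  obtain q where q: "p' = bind_pmf p q" "\<And>x y. x \<in> set_pmf p \<Longrightarrow> y \<in> set_pmf (q x) \<Longrightarrow> G' y \<subseteq> G x"
    using assms(1) by (auto simp: packing_refines_def)
  obtain q' where q': "p'' = bind_pmf p' q'" "\<And>x y. x \<in> set_pmf p' \<Longrightarrow> y \<in> set_pmf (q' x) \<Longrightarrow> G'' y \<subseteq> G' x"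
    using assms(2) by (auto simp: packing_refines_def)
  have "p'' = bind_pmf p (\<lambda>x. bind_pmf (q x) q')" by (simp add: q q' bind_assoc_pmf)
  moreover have "G'' y \<subseteq> G x" if "x \<in> set_pmf p" "y \<in> set_pmf (bind_pmf (q x) q')" for x y
  proof -
    obtain z where z: "z \<in> set_pmf (q x)" "y \<in> set_pmf (q' z)" using \<open>y \<in> _\<close> by auto
    have "z \<in> set_pmf p'" using q(1) z(1) that(1) by auto
    then show ?thesis using q'(2)[OF _ z(2)] q(2)[OF that(1) z(1)] by blast
  qed
  ultimately show ?thesis unfolding packing_refines_def by blast
qed

lemma clball_nested:
  assumes "0 < k" "k \<le> n" "y \<in> oball k x (e / 4)"
  shows "clball n y (3 / 4 * e) \<subseteq> clball k x e"
proof
  fix z assume z: "z \<in> clball n y (3 / 4 * e)"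
  have "d ((f ^^ j) x) ((f ^^ j) z) \<le> e" if "j < k" for j
  proof -
    have "d ((f ^^ j) x) ((f ^^ j) y) < e / 4" "d ((f ^^ j) y) ((f ^^ j) z) \<le> 3 / 4 * e"
      using assms z that by (simp_all add: in_oball in_clball)
    then show ?thesis using d_triangle[of "(f ^^ j) x" "(f ^^ j) z" "(f ^^ j) y"] by linarith
  qed
  then show "z \<in> clball k x e" using assms(1) by (simp add: in_clball)
qed

text \<open>The packing radius splits as \<open>e / 4\<close> plus \<open>3 / 4 * e\<close>: the
  first part pays for moving the centre within its neighbourhood, the second remains as a separation
  radius.\<close>

lemma siblings_separated:
  assumes "0 < e" "0 < m x" "0 < m x'" "clball (m x) x e \<inter> clball (m x') x' e = {}"
    and "y \<in> oball (m x) x (e / 4)" "m x \<le> n"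
  shows "clball n y (3 / 4 * e) \<inter> oball (m x') x' (e / 4) = {}"
proof -
  have "oball (m x') x' (e / 4) \<subseteq> clball (m x') x' e"
    using assms(1,3) by (force simp: in_oball in_clball intro: less_imp_le)
  then show ?thesis using clball_nested[OF assms(2,6,5)] assms(4) by blast
qed

text \<open>The neighbourhood of each atom meets \<open>K\<close>, so \<open>core\<close> allows a
  new packing distribution inside it, which replaces the atom.\<close>

lemma packing_state_step:
  assumes e: "0 < e" and lam: "lam' < lam"
    and core: "\<And>G. open G \<Longrightarrow> G \<inter> K \<noteq> {} \<Longrightarrow> BSP_lim d f \<phi> (G \<inter> K) lam e \<noteq> 0"
    and st: "packing_state K lam' e i (p, m, G)"
  shows "\<exists>p' m' G'. packing_state K lam' e (Suc i) (p', m', G') \<and> packing_refines (p, G) (p', G')"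
proof -
  have fin: "finite (set_pmf p)" and pK: "set_pmf p \<subseteq> K"
    and node: "\<And>x. x \<in> set_pmf p \<Longrightarrow> i < m x \<and> open (G x) \<and> x \<in> G x"
    and sep: "\<And>x x' y n. x \<in> set_pmf p \<Longrightarrow> x' \<in> set_pmf p \<Longrightarrow> x \<noteq> x' \<Longrightarrow> y \<in> G x \<Longrightarrow> m x \<le> n \<Longrightarrow>
       clball n y (3 / 4 * e) \<inter> G x' = {}"
    using st by (auto simp: packing_state_def)
  \<comment> \<open>The lower bound on the new times serves two purposes: \<open>Suc (Suc i)\<close>
    yields the time clause of the next state, and \<open>m x\<close> brings the new times into the
    range of the parent's separation clause.\<close>
  have "\<exists>q k. finite (set_pmf q) \<and> set_pmf q \<subseteq> G x \<inter> K \<and>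
    (\<forall>y\<in>set_pmf q. max (Suc (Suc i)) (m x) \<le> k y \<and> 0 < k y \<and> pmf q y \<le> rweight lam' e (k y) y) \<and>
    (\<forall>y\<in>set_pmf q. \<forall>z\<in>set_pmf q. y \<noteq> z \<longrightarrow> clball (k y) y e \<inter> clball (k z) z e = {})"
    if x: "x \<in> set_pmf p" for x
  proof -
    have ne: "BSP_lim d f \<phi> (G x \<inter> K) lam e \<noteq> 0" using node[OF x] pK x by (intro core) auto
    show ?thesis by (rule packing_pmf[OF e lam ne, of "max (Suc (Suc i)) (m x)"]) blast
  qed
  then have "\<forall>x\<in>set_pmf p. \<exists>qk. finite (set_pmf (fst qk)) \<and> set_pmf (fst qk) \<subseteq> G x \<inter> K \<and>
    (\<forall>y\<in>set_pmf (fst qk). max (Suc (Suc i)) (m x) \<le> snd qk y \<and> 0 < snd qk y \<and>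
       pmf (fst qk) y \<le> rweight lam' e (snd qk y) y) \<and>
    (\<forall>y\<in>set_pmf (fst qk). \<forall>z\<in>set_pmf (fst qk). y \<noteq> z \<longrightarrow>
       clball (snd qk y) y e \<inter> clball (snd qk z) z e = {})"
    by (simp only: split_paired_Ex fst_conv snd_conv) (rule ballI)
  from bchoice[OF this] obtain qk where qk: "\<forall>x\<in>set_pmf p.
      finite (set_pmf (fst (qk x))) \<and> set_pmf (fst (qk x)) \<subseteq> G x \<inter> K \<and>
    (\<forall>y\<in>set_pmf (fst (qk x)). max (Suc (Suc i)) (m x) \<le> snd (qk x) y \<and> 0 < snd (qk x) y \<and>
       pmf (fst (qk x)) y \<le> rweight lam' e (snd (qk x) y) y) \<and>
    (\<forall>y\<in>set_pmf (fst (qk x)). \<forall>z\<in>set_pmf (fst (qk x)). y \<noteq> z \<longrightarrow>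
       clball (snd (qk x) y) y e \<inter> clball (snd (qk x) z) z e = {})" ..
  define q where "q x = fst (qk x)" for x
  define k where "k x = snd (qk x)" for x
  have q: "finite (set_pmf (q x))" "set_pmf (q x) \<subseteq> G x \<inter> K" if "x \<in> set_pmf p" for x
    using bspec[OF qk that] by (simp_all add: q_def)
  have k: "Suc (Suc i) \<le> k x y" "m x \<le> k x y" "0 < k x y" "pmf (q x) y \<le> rweight lam' e (k x y) y"
    if "x \<in> set_pmf p" "y \<in> set_pmf (q x)" for x y
    using bspec[OF qk that(1)] that(2) by (simp_all add: q_def k_def)
  have disj: "clball (k x y) y e \<inter> clball (k x z) z e = {}"
    if "x \<in> set_pmf p" "y \<in> set_pmf (q x)" "z \<in> set_pmf (q x)" "y \<noteq> z" for x y z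
    using bspec[OF qk that(1)] that(2-4) by (simp add: q_def k_def)
  have uniq: "x = x'" if "x \<in> set_pmf p" "x' \<in> set_pmf p" "y \<in> G x" "y \<in> G x'" for x x' y
  proof (rule ccontr)
    assume "x \<noteq> x'"
    then have "clball (m x) y (3 / 4 * e) \<inter> G x' = {}" using sep that by blast
    moreover have "0 < m x" using node[OF that(1)] by simp
    then have "y \<in> clball (m x) y (3 / 4 * e)" using e by (simp add: in_clball)
    ultimately show False using that(4) by blast
  qed
  \<comment> \<open>Neighbourhoods of distinct atoms are disjoint, so a point determines its parent;
    hence times and neighbourhoods of the new state can be functions of the point alone.\<close>
  define par where "par y = (SOME x. x \<in> set_pmf p \<and> y \<in> G x)" for y
  have par: "par y = x" if "x \<in> set_pmf p" "y \<in> G x" for x y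
    unfolding par_def using that uniq by (intro some_equality) auto
  define p' where "p' = bind_pmf p q"
  define m' where "m' y = k (par y) y" for y
  define G' where "G' y = G (par y) \<inter> oball (m' y) y (e / 4)" for y
  have p': "\<exists>x\<in>set_pmf p. par y = x \<and> y \<in> set_pmf (q x) \<and> y \<in> G x" if "y \<in> set_pmf p'" for y
  proof -
    obtain x where x: "x \<in> set_pmf p" "y \<in> set_pmf (q x)" using \<open>y \<in> set_pmf p'\<close> by (auto simp: p'_def)
    then show ?thesis using q(2)[OF x(1)] par[OF x(1)] by blast
  qed
  have "packing_state K lam' e (Suc i) (p', m', G')"
    unfolding packing_state_def prod.case
  proof (intro conjI ballI impI allI)
    show "finite (set_pmf p')" using fin q(1) by (simp add: p'_def)
    show "set_pmf p' \<subseteq> K" using q(2) by (auto simp: p'_def)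
  next
    fix y assume "y \<in> set_pmf p'"
    then obtain x where x: "x \<in> set_pmf p" "par y = x" "y \<in> set_pmf (q x)" "y \<in> G x" using p' by blast
    have m': "m' y = k x y" by (simp add: m'_def x)
    note kx = k[OF x(1,3), folded m']
    show "Suc i < m' y" using kx(1) by simp
    show "open (G' y)" unfolding G'_def x(2) using node[OF x(1)] open_oball[OF kx(3)] by blast
    show "y \<in> G' y" using x(4) center_in_oball[OF kx(3)] e by (simp add: G'_def x(2))
    show "G' y \<subseteq> oball (m' y) y (e / 4)" by (simp add: G'_def)
    \<comment> \<open>The mass of \<open>y\<close> in \<open>p'\<close> is an average over
      \<open>p\<close> in which only the parent of \<open>y\<close> contributes; each term is
      bounded by the weight of \<open>y\<close>, and so is the average.\<close>
    have "pmf (q z) y \<le> rweight lam' e (m' y) y" if z: "z \<in> set_pmf p" for z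
    proof (cases "y \<in> set_pmf (q z)")
      case True
      then have "z = x" using q(2)[OF z] par[OF z] x(2) by blast
      then show ?thesis using kx(4) by simp
    next
      case False
      then show ?thesis by (simp add: set_pmf_iff rweight_def)
    qed
    then have "AE z in measure_pmf p. pmf (q z) y \<le> rweight lam' e (m' y) y" by (rule AE_pmfI)
    then have "(\<integral>z. pmf (q z) y \<partial>measure_pmf p) \<le> (\<integral>z. rweight lam' e (m' y) y \<partial>measure_pmf p)"
      by (intro integral_mono_AE measure_pmf.integrable_const_bound[where B = 1 and f = "\<lambda>z. pmf (q z) y"])
        (auto simp: pmf_le_1)
    then show "pmf p' y \<le> rweight lam' e (m' y) y" by (simp add: p'_def pmf_bind)
  next
    fix y1 y2 y n
    assume y1: "y1 \<in> set_pmf p'" and y2: "y2 \<in> set_pmf p'" and "y1 \<noteq> y2" and y: "y \<in> G' y1" and n: "m' y1 \<le> n"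
    obtain x1 where x1: "x1 \<in> set_pmf p" "par y1 = x1" "y1 \<in> set_pmf (q x1)" using p'[OF y1] by blast
    obtain x2 where x2: "x2 \<in> set_pmf p" "par y2 = x2" "y2 \<in> set_pmf (q x2)" using p'[OF y2] by blast
    have m1: "m' y1 = k x1 y1" and m2: "m' y2 = k x2 y2" by (simp_all add: m'_def x1 x2)
    show "clball n y (3 / 4 * e) \<inter> G' y2 = {}"
    \<comment> \<open>With different parents the separation is inherited at full radius; with a
      common parent it comes from the disjoint packing balls.\<close>
    proof (cases "x1 = x2")
      case False
      have "y \<in> G x1" using y by (simp add: G'_def x1)
      moreover have "m x1 \<le> n" using k(2)[OF x1(1,3)] n m1 by simp
      ultimately have "clball n y (3 / 4 * e) \<inter> G x2 = {}" by (rule sep[OF x1(1) x2(1) False])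
      then show ?thesis by (auto simp: G'_def x2)
    next
      case True
      have "clball (m' y1) y1 e \<inter> clball (m' y2) y2 e = {}"
        unfolding m1 m2 using disj[OF x1(1,3)] x2(3) True \<open>y1 \<noteq> y2\<close> by blast
      then have "clball n y (3 / 4 * e) \<inter> oball (m' y2) y2 (e / 4) = {}"
        using e y n k(3)[OF x1(1,3)] k(3)[OF x2(1,3)]
        by (intro siblings_separated[where x = y1]) (auto simp: m1 m2 G'_def)
      then show ?thesis by (auto simp: G'_def)
    qed
  qed
  moreover have "packing_refines (p, G) (p', G')"
    unfolding packing_refines_def prod.case
  proof (intro exI conjI ballI)
    show "p' = bind_pmf p q" by (simp add: p'_def)
    fix x y assume x: "x \<in> set_pmf p" "y \<in> set_pmf (q x)"
    then have "par y = x" using q(2)[OF x(1)] by (intro par) auto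
    then show "G' y \<subseteq> G x" by (simp add: G'_def)
  qed
  ultimately show ?thesis by blast
qed

lemma packing_state_initial:
  assumes e: "0 < e" and lam: "lam' < lam"
    and core: "\<And>G. open G \<Longrightarrow> G \<inter> K \<noteq> {} \<Longrightarrow> BSP_lim d f \<phi> (G \<inter> K) lam e \<noteq> 0"
    and K: "K \<noteq> {}"
  shows "\<exists>p m G. packing_state K lam' e 0 (p, m, G)"
proof -
  have ne: "BSP_lim d f \<phi> K lam e \<noteq> 0" using core[of UNIV] K by simp
  obtain q m where q: "finite (set_pmf q)" "set_pmf q \<subseteq> K"
    "\<And>x. x \<in> set_pmf q \<Longrightarrow> 1 \<le> m x \<and> 0 < m x \<and> pmf q x \<le> rweight lam' e (m x) x"
    "\<And>x y. x \<in> set_pmf q \<Longrightarrow> y \<in> set_pmf q \<Longrightarrow> x \<noteq> y \<Longrightarrow> clball (m x) x e \<inter> clball (m y) y e = {}"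
    by (rule packing_pmf[OF e lam ne, of 1]) blast
  have "packing_state K lam' e 0 (q, m, \<lambda>x. oball (m x) x (e / 4))"
    unfolding packing_state_def prod.case
  proof (intro conjI ballI impI allI)
    fix x x' y n
    assume "x \<in> set_pmf q" "x' \<in> set_pmf q" "x \<noteq> x'" "y \<in> oball (m x) x (e / 4)" "m x \<le> n"
    then show "clball n y (3 / 4 * e) \<inter> oball (m x') x' (e / 4) = {}"
      using e q(3)[of x] q(3)[of x'] q(4)[of x x'] by (intro siblings_separated[where x = x]) auto
  qed (use q e in \<open>auto intro: open_oball center_in_oball\<close>)
  then show ?thesis by blast
qed

lemma packing_tree:
  assumes e: "0 < e" and lam: "lam' < lam"
    and core: "\<And>G. open G \<Longrightarrow> G \<inter> K \<noteq> {} \<Longrightarrow> BSP_lim d f \<phi> (G \<inter> K) lam e \<noteq> 0"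
    and K: "K \<noteq> {}"
  shows "\<exists>p m G. (\<forall>i. packing_state K lam' e i (p i, m i, G i)) \<and>
    (\<forall>i j. i \<le> j \<longrightarrow> packing_refines (p i, G i) (p j, G j))"
proof -
  have "\<exists>s. \<forall>i. packing_state K lam' e i (s i) \<and>
      packing_refines (fst (s i), snd (snd (s i))) (fst (s (Suc i)), snd (snd (s (Suc i))))"
  proof (rule dependent_nat_choice)
    show "\<exists>s. packing_state K lam' e 0 s"
      using packing_state_initial[OF e lam core K] by blast
    fix s i assume "packing_state K lam' e i s"
    then have "packing_state K lam' e i (fst s, fst (snd s), snd (snd s))" by simp
    from packing_state_step[OF e lam core this]
    obtain p' m' G' where "packing_state K lam' e (Suc i) (p', m', G')" "packing_refines (fst s, snd (snd s)) (p', G')"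
      by blast
    then show "\<exists>s'. packing_state K lam' e (Suc i) s' \<and>
        packing_refines (fst s, snd (snd s)) (fst s', snd (snd s'))"
      by (intro exI[of _ "(p', m', G')"]) simp
  qed
  then obtain s where s: "\<And>i. packing_state K lam' e i (s i)"
    "\<And>i. packing_refines (fst (s i), snd (snd (s i))) (fst (s (Suc i)), snd (snd (s (Suc i))))" by blast
  show ?thesis
  proof (intro exI[of _ "\<lambda>i. fst (s i)"] exI[of _ "\<lambda>i. fst (snd (s i))"] exI[of _ "\<lambda>i. snd (snd (s i))"] conjI allI impI)
    show "packing_state K lam' e i (fst (s i), fst (snd (s i)), snd (snd (s i)))" for i using s(1) by simp
    show "packing_refines (fst (s i), snd (snd (s i))) (fst (s j), snd (snd (s j)))" if "i \<le> j" for i j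
      using that
    proof (induction j rule: dec_induct)
      case base
      show ?case by (rule packing_refines_refl)
    next
      case (step j)
      show ?case by (rule packing_refines_trans[OF step.IH s(2)])
    qed
  qed
qed

section \<open>The measure carried by the tree\<close>

text \<open>Almost every \<open>z\<close> is close to an atom \<open>x\<close> on each level
  \<open>i\<close>, and the ball of radius \<open>e / 2\<close> about \<open>z\<close> at the time
  of \<open>x\<close> meets no neighbourhood of another atom of that level. Its mass is therefore at
  most that of \<open>x\<close>. These times exceed \<open>i\<close>, so the bound holds infinitely
  often, which is what an upper limit needs.\<close>

lemma upper_entropy_ge_of_BSP_outer_nonzero:
  assumes K: "compact K" and e: "0 < e" and lam: "0 \<le> lam'" "lam' < lam"
    and nonzero: "BSP_outer d f \<phi> K lam e \<noteq> 0"
  obtains \<mu> where "\<mu> \<in> borel_probs" "measure \<mu> K = 1" "ennreal lam' \<le> upper_entropy d f \<phi> \<mu> (e / 2)"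
proof -
  obtain K' where K': "K' \<subseteq> K" "K' \<noteq> {}"
    and core: "\<And>G. open G \<Longrightarrow> G \<inter> K' \<noteq> {} \<Longrightarrow> BSP_lim d f \<phi> (G \<inter> K') lam e \<noteq> 0"
    by (rule locally_non_negligible_core[OF nonzero]) blast
  have "\<exists>p m G. (\<forall>i. packing_state K' lam' e i (p i, m i, G i)) \<and>
      (\<forall>i j. i \<le> j \<longrightarrow> packing_refines (p i, G i) (p j, G j))"
    by (rule packing_tree[OF e lam(2) _ K'(2)]) (rule core)
  then obtain p :: "nat \<Rightarrow> 'a pmf" and m G where
    st': "\<forall>i. packing_state K' lam' e i (p i, m i, G i)"
    and ref': "\<forall>i j. i \<le> j \<longrightarrow> packing_refines (p i, G i) (p j, G j)"
    by (elim exE conjE)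
  note st = st'[rule_format] and ref = ref'[rule_format]
  have fin: "finite (set_pmf (p i))" and pK: "set_pmf (p i) \<subseteq> K" for i
    using st[of i] K'(1) by (auto simp: packing_state_def)
  have node: "i < m i x" "x \<in> G i x" "G i x \<subseteq> oball (m i x) x (e / 4)"
    "pmf (p i) x \<le> rweight lam' e (m i x) x" if "x \<in> set_pmf (p i)" for i x
    using st[of i] that by (auto simp: packing_state_def)
  have sep: "clball (m i x) x (3 / 4 * e) \<inter> G i x' = {}"
    if "x \<in> set_pmf (p i)" "x' \<in> set_pmf (p i)" "x \<noteq> x'" for i x x'
    using st[of i] that node(2)[OF that(1)] by (simp add: packing_state_def)
  obtain \<mu> where \<mu>: "\<mu> \<in> borel_probs"
    "\<And>U w. open U \<Longrightarrow> \<forall>\<^sub>F j in sequentially. measure_pmf.prob (p j) U \<le> w \<Longrightarrow> measure \<mu> U \<le> w"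
    by (rule pmf_weak_limit[of p]) blast
  \<comment> \<open>Closed balls replace the open neighbourhoods, since full mass passes to the
    limit on closed sets.\<close>
  define D where "D i = (\<Union>x\<in>set_pmf (p i). clball (m i x) x (e / 4))" for i
  have closedD: "closed (D i)" for i
    unfolding D_def
  proof (intro closed_UN fin ballI closed_clball)
    show "0 < m i x" if "x \<in> set_pmf (p i)" for x using node(1)[OF that] by simp
  qed
  have supp: "set_pmf (p j) \<subseteq> D i" if ij: "i \<le> j" for i j
  proof
    fix y assume y: "y \<in> set_pmf (p j)"
    obtain q where q: "p j = bind_pmf (p i) q" "\<forall>x\<in>set_pmf (p i). \<forall>y\<in>set_pmf (q x). G j y \<subseteq> G i x"
      using ref[OF ij] by (auto simp: packing_refines_def)
    obtain x where x: "x \<in> set_pmf (p i)" "y \<in> set_pmf (q x)" using y q(1) by auto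
    have "0 < m i x" using node(1)[OF x(1)] by simp
    moreover have "y \<in> oball (m i x) x (e / 4)" using q(2) x node(2)[OF y] node(3)[OF x(1)] by blast
    ultimately have "y \<in> clball (m i x) x (e / 4)" by (auto simp: in_oball in_clball intro: less_imp_le)
    then show "y \<in> D i" using x(1) by (auto simp: D_def)
  qed
  have D1: "measure \<mu> (D i) = 1" for i
  proof (rule measure_limit_full[OF \<mu> closedD])
    show "\<forall>\<^sub>F j in sequentially. set_pmf (p j) \<subseteq> D i"
      using eventually_ge_at_top[of i] by eventually_elim (rule supp)
  qed
  have "AE z in \<mu>. \<forall>i. z \<in> D i"
    unfolding AE_all_countable using AE_in_if_measure_1[OF \<mu>(1) _ D1] closedD by simp
  then have "AE z in \<mu>. ereal lam' \<le> limsup (\<lambda>n. - elog (measure \<mu> (oball n z (e / 2))) / ereal (S n z))"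
  proof eventually_elim
    case (elim z)
    show ?case
    proof (rule le_limsup_if_infinitely_often)
      fix i
      obtain x where x: "x \<in> set_pmf (p i)" "z \<in> clball (m i x) x (e / 4)" using elim by (auto simp: D_def)
      define n where "n = m i x"
      have n: "0 < n" "i < n" using node(1)[OF x(1)] by (auto simp: n_def)
      have sub: "oball n z (e / 2) \<subseteq> clball n x (3 / 4 * e)"
      proof
        fix y assume y: "y \<in> oball n z (e / 2)"
        have "d ((f ^^ j) x) ((f ^^ j) y) \<le> 3 / 4 * e" if "j < n" for j
        proof -
          have "d ((f ^^ j) x) ((f ^^ j) z) \<le> e / 4" "d ((f ^^ j) z) ((f ^^ j) y) < e / 2"
            using x(2) y that n by (simp_all add: in_oball in_clball n_def)
          then show ?thesis using d_triangle[of "(f ^^ j) x" "(f ^^ j) y" "(f ^^ j) z"] by linarith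
        qed
        then show "y \<in> clball n x (3 / 4 * e)" using n by (simp add: in_clball)
      qed
      have "measure_pmf.prob (p j) (oball n z (e / 2)) \<le> pmf (p i) x" if j: "i \<le> j" for j
      proof -
        obtain q where q: "p j = bind_pmf (p i) q" "\<forall>x\<in>set_pmf (p i). \<forall>y\<in>set_pmf (q x). G j y \<subseteq> G i x"
          using ref[OF j] by (auto simp: packing_refines_def)
        have "emeasure (measure_pmf (p j)) (oball n z (e / 2))
            = (\<integral>\<^sup>+ x'. emeasure (measure_pmf (q x')) (oball n z (e / 2)) \<partial>measure_pmf (p i))"
          by (simp add: q(1))
        \<comment> \<open>Mass found in the ball at stage \<open>j\<close> must have passed through
          \<open>x\<close> at stage \<open>i\<close>: descendants of any other atom stay in a
          neighbourhood that the ball avoids.\<close>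
        also have "\<dots> \<le> (\<integral>\<^sup>+ x'. indicator {x} x' \<partial>measure_pmf (p i))"
        proof (rule nn_integral_mono_AE, rule AE_pmfI)
          fix x' assume x': "x' \<in> set_pmf (p i)"
          show "emeasure (measure_pmf (q x')) (oball n z (e / 2)) \<le> indicator {x} x'"
          proof (cases "x' = x")
            case True
            then show ?thesis by (simp add: measure_pmf.emeasure_le_1)
          next
            case False
            have "y \<notin> oball n z (e / 2)" if y: "y \<in> set_pmf (q x')" for y
            proof -
              have "y \<in> set_pmf (p j)" using q(1) x' y by auto
              then have "y \<in> G i x'" using node(2) q(2) x' y by blast
              then show ?thesis using sep[OF x(1) x'] False sub by (auto simp: n_def)
            qed
            then have "emeasure (measure_pmf (q x')) (oball n z (e / 2)) = 0"
              by (auto simp: measure_pmf.emeasure_eq_measure measure_pmf_zero_iff)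
            then show ?thesis by simp
          qed
        qed
        also have "\<dots> = ennreal (pmf (p i) x)" by (simp add: emeasure_pmf_single)
        finally show ?thesis by (simp add: measure_pmf.emeasure_eq_measure)
      qed
      from eventually_mono[OF eventually_ge_at_top[of i] this]
      have "measure \<mu> (oball n z (e / 2)) \<le> pmf (p i) x" by (rule \<mu>(2)[OF open_oball[OF n(1)]])
      also have "\<dots> \<le> rweight lam' e n x" using node(4)[OF x(1)] by (simp add: n_def)
      \<comment> \<open>The weight contains the supremum of \<open>S n\<close> over a ball
        containing \<open>z\<close>, so there is no loss by a factor here.\<close>
      also have "\<dots> \<le> exp (- lam' * S n z)"
      proof -
        have "z \<in> oball n x e" using x(2) n(1) e by (force simp: in_oball in_clball n_def)
        then have "S n z \<le> (SUP y\<in>oball n x e. S n y)" by (rule S_le_SUP)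
        then show ?thesis using lam(1) by (simp add: rweight_def mult_left_mono)
      qed
      finally have "ereal lam' \<le> - elog (measure \<mu> (oball n z (e / 2))) / ereal (S n z)"
        using n(1) by (intro neg_elog_divide_ge S_pos) auto
      then show "\<exists>n\<ge>i. ereal lam' \<le> - elog (measure \<mu> (oball n z (e / 2))) / ereal (S n z)"
        using n(2) by (intro exI[of _ n]) simp
    qed
  qed
  then have "ennreal lam' \<le> upper_entropy d f \<phi> \<mu> (e / 2)"
    unfolding upper_entropy_def using \<mu>(1) by (intro le_nn_integral_e2ennreal borel_probsD(1))
  moreover have "measure \<mu> K = 1"
    by (rule measure_limit_full[OF \<mu> closed_compact[OF K]]) (use pK in auto)
  ultimately show ?thesis using that \<mu>(1) by blast
qed

end

section \<open>Comparison of the upper limits\<close>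

lemma eventually_ln_scaled_le:
  fixes c \<theta> :: real
  assumes "0 < c" "1 < \<theta>"
  shows "\<forall>\<^sub>F e in at_right 0. 0 < ln (1 / e) \<and> 0 < ln (1 / (c * e)) \<and> ln (1 / e) \<le> \<theta> * ln (1 / (c * e))"
proof -
  \<comment> \<open>The three thresholds correspond, in this order, to the three inequalities
    claimed.\<close>
  have "\<forall>\<^sub>F e in at_right 0. ln e \<le> min (-1) (min (- ln c - 1) (- (\<theta> * ln c / (\<theta> - 1))))"
    using ln_at_0 by (simp only: filterlim_at_bot)
  then show ?thesis
    using eventually_at_right_less[of "0::real"]
  proof eventually_elim
    case (elim e)
    have eq: "ln (1 / e) = - ln e" "ln (1 / (c * e)) = - ln c - ln e"
      using elim(2) assms(1) by (simp_all add: ln_div ln_mult)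
    have "ln e \<le> - (\<theta> * ln c / (\<theta> - 1))" using elim(1) by simp
    then have "(\<theta> - 1) * ln e \<le> (\<theta> - 1) * - (\<theta> * ln c / (\<theta> - 1))"
      using assms(2) by (intro mult_left_mono) auto
    also have "\<dots> = - (\<theta> * ln c)" using assms(2) by simp
    finally have "(\<theta> - 1) * ln e \<le> - (\<theta> * ln c)" .
    then show ?case using elim(1) unfolding eq by (simp add: algebra_simps)
  qed
qed

text \<open>Rescaling by \<open>c\<close> changes the logarithm by an additive constant, hence by a
  factor tending to 1, and \<open>\<theta>\<close> can be taken as close to 1 as desired.\<close>

lemma Limsup_scaled_le:
  fixes F G :: "real \<Rightarrow> ereal"
  assumes c: "0 < c" and G: "\<And>e. 0 < e \<Longrightarrow> 0 \<le> G e"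
    and le: "\<And>\<theta>::real. 1 < \<theta> \<Longrightarrow> \<forall>\<^sub>F e in at_right 0. F (c * e) \<le> ereal \<theta> * G e"
  shows "Limsup (at_right 0) (\<lambda>e. F e / ereal (ln (1 / e))) \<le> Limsup (at_right 0) (\<lambda>e. G e / ereal (ln (1 / e)))"
    (is "?F \<le> ?G")
proof (rule dense_ge)
  fix y assume y: "?G < y"
  have pos: "\<forall>\<^sub>F e::real in at_right 0. 0 < ln (1 / e)"
    using eventually_ln_scaled_le[of 1 2] by (auto elim: eventually_mono)
  have "0 \<le> ?G"
  proof (rule le_Limsup)
    show "\<forall>\<^sub>F e in at_right 0. 0 \<le> G e / ereal (ln (1 / e))"
      using pos eventually_at_right_less[of "0::real"]
      by eventually_elim (simp add: G)
  qed simp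
  show "?F \<le> y"
  proof (cases y)
    case (real C)
    obtain D where D: "?G < ereal D" "ereal D < ereal C" using ereal_dense2[of ?G "ereal C"] y real by auto
    have "0 < D" using \<open>0 \<le> ?G\<close> D(1) by (metis ereal_less(2) le_less_trans)
    have "D < C" using D(2) by simp
    \<comment> \<open>The room between \<open>D\<close> and \<open>C\<close> is split evenly: one
      factor for the hypothesis, one for the ratio of the logarithms.\<close>
    define \<theta> where "\<theta> = sqrt (C / D)"
    have \<theta>: "1 < \<theta>" "\<theta> * \<theta> * D = C" using \<open>0 < D\<close> \<open>D < C\<close> by (auto simp: \<theta>_def)
    have "\<forall>\<^sub>F e in at_right 0. F (c * e) / ereal (ln (1 / (c * e))) \<le> ereal C"
      using le[OF \<theta>(1)] Limsup_lessD[OF D(1)] eventually_ln_scaled_le[OF c \<theta>(1)]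
    proof eventually_elim
      case (elim e)
      have "G e \<le> ereal (ln (1 / e)) * ereal D"
        using elim(2,3) by (subst ereal_divide_le_pos[symmetric]) (auto intro: less_imp_le)
      then have "F (c * e) \<le> ereal \<theta> * (ereal (ln (1 / e)) * ereal D)"
        using elim(1) \<theta>(1) by (meson ereal_less_eq(5) ereal_mult_left_mono less_imp_le order_trans zero_less_one)
      also have "\<dots> \<le> ereal (\<theta> * (\<theta> * ln (1 / (c * e)) * D))"
        using elim(3) \<theta>(1) \<open>0 < D\<close> by (auto intro!: mult_left_mono mult_right_mono)
      also have "\<dots> = ereal (ln (1 / (c * e))) * ereal C"
        by (simp add: \<theta>(2)[symmetric] mult_ac)
      finally show ?case using elim(3) by (subst ereal_divide_le_pos) auto
    qed
    then have "\<forall>\<^sub>F e in filtermap ((*) c) (at_right 0). F e / ereal (ln (1 / e)) \<le> ereal C"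
      by (simp add: eventually_filtermap)
    then have "\<forall>\<^sub>F e in at_right 0. F e / ereal (ln (1 / e)) \<le> ereal C"
      using filtermap_times_pos_at_right[OF c, of 0] by simp
    then show ?thesis unfolding real by (rule Limsup_bounded)
  qed (use y in auto)
qed

lemma enn2ereal_SUP_le:
  assumes "\<And>x. x \<in> A \<Longrightarrow> g x \<le> ennreal s" "0 \<le> s"
  shows "enn2ereal (SUP x\<in>A. g x) \<le> ereal s"
proof -
  have "(SUP x\<in>A. g x) \<le> ennreal s" using assms(1) by (rule SUP_least)
  then show ?thesis using assms(2) by (simp add: less_eq_ennreal.rep_eq enn2ereal_ennreal)
qed

lemma le_enn2ereal_SUP:
  assumes "x \<in> A" "ennreal s \<le> g x" "0 \<le> s"
  shows "ereal s \<le> enn2ereal (SUP x\<in>A. g x)"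
proof -
  have "ennreal s \<le> (SUP x\<in>A. g x)" using assms(1,2) by (rule SUP_upper2)
  then show ?thesis using assms(3) by (simp add: less_eq_ennreal.rep_eq enn2ereal_ennreal)
qed

lemma le_ereal_mult_Inf:
  assumes \<theta>: "0 < \<theta>" and "\<And>l. P l \<Longrightarrow> h \<le> ereal (\<theta> * l)"
  shows "h \<le> ereal \<theta> * Inf {ereal l | l. P l}"
proof -
  have "h / ereal \<theta> \<le> Inf {ereal l | l. P l}"
    using assms by (intro Inf_greatest) (auto simp: ereal_divide_le_pos)
  then show ?thesis using \<theta> by (simp add: ereal_divide_le_pos)
qed

context bs_system
begin

lemma comparable_eventually:
  assumes "1 < \<theta>" "0 < c"
  shows "\<forall>\<^sub>F e in at_right 0. 0 < e \<and> comparable \<theta> (c * e)"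
proof -
  obtain e0 where e0: "0 < e0" "comparable \<theta> e0" using comparable_exists[OF assms(1)] .
  have "\<forall>\<^sub>F e in at_right 0. 0 < e \<and> e < e0 / c"
    using e0(1) assms(2) unfolding eventually_at_right_field by (intro exI[of _ "e0 / c"]) auto
  then show ?thesis
  proof eventually_elim
    case (elim e)
    then show ?case using assms(2) by (auto intro!: comparable_mono[OF e0(2)] simp: field_simps)
  qed
qed

lemma BS_crit_nonneg: "compact K \<Longrightarrow> K \<noteq> {} \<Longrightarrow> 0 < e \<Longrightarrow> 0 \<le> BS_crit d f \<phi> K e"
  unfolding BS_crit_def
  by (rule Inf_greatest, elim CollectE exE conjE) (simp add: BS_outer_zero_imp_nonneg)

lemma BSP_crit_nonneg: "K \<noteq> {} \<Longrightarrow> 0 < e \<Longrightarrow> 0 \<le> BSP_crit d f \<phi> K e"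
  unfolding BSP_crit_def
  by (rule Inf_greatest, elim CollectE exE conjE) (simp add: BSP_outer_zero_imp_nonneg)

lemma upper_BSmdim_eq:
  assumes K: "compact K" "K \<noteq> {}"
  shows "upper_BSmdim d f \<phi> K = Limsup (at_right 0) (\<lambda>e.
    enn2ereal (SUP \<mu>\<in>{\<mu> \<in> borel_probs. measure \<mu> K = 1}. lower_entropy d f \<phi> \<mu> e) / ereal (ln (1 / e)))"
proof -
  define H where "H e = enn2ereal (SUP \<mu>\<in>{\<mu> \<in> borel_probs. measure \<mu> K = 1}. lower_entropy d f \<phi> \<mu> e)" for e
  have "Limsup (at_right 0) (\<lambda>e. BS_crit d f \<phi> K e / ereal (ln (1 / e))) \<le> Limsup (at_right 0) (\<lambda>e. H e / ereal (ln (1 / e)))"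
  proof (rule Limsup_scaled_le[of 4])
    fix \<theta> :: real assume \<theta>: "1 < \<theta>"
    \<comment> \<open>The lower entropy estimate loses the fourth power of its comparison
      factor.\<close>
    define t where "t = root 4 \<theta>"
    have t: "1 < t" "t ^ 4 = \<theta>" using \<theta> by (simp_all add: t_def)
    show "\<forall>\<^sub>F e in at_right 0. BS_crit d f \<phi> K (4 * e) \<le> ereal \<theta> * H e"
      using comparable_eventually[OF t(1) zero_less_numeral[of "num.Bit0 num.One"]]
    proof eventually_elim
      case (elim e)
      show ?case
      proof (rule ccontr)
        assume "\<not> ?case"
        then obtain lam where lam: "ereal \<theta> * H e < ereal lam" "ereal lam < BS_crit d f \<phi> K (4 * e)"
          using ereal_dense2[of "ereal \<theta> * H e"] by (auto simp: not_le)
        have "0 \<le> ereal \<theta> * H e" using \<theta> by (simp add: H_def)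
        then have "0 < lam" using lam(1) by (metis ereal_less(2) le_less_trans)
        have "BS_outer d f \<phi> lam K (4 * e) \<noteq> 0"
        proof
          assume "BS_outer d f \<phi> lam K (4 * e) = 0"
          then have "BS_crit d f \<phi> K (4 * e) \<le> ereal lam" unfolding BS_crit_def by (intro Inf_lower) blast
          then show False using lam(2) by simp
        qed
        then obtain \<mu> where \<mu>: "\<mu> \<in> borel_probs" "measure \<mu> K = 1" "ennreal (lam / t ^ 4) \<le> lower_entropy d f \<phi> \<mu> e"
          using lower_entropy_ge_of_BS_outer_nonzero[OF K _ t(1) _ \<open>0 < lam\<close>] elim by blast
        have "ereal (lam / \<theta>) \<le> H e"
          unfolding H_def using \<mu> \<open>0 < lam\<close> \<theta> t(2) by (intro le_enn2ereal_SUP[of \<mu>]) auto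
        then have "ereal \<theta> * ereal (lam / \<theta>) \<le> ereal \<theta> * H e"
          using \<theta> by (intro ereal_mult_left_mono) auto
        then show False using lam(1) \<theta> by simp
      qed
    qed
  qed (simp_all add: H_def)
  moreover have "Limsup (at_right 0) (\<lambda>e. H e / ereal (ln (1 / e))) \<le> Limsup (at_right 0) (\<lambda>e. BS_crit d f \<phi> K e / ereal (ln (1 / e)))"
  proof (rule Limsup_scaled_le[of 2])
    fix \<theta> :: real assume \<theta>: "1 < \<theta>"
    show "\<forall>\<^sub>F e in at_right 0. H (2 * e) \<le> ereal \<theta> * BS_crit d f \<phi> K e"
      using comparable_eventually[OF \<theta> zero_less_numeral[of "num.Bit0 num.One"]]
    proof eventually_elim
      case (elim e)
      show ?case
        unfolding BS_crit_def
      proof (rule le_ereal_mult_Inf)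
        fix lam assume zero: "BS_outer d f \<phi> lam K e = 0"
        have "0 \<le> lam" using BS_outer_zero_imp_nonneg[OF K _ zero] elim by blast
        then show "H (2 * e) \<le> ereal (\<theta> * lam)"
          unfolding H_def using \<theta> elim zero K
          by (intro enn2ereal_SUP_le) (auto intro!: lower_entropy_le_of_BS_outer_zero[of _ K])
      qed (use \<theta> in simp)
    qed
  qed (simp_all add: BS_crit_nonneg K)
  ultimately show ?thesis unfolding upper_BSmdim_def H_def by (rule order_antisym)
qed

lemma upper_BSPmdim_eq:
  assumes K: "compact K" "K \<noteq> {}"
  shows "upper_BSPmdim d f \<phi> K = Limsup (at_right 0) (\<lambda>e.
    enn2ereal (SUP \<mu>\<in>{\<mu> \<in> borel_probs. measure \<mu> K = 1}. upper_entropy d f \<phi> \<mu> e) / ereal (ln (1 / e)))"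
proof -
  define H where "H e = enn2ereal (SUP \<mu>\<in>{\<mu> \<in> borel_probs. measure \<mu> K = 1}. upper_entropy d f \<phi> \<mu> e)" for e
  have H0: "0 \<le> H e" for e by (simp add: H_def)
  have "Limsup (at_right 0) (\<lambda>e. BSP_crit d f \<phi> K e / ereal (ln (1 / e))) \<le> Limsup (at_right 0) (\<lambda>e. H e / ereal (ln (1 / e)))"
  proof (rule Limsup_scaled_le[of 2])
    fix \<theta> :: real assume \<theta>: "1 < \<theta>"
    show "\<forall>\<^sub>F e in at_right 0. BSP_crit d f \<phi> K (2 * e) \<le> ereal \<theta> * H e"
      using eventually_at_right_less[of "0::real"]
    proof eventually_elim
      case (elim e)
      have "BSP_crit d f \<phi> K (2 * e) \<le> H e"
      proof (rule ccontr)
        assume "\<not> ?thesis"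
        then obtain lam where lam: "H e < ereal lam" "ereal lam < BSP_crit d f \<phi> K (2 * e)"
          using ereal_dense2[of "H e"] by (auto simp: not_le)
        \<comment> \<open>A second exponent is inserted because the packing construction needs a
          strict drop from \<open>lam\<close> to \<open>lam'\<close>.\<close>
        obtain lam' where lam': "H e < ereal lam'" "ereal lam' < ereal lam"
          using ereal_dense2[OF lam(1)] by auto
        have "0 < lam'" using lam'(1) H0[of e] by (metis ereal_less(2) le_less_trans)
        have nonzero: "BSP_outer d f \<phi> K lam (2 * e) \<noteq> 0"
        proof
          assume "BSP_outer d f \<phi> K lam (2 * e) = 0"
          then have "BSP_crit d f \<phi> K (2 * e) \<le> ereal lam" unfolding BSP_crit_def by (intro Inf_lower) blast
          then show False using lam(2) by simp
        qed
        obtain \<mu> where \<mu>: "\<mu> \<in> borel_probs" "measure \<mu> K = 1" "ennreal lam' \<le> upper_entropy d f \<phi> \<mu> (2 * e / 2)"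
          by (rule upper_entropy_ge_of_BSP_outer_nonzero[OF K(1) _ _ _ nonzero, of lam'])
            (use \<open>0 < lam'\<close> lam'(2) elim in auto)
        have "ereal lam' \<le> H e"
          unfolding H_def using \<mu> \<open>0 < lam'\<close> by (intro le_enn2ereal_SUP[of \<mu>]) auto
        then show False using lam'(1) by simp
      qed
      also have "H e = ereal 1 * H e" by (simp add: one_ereal_def[symmetric])
      also have "\<dots> \<le> ereal \<theta> * H e" using \<theta> H0 by (intro ereal_mult_right_mono) auto
      finally show ?case .
    qed
  qed (simp_all add: H0)
  moreover have "Limsup (at_right 0) (\<lambda>e. H e / ereal (ln (1 / e))) \<le> Limsup (at_right 0) (\<lambda>e. BSP_crit d f \<phi> K e / ereal (ln (1 / e)))"
  proof (rule Limsup_scaled_le[of 3])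
    fix \<theta> :: real assume \<theta>: "1 < \<theta>"
    show "\<forall>\<^sub>F e in at_right 0. H (3 * e) \<le> ereal \<theta> * BSP_crit d f \<phi> K e"
      using comparable_eventually[OF \<theta> zero_less_numeral[of "num.Bit1 num.One"]]
    proof eventually_elim
      case (elim e)
      show ?case
        unfolding BSP_crit_def
      proof (rule le_ereal_mult_Inf)
        fix lam assume zero: "BSP_outer d f \<phi> K lam e = 0"
        have lam: "0 \<le> lam" using BSP_outer_zero_imp_nonneg[OF K(2) _ zero] elim by blast
        show "H (3 * e) \<le> ereal (\<theta> * lam)"
        \<comment> \<open>The Borel--Cantelli bound requires an exponent strictly above
          \<open>\<theta> * lam\<close>, so a slack \<open>s\<close> is added and then
          removed.\<close>
        proof (rule ereal_le_epsilon2)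
          fix s :: real assume s: "0 < s"
          have "H (3 * e) \<le> ereal (\<theta> * lam + s)"
            unfolding H_def
          proof (rule enn2ereal_SUP_le)
            show "0 \<le> \<theta> * lam + s" using \<theta> lam s by simp
            fix \<mu> :: "'a measure" assume "\<mu> \<in> {\<mu> \<in> borel_probs. measure \<mu> K = 1}"
            then show "upper_entropy d f \<phi> \<mu> (3 * e) \<le> ennreal (\<theta> * lam + s)"
              using elim lam s zero
              by (intro upper_entropy_le_of_BSP_outer_zero[OF _ _ K(1), where lam = lam and \<theta> = \<theta>]) auto
          qed
          then show "H (3 * e) \<le> ereal (\<theta> * lam) + ereal s" by simp
        qed
      qed (use \<theta> in simp)
    qed
  qed (simp_all add: BSP_crit_nonneg K)
  ultimately show ?thesis unfolding upper_BSPmdim_def H_def by (rule order_antisym)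
qed

end

theorem theorem1p4:
  fixes f :: "'a::topological_space \<Rightarrow> 'a"
    and K :: "'a set"
    and \<phi> :: "'a \<Rightarrow> real"
  assumes "is_tds f"
    and "compact K" and "K \<noteq> {}"
    and "continuous_on UNIV \<phi>" and "\<And>x. \<phi> x > 0"
  shows "\<forall>d\<in>compatible_metrics.
      upper_BSmdim d f \<phi> K =
        Limsup (at_right 0) (\<lambda>\<epsilon>.
          enn2ereal (SUP \<mu>\<in>{\<mu> \<in> borel_probs. measure \<mu> K = 1}. lower_entropy d f \<phi> \<mu> \<epsilon>)
            / ereal (ln (1 / \<epsilon>))) \<and>
      upper_BSPmdim d f \<phi> K =
        Limsup (at_right 0) (\<lambda>\<epsilon>.
          enn2ereal (SUP \<mu>\<in>{\<mu> \<in> borel_probs. measure \<mu> K = 1}. upper_entropy d f \<phi> \<mu> \<epsilon>)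
            / ereal (ln (1 / \<epsilon>)))"
proof
  fix d :: "'a \<Rightarrow> 'a \<Rightarrow> real"
  assume "d \<in> compatible_metrics"
  then have d: "Metric_space UNIV d" "Metric_space.mtopology UNIV d = (euclidean :: 'a topology)"
    by (simp_all add: compatible_metrics_def)
  interpret bs_system d f \<phi>
    using d assms by (simp add: bs_system_def bs_system_axioms_def compact_metric_def
        compact_metric_axioms_def is_tds_def)
  show "upper_BSmdim d f \<phi> K =
        Limsup (at_right 0) (\<lambda>\<epsilon>.
          enn2ereal (SUP \<mu>\<in>{\<mu> \<in> borel_probs. measure \<mu> K = 1}. lower_entropy d f \<phi> \<mu> \<epsilon>)
            / ereal (ln (1 / \<epsilon>))) \<and>
      upper_BSPmdim d f \<phi> K =
        Limsup (at_right 0) (\<lambda>\<epsilon>.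
          enn2ereal (SUP \<mu>\<in>{\<mu> \<in> borel_probs. measure \<mu> K = 1}. upper_entropy d f \<phi> \<mu> \<epsilon>)
            / ereal (ln (1 / \<epsilon>)))"
    using upper_BSmdim_eq upper_BSPmdim_eq assms(2,3) by blast
qed

end
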